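(* The number of similar sublattices (SSLs) of a given index is the same for the lattices $A_4$ and $L$. The possible indices of SSLs of $A_4$ are precisely the squares of non-zero integers of the form $k^2+k\ell-\ell^2=\mathrm{N}(k+\ell\tau)$ with $k,\ell\in\mathbb{Z}$; moreover, all these possible indices are realized. Furthermore, there is an index preserving bijection between the primitive SSLs of $A_4$ (with index taken in $A_4$) and the primitive right ideals of $\mathbb{I}$ (with index taken in $\mathbb{I}$). When $f(m)$ denotes the number of SSLs of $A_4$ of index $m^2$ and $f^{\mathsf{pr}}(m)$ the number of primitive ones, the corresponding Dirichlet series generating functions read $$D_{A_4}(s):=\sum_{m=1}^{\infty}\frac{f(m)}{m^{2s}}=\zeta(4s)\,\frac{\zeta_{\mathbb{I}}(s)}{\zeta_K(4s)}=\frac{\zeta_K(2s)\,\zeta_K(2s-1)}{L(4s,\chi)}$$ and $$D^{\mathsf{pr}}_{A_4}(s):=\sum_{m=1}^{\infty}\frac{f^{\mathsf{pr}}(m)}{m^{2s}}=\zeta^{\mathsf{pr}}_{\mathbb{I}}(s)=\frac{\zeta_{\mathbb{I}}(s)}{\zeta_K(4s)}=\frac{\zeta_K(2s)\,\zeta_K(2s-1)}{\zeta_K(4s)}.$$ In particular, each possible index is thus also realized by a primitive SSL.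
   Context: A similarity of a Euclidean space $E$ of dimension $d$ is a linear map $S$ with $\langle Su|Sv\rangle=c\langle u|v\rangle$ for all $u,v$, for some $c>0$. For a lattice $\Gamma$ spanning $E$, a similar sublattice (SSL) of $\Gamma$ is a sublattice of the form $S\Gamma\subset\Gamma$ with $S$ such a similarity; its index is $[\Gamma:S\Gamma]=c^{d/2}$. An SSL $\Lambda\subset\Gamma$ is primitive if $\Lambda\subset m\Gamma$ with $m\in\mathbb{N}$ implies $m=1$. $A_4$ is the root lattice $\{x\in\mathbb{Z}^5: x_1+\dots+x_5=0\}$, a lattice in a $4$-dimensional Euclidean hyperplane. Let $K=\mathbb{Q}(\sqrt5)$, with nontrivial Galois automorphism $\alpha\mapsto\alpha'$ ($\sqrt5\mapsto-\sqrt5$), norm $\mathrm{N}(\alpha)=\alpha\alpha'$, and let $\tau=(1+\sqrt5)/2$, so that $\mathbb{Z}[\tau]$ is the ring of integers of $K$. $\mathbb{H}(K)$ is the Hamilton quaternion algebra over $K$ with basis $1,\mathrm{i},\mathrm{j},\mathrm{k}$, $\mathrm{i}^2=\mathrm{j}^2=\mathrm{k}^2=\mathrm{i}\mathrm{j}\mathrm{k}=-1$; write $x=(x_0,x_1,x_2,x_3)=x_0+x_1\mathrm{i}+x_2\mathrm{j}+x_3\mathrm{k}$. The lattice $L\subset\mathbb{R}^4$ is $L=\langle(1,0,0,0),\tfrac12(-1,1,1,1),(0,-1,0,0),\tfrac12(0,1,\tau-1,-\tau)\rangle_{\mathbb{Z}}$. The icosian ring is the maximal order $\mathbb{I}=\langle(1,0,0,0),(0,1,0,0),\tfrac12(1,1,1,1),\tfrac12(1-\tau,\tau,0,1)\rangle_{\mathbb{Z}[\tau]}$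 of $\mathbb{H}(K)$; all its one-sided ideals are principal. An element $p\in\mathbb{I}$ is primitive if every $\alpha\in\mathbb{Z}[\tau]$ with $p\in\alpha\mathbb{I}$ is a unit of $\mathbb{Z}[\tau]$; a right ideal of $\mathbb{I}$ is primitive if it is of the form $p\mathbb{I}$ with $p\in\mathbb{I}$ primitive. $\zeta(s)$ is Riemann's zeta function, $\chi$ is the Dirichlet character with $\chi(n)=0$ for $n\equiv0$, $\chi(n)=1$ for $n\equiv\pm1$, $\chi(n)=-1$ for $n\equiv\pm2\pmod 5$, $L(s,\chi)=\sum_{m\ge1}\chi(m)m^{-s}$, and $\zeta_K(s)=\zeta(s)L(s,\chi)$ is the Dedekind zeta function of $K$. $\zeta_{\mathbb{I}}(s)=\sum_{I}[\mathbb{I}:I]^{-s}$, summed over the non-zero right ideals of $\mathbb{I}$, is the zeta function of $\mathbb{I}$, given by $\zeta_{\mathbb{I}}(s)=\zeta_K(2s)\zeta_K(2s-1)$; $\zeta^{\mathsf{pr}}_{\mathbb{I}}(s)$ is the analogous sum over the primitive right ideals only. *)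

theory Defs
  imports "HOL-Analysis.Analysis"
begin

section \<open>Spans and indices\<close>

definition span_over :: "real set \<Rightarrow> 'a::real_vector set \<Rightarrow> 'a set" where
  "span_over R B = {\<Sum>b\<in>B. c b *\<^sub>R b | c. \<forall>b\<in>B. c b \<in> R}"

text \<open>The group index; it is \<open>0\<close> if the quotient is infinite.\<close>

definition group_index :: "'a::ab_group_add set \<Rightarrow> 'a set \<Rightarrow> nat" where
  "group_index G H = card (G // {(x, y). x \<in> G \<and> y \<in> G \<and> x - y \<in> H})"

section \<open>Similar sublattices\<close>

text \<open>Every linear map on a subspace \<open>E\<close> extends to the ambient space, so a similarity of \<open>E\<close>
  is represented by a linear map of the ambient space of which only the restriction to \<open>E\<close> matters.\<close>

definition similarity_on :: "'a::euclidean_space set \<Rightarrow> ('a \<Rightarrow> 'a) \<Rightarrow> bool" where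
  "similarity_on E S \<longleftrightarrow> linear S \<and> S ` E \<subseteq> E \<and>
     (\<exists>c>0. \<forall>u\<in>E. \<forall>v\<in>E. S u \<bullet> S v = c * (u \<bullet> v))"

definition ssl :: "'a::euclidean_space set \<Rightarrow> 'a set \<Rightarrow> bool" where
  "ssl \<Gamma> \<Lambda> \<longleftrightarrow> (\<exists>S. similarity_on (span \<Gamma>) S \<and> \<Lambda> = S ` \<Gamma> \<and> \<Lambda> \<subseteq> \<Gamma>)"

definition primitive_ssl :: "'a::euclidean_space set \<Rightarrow> 'a set \<Rightarrow> bool" where
  "primitive_ssl \<Gamma> \<Lambda> \<longleftrightarrow> ssl \<Gamma> \<Lambda> \<and>
     (\<forall>m::nat. m \<ge> 1 \<and> \<Lambda> \<subseteq> (\<lambda>x. real m *\<^sub>R x) ` \<Gamma> \<longrightarrow> m = 1)"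

definition A4 :: "(real ^ 5) set" where
  "A4 = {x. (\<forall>i. x $ i \<in> \<int>) \<and> (\<Sum>i\<in>UNIV. x $ i) = 0}"

section \<open>The quadratic field\<close>

text \<open>\<open>K = \<rat>(\<surd>5)\<close> is regarded as a subfield of the real numbers.\<close>

definition tau :: real where
  "tau = (1 + sqrt 5) / 2"

definition Z_tau :: "real set" where
  "Z_tau = {of_int a + of_int b * tau | a b. True}"

definition Z_tau_unit :: "real \<Rightarrow> bool" where
  "Z_tau_unit \<alpha> \<longleftrightarrow> \<alpha> \<in> Z_tau \<and> (\<exists>\<beta>\<in>Z_tau. \<alpha> * \<beta> = 1)"

text \<open>The Galois automorphism; it is meaningful only for arguments in \<open>K\<close>.\<close>

definition K_conj :: "real \<Rightarrow> real" where
  "K_conj \<alpha> = (THE \<beta>. \<exists>a b. \<alpha> = of_rat a + of_rat b * sqrt 5 \<and> \<beta> = of_rat a - of_rat b * sqrt 5)"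

definition K_norm :: "real \<Rightarrow> real" where
  "K_norm \<alpha> = \<alpha> * K_conj \<alpha>"

section \<open>Quaternions, the lattice L and the icosian ring\<close>

text \<open>A vector with components \<open>x0, x1, x2, x3\<close> stands for the quaternion
  \<open>x0 + x1 i + x2 j + x3 k\<close>. Vector indices start at \<open>1\<close>. The Hamilton algebra over \<open>K\<close> consists
  of the vectors with all components in \<open>K\<close>. The product below is not the library's
  componentwise product on vectors.\<close>

definition qmult :: "real ^ 4 \<Rightarrow> real ^ 4 \<Rightarrow> real ^ 4" (infixl \<open>\<star>\<close> 70) where
  "x \<star> y = vector
    [x$1 * y$1 - x$2 * y$2 - x$3 * y$3 - x$4 * y$4,
     x$1 * y$2 + x$2 * y$1 + x$3 * y$4 - x$4 * y$3,
     x$1 * y$3 - x$2 * y$4 + x$3 * y$1 + x$4 * y$2,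
     x$1 * y$4 + x$2 * y$3 - x$3 * y$2 + x$4 * y$1]"

lemma vec4_nth [simp]:
  "(vector [a, b, c, d] :: real ^ 4) $ 1 = a"
  "(vector [a, b, c, d] :: real ^ 4) $ 2 = b"
  "(vector [a, b, c, d] :: real ^ 4) $ 3 = c"
  "(vector [a, b, c, d] :: real ^ 4) $ 4 = d"
  by (simp_all add: vector_def)

lemma qmult_one:
  "vector [1, 0, 0, 0] \<star> x = x" "x \<star> vector [1, 0, 0, 0] = x"
  by (simp_all add: qmult_def vec_eq_iff forall_4)

lemma qmult_relations:
  "vector [0, 1, 0, 0] \<star> vector [0, 1, 0, 0] = vector [-1, 0, 0, 0]"
  "vector [0, 0, 1, 0] \<star> vector [0, 0, 1, 0] = vector [-1, 0, 0, 0]"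
  "vector [0, 0, 0, 1] \<star> vector [0, 0, 0, 1] = vector [-1, 0, 0, 0]"
  "vector [0, 1, 0, 0] \<star> vector [0, 0, 1, 0] \<star> vector [0, 0, 0, 1] = vector [-1, 0, 0, 0]"
  by (simp_all add: qmult_def vec_eq_iff forall_4)

lemma qmult_assoc: "x \<star> y \<star> z = x \<star> (y \<star> z)"
  by (simp add: qmult_def vec_eq_iff forall_4 algebra_simps)

definition L_lattice :: "(real ^ 4) set" where
  "L_lattice = span_over \<int>
     {vector [1, 0, 0, 0],
      (1/2) *\<^sub>R vector [-1, 1, 1, 1],
      vector [0, -1, 0, 0],
      (1/2) *\<^sub>R vector [0, 1, tau - 1, -tau]}"

definition icosians :: "(real ^ 4) set" where
  "icosians = span_over Z_tau
     {vector [1, 0, 0, 0],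
      vector [0, 1, 0, 0],
      (1/2) *\<^sub>R vector [1, 1, 1, 1],
      (1/2) *\<^sub>R vector [1 - tau, tau, 0, 1]}"

definition right_ideal :: "(real ^ 4) set \<Rightarrow> bool" where
  "right_ideal I \<longleftrightarrow> I \<subseteq> icosians \<and> 0 \<in> I \<and> (\<forall>x\<in>I. \<forall>y\<in>I. x - y \<in> I) \<and>
     (\<forall>x\<in>I. \<forall>a\<in>icosians. x \<star> a \<in> I)"

definition primitive_icosian :: "real ^ 4 \<Rightarrow> bool" where
  "primitive_icosian p \<longleftrightarrow> p \<in> icosians \<and>
     (\<forall>\<alpha>\<in>Z_tau. p \<in> (\<lambda>x. \<alpha> *\<^sub>R x) ` icosians \<longrightarrow> Z_tau_unit \<alpha>)"

definition primitive_right_ideal :: "(real ^ 4) set \<Rightarrow> bool" where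
  "primitive_right_ideal I \<longleftrightarrow> right_ideal I \<and> (\<exists>p. primitive_icosian p \<and> I = (\<lambda>x. p \<star> x) ` icosians)"

section \<open>Zeta functions and generating functions\<close>

text \<open>All functions are given by their Dirichlet series, and are meaningful only where these
  converge absolutely.\<close>

definition zeta :: "complex \<Rightarrow> complex" where
  "zeta s = (\<Sum>\<^sub>\<infinity>m\<in>{1::nat..}. 1 / of_nat m powr s)"

definition chi5 :: "nat \<Rightarrow> complex" where
  "chi5 n = (if n mod 5 = 0 then 0 else if n mod 5 \<in> {1, 4} then 1 else -1)"

definition L_chi5 :: "complex \<Rightarrow> complex" where
  "L_chi5 s = (\<Sum>\<^sub>\<infinity>m\<in>{1::nat..}. chi5 m / of_nat m powr s)"

definition zeta_K :: "complex \<Rightarrow> complex" where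
  "zeta_K s = zeta s * L_chi5 s"

definition ideal_term :: "complex \<Rightarrow> (real ^ 4) set \<Rightarrow> complex" where
  "ideal_term s I = 1 / of_nat (group_index icosians I) powr s"

definition zeta_icosian :: "complex \<Rightarrow> complex" where
  "zeta_icosian s = (\<Sum>\<^sub>\<infinity>I\<in>{I. right_ideal I \<and> I \<noteq> {0}}. ideal_term s I)"

definition zeta_icosian_pr :: "complex \<Rightarrow> complex" where
  "zeta_icosian_pr s = (\<Sum>\<^sub>\<infinity>I\<in>{I. primitive_right_ideal I}. ideal_term s I)"

definition num_ssl :: "nat \<Rightarrow> nat" where
  "num_ssl m = card {\<Lambda>. ssl A4 \<Lambda> \<and> group_index A4 \<Lambda> = m\<^sup>2}"

definition num_ssl_pr :: "nat \<Rightarrow> nat" where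
  "num_ssl_pr m = card {\<Lambda>. primitive_ssl A4 \<Lambda> \<and> group_index A4 \<Lambda> = m\<^sup>2}"

definition ssl_term :: "complex \<Rightarrow> nat \<Rightarrow> complex" where
  "ssl_term s m = of_nat (num_ssl m) / of_nat m powr (2 * s)"

definition ssl_pr_term :: "complex \<Rightarrow> nat \<Rightarrow> complex" where
  "ssl_pr_term s m = of_nat (num_ssl_pr m) / of_nat m powr (2 * s)"

definition D_A4 :: "complex \<Rightarrow> complex" where
  "D_A4 s = (\<Sum>\<^sub>\<infinity>m\<in>{1::nat..}. ssl_term s m)"

definition D_A4_pr :: "complex \<Rightarrow> complex" where
  "D_A4_pr s = (\<Sum>\<^sub>\<infinity>m\<in>{1::nat..}. ssl_pr_term s m)"

end

theory Submission
  imports Defs "HOL-Number_Theory.Number_Theory"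
begin

text \<open>The lattice \<open>L\<close> is isometric to the root lattice \<open>A\<^sub>4\<close> scaled by \<open>1 / \<surd>2\<close>, so both have the same similar
  sublattices up to this similarity. Its virtue is that it consists of the icosians fixed by the \<^emph>\<open>twist\<close>
  \<open>(x\<^sub>0, x\<^sub>1, x\<^sub>2, x\<^sub>3) \<mapsto> (x\<^sub>0', x\<^sub>1', x\<^sub>3', x\<^sub>2')\<close>, an anti-automorphism of order two of the icosian ring \<open>\<I>\<close>.
  For an icosian \<open>p\<close> with twist \<open>p~\<close>, the map \<open>x \<mapsto> p x p~\<close> is thus a similarity of \<open>L\<close> into itself.

  Conversely, every similarity \<open>S\<close> of \<open>L\<close> into itself maps \<open>L\<close> onto \<open>m p L p~\<close> for some primitive icosian
  \<open>p\<close> and some positive integer \<open>m\<close> (\<open>similarity_of_Fix\<close>). Up to conjugation \<open>S\<close> is of the form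
  \<open>x \<mapsto> a r x r\<^sup>-\<^sup>1\<close> with \<open>a = S(1)\<close>; since the values on \<open>L\<close> are fixed by the twist, the right factor
  has to be proportional to the twist of the left one. The sublattice determines both \<open>m\<close> and the right
  ideal \<open>p \<I>\<close> (\<open>msl_inj\<close>), because \<open>p L p~\<close> is contained in no proper integer multiple of \<open>L\<close>
  (\<open>SL_primitive\<close>): modulo a prime the icosian ring is simple, so that \<open>p \<I> p~\<close> does not vanish modulo a
  prime unless \<open>p\<close> or \<open>p~\<close> does. Hence similar sublattices correspond to pairs of a positive integer \<open>m\<close>
  and a primitive right ideal \<open>J\<close>, primitive sublattices to those with \<open>m = 1\<close>.

  The index of \<open>m p L p~\<close> is \<open>m\<^sup>4\<close> times that of \<open>p \<I>\<close> in the icosian ring. The reason is that both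
  indices are multiplicative in \<open>p\<close>, they agree on \<open>p\<close> and its conjugate, which are conjugate
  elements of the quaternion algebra, and the product of these two is a scalar
  (\<open>multiplicative_eq_norm_square\<close>).

  It remains to count right ideals. The icosian ring is Euclidean for the absolute norm, so all right
  ideals are principal. There are \<open>N + 1\<close> of them for each prime of norm \<open>N\<close> (\<open>card_ideals_of_norm_prime\<close>),
  and counting the chains of a right ideal in one of prime norm gives the recursion of Hecke, which
  determines the number of right ideals of norm \<open>n\<close> to be the sum of the norms of the divisors of \<open>n\<close>
  (\<open>card_ideals_of_norm_eq_sigma\<close>). Summation gives \<open>\<zeta>\<^sub>K(2s) \<zeta>\<^sub>K(2s - 1)\<close>. Removing the content, which is an ideal
  of \<open>\<int>[\<tau>]\<close>, divides by \<open>\<zeta>\<^sub>K(4s)\<close> and leaves the primitive right ideals; readmitting the factor \<open>m\<close>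
  multiplies by \<open>\<zeta>(4s)\<close>. Here \<open>\<zeta>\<^sub>K\<close> enters as the sum over the ideals of \<open>\<int>[\<tau>]\<close>, which agrees with the
  product \<open>\<zeta>(s) L(s, \<chi>)\<close> by the decomposition of rational primes in \<open>\<int>[\<tau>]\<close> (\<open>zeta_K_ideals\<close>). Finally, the
  choice of a prime ideal at each step of the prime factorisation of \<open>n\<close> is free enough to construct a
  primitive icosian of any given norm (\<open>prim_exists\<close>), so every possible index belongs to a primitive
  sublattice.\<close>

section \<open>Indices of subgroups\<close>

definition add_subgroup :: "'a::ab_group_add set \<Rightarrow> bool" where
  "add_subgroup H \<longleftrightarrow> 0 \<in> H \<and> (\<forall>x\<in>H. \<forall>y\<in>H. x - y \<in> H)"

lemma add_subgroupI:
  "0 \<in> H \<Longrightarrow> (\<And>x y. x \<in> H \<Longrightarrow> y \<in> H \<Longrightarrow> x - y \<in> H) \<Longrightarrow> add_subgroup H"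
  by (simp add: add_subgroup_def)

lemma add_subgroup_0: "add_subgroup H \<Longrightarrow> 0 \<in> H"
  and add_subgroup_diff: "add_subgroup H \<Longrightarrow> x \<in> H \<Longrightarrow> y \<in> H \<Longrightarrow> x - y \<in> H"
  by (auto simp: add_subgroup_def)

lemma add_subgroup_minus: "add_subgroup H \<Longrightarrow> x \<in> H \<Longrightarrow> - x \<in> H"
  using add_subgroup_diff[of H 0 x] add_subgroup_0[of H] by simp

lemma add_subgroup_add: "add_subgroup H \<Longrightarrow> x \<in> H \<Longrightarrow> y \<in> H \<Longrightarrow> x + y \<in> H"
  using add_subgroup_diff[of H x "- y"] add_subgroup_minus[of H y] by simp

lemma add_subgroup_UNIV [simp]: "add_subgroup UNIV"
  by (simp add: add_subgroup_def)

lemma add_subgroup_image: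
  assumes "\<And>x y. f (x - y) = f x - f y" "add_subgroup H"
  shows "add_subgroup (f ` H)"
proof (rule add_subgroupI)
  show "0 \<in> f ` H"
    using assms(1)[of 0 0] add_subgroup_0[OF assms(2)] by (metis diff_self image_eqI)
next
  fix x y assume "x \<in> f ` H" "y \<in> f ` H"
  then show "x - y \<in> f ` H"
    using add_subgroup_diff[OF assms(2)] by (auto simp: assms(1)[symmetric])
qed

text \<open>Most indices below are computed by means of a function whose level sets are the
  cosets.\<close>

lemma group_index_eq_card_image:
  assumes "\<And>x y. x \<in> G \<Longrightarrow> y \<in> G \<Longrightarrow> x - y \<in> H \<longleftrightarrow> f x = f y"
  shows "group_index G H = card (f ` G)"
proof -
  let ?R = "{(x, y). x \<in> G \<and> y \<in> G \<and> x - y \<in> H}"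
  have "?R `` {x} = {y\<in>G. f y = f x}" if "x \<in> G" for x
    using that assms by auto
  then have "G // ?R = (\<lambda>v. {y\<in>G. f y = v}) ` (f ` G)"
    unfolding quotient_def by (auto simp: image_iff)
  moreover have "inj_on (\<lambda>v. {y\<in>G. f y = v}) (f ` G)"
    by (rule inj_onI) blast
  ultimately show ?thesis
    unfolding group_index_def by (simp add: card_image)
qed

lemma coset_representatives:
  assumes "add_subgroup H"
  shows "\<exists>c. (\<forall>x. x - c x \<in> H) \<and> (\<forall>x y. c x = c y \<longleftrightarrow> x - y \<in> H)"
proof -
  define c where "c x = (SOME z. x - z \<in> H)" for x
  have c1: "x - c x \<in> H" for x
    unfolding c_def by (rule someI[of _ x]) (simp add: assms add_subgroup_0)
  have c2: "c x = c y" if "x - y \<in> H" for x y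
  proof -
    have "x - z \<in> H \<longleftrightarrow> y - z \<in> H" for z
      using add_subgroup_add[OF assms that, of "y - z"] add_subgroup_diff[OF assms _ that, of "x - z"]
      by (auto simp: algebra_simps)
    then show ?thesis unfolding c_def by simp
  qed
  have c3: "x - y \<in> H" if "c x = c y" for x y
    using add_subgroup_diff[OF assms c1[of x] c1[of y]] that by simp
  show ?thesis
    using c1 c2 c3 by blast
qed

text \<open>The identity also holds for infinite indices, which are \<open>0\<close>, as the
  cosets of \<open>K\<close> in \<open>G\<close> correspond to pairs of a coset of
  \<open>H\<close> in \<open>G\<close> and a coset of \<open>K\<close> in
  \<open>H\<close>.\<close>

lemma group_index_tower:
  assumes "add_subgroup G" "add_subgroup H" "add_subgroup K" "K \<subseteq> H" "H \<subseteq> G"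
  shows "group_index G K = group_index G H * group_index H K"
proof -
  obtain c where c: "\<And>x. x - c x \<in> H" "\<And>x y. c x = c y \<longleftrightarrow> x - y \<in> H"
    using coset_representatives[OF assms(2)] by blast
  obtain d where d: "\<And>x. x - d x \<in> K" "\<And>x y. d x = d y \<longleftrightarrow> x - y \<in> K"
    using coset_representatives[OF assms(3)] by blast
  define f where "f x = (c x, d (x - c x))" for x
  have "group_index G K = card (f ` G)"
  proof (rule group_index_eq_card_image)
    fix x y
    show "x - y \<in> K \<longleftrightarrow> f x = f y"
      using c(2)[of x y] d(2)[of "x - c x" "y - c y"] assms(4) by (auto simp: f_def)
  qed
  also have "f ` G = (c ` G) \<times> (d ` H)"
  proof (intro equalityI subsetI)
    fix v assume "v \<in> f ` G"
    then show "v \<in> (c ` G) \<times> (d ` H)"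
      using c(1) by (auto simp: f_def)
  next
    fix v assume "v \<in> (c ` G) \<times> (d ` H)"
    then obtain x h where v: "v = (c x, d h)" "x \<in> G" "h \<in> H" by auto
    \<comment> \<open>The representative of the coset of \<open>x\<close> plus \<open>h\<close> is the element with the prescribed data.\<close>
    have "c (c x + h) = c x"
      using add_subgroup_diff[OF assms(2) v(3) c(1)[of x]] by (simp add: c(2) algebra_simps)
    moreover have "c x + h \<in> G"
    proof -
      have "c x = x - (x - c x)" by simp
      then have "c x \<in> G"
        using add_subgroup_diff[OF assms(1) v(2)] c(1)[of x] assms(5) by (metis subsetD)
      then show ?thesis using add_subgroup_add[OF assms(1)] v assms(5) by blast
    qed
    ultimately show "v \<in> f ` G"
      using v by (auto simp: f_def image_iff intro!: bexI[of _ "c x + h"])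
  qed
  also have "card \<dots> = group_index G H * group_index H K"
    using group_index_eq_card_image[of G H c] group_index_eq_card_image[of H K d]
    by (simp add: c(2) d(2) card_cartesian_product)
  finally show ?thesis .
qed

lemma group_index_inj_image:
  assumes "\<And>x y. f (x - y) = f x - f y" "inj f"
  shows "group_index (f ` G) (f ` H) = group_index G H"
proof -
  define R where "R = {(x, y). x \<in> G \<and> y \<in> G \<and> x - y \<in> H}"
  have "{(x, y). x \<in> f ` G \<and> y \<in> f ` G \<and> x - y \<in> f ` H} `` {f x} = f ` (R `` {x})" for x
  proof (intro equalityI subsetI)
    fix v assume "v \<in> {(x, y). x \<in> f ` G \<and> y \<in> f ` G \<and> x - y \<in> f ` H} `` {f x}"
    then obtain y where "v = f y" "x \<in> G" "y \<in> G" "f (x - y) \<in> f ` H"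
      using inj_image_mem_iff[OF assms(2)] by (auto simp: assms(1))
    then show "v \<in> f ` (R `` {x})"
      using inj_image_mem_iff[OF assms(2)] by (auto simp: R_def)
  next
    fix v assume "v \<in> f ` (R `` {x})"
    then obtain y where "v = f y" "x \<in> G" "y \<in> G" "x - y \<in> H"
      by (auto simp: R_def)
    then show "v \<in> {(x, y). x \<in> f ` G \<and> y \<in> f ` G \<and> x - y \<in> f ` H} `` {f x}"
      using assms(1)[of x y] imageI[of "x - y" H f] by auto
  qed
  then have "f ` G // {(x, y). x \<in> f ` G \<and> y \<in> f ` G \<and> x - y \<in> f ` H} = (`) f ` (G // R)"
    by (simp only: quotient_def UN_simps image_UN image_insert image_empty)
  moreover have "inj_on ((`) f) (G // R)"
    using assms(2) by (meson inj_image_eq_iff inj_onI)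
  ultimately show ?thesis
    unfolding group_index_def R_def by (simp add: card_image)
qed

lemma group_index_self:
  assumes "add_subgroup G"
  shows "group_index G G = 1"
proof -
  have "group_index G G = card ((\<lambda>_. ()) ` G)"
    by (rule group_index_eq_card_image) (simp add: add_subgroup_diff[OF assms])
  also have "(\<lambda>_. ()) ` G = {()}"
    using add_subgroup_0[OF assms] by auto
  finally show ?thesis by simp
qed

text \<open>An intermediate group is determined by the cosets of \<open>K\<close> of which it is
  the union.\<close>

lemma finite_intermediate_subgroups:
  assumes "add_subgroup K" "group_index G K \<noteq> 0"
  shows "finite {H. add_subgroup H \<and> K \<subseteq> H \<and> H \<subseteq> G}"
proof -
  obtain c where c: "\<And>x. x - c x \<in> K" "\<And>x y. c x = c y \<longleftrightarrow> x - y \<in> K"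
    using coset_representatives[OF assms(1)] by blast
  have "group_index G K = card (c ` G)"
    by (rule group_index_eq_card_image) (simp add: c(2))
  then have fin: "finite (Pow (c ` G))"
    using assms(2) by (metis card.infinite finite_Pow_iff)
  have *: "H \<subseteq> H'" if H: "add_subgroup H'" "K \<subseteq> H'" "c ` H = c ` H'" for H H'
  proof
    fix x assume "x \<in> H"
    then obtain y where y: "y \<in> H'" "c x = c y" using H(3) by (metis image_iff)
    then have "x - y \<in> H'" using c(2) H(2) by blast
    then show "x \<in> H'" using add_subgroup_add[OF H(1) _ y(1)] by fastforce
  qed
  have "inj_on ((`) c) {H. add_subgroup H \<and> K \<subseteq> H \<and> H \<subseteq> G}"
    by (rule inj_onI) (metis (no_types, lifting) "*" mem_Collect_eq subset_antisym)
  moreover have "((`) c) ` {H. add_subgroup H \<and> K \<subseteq> H \<and> H \<subseteq> G} \<subseteq> Pow (c ` G)"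
    by auto
  ultimately show ?thesis
    using fin by (rule inj_on_finite)
qed

section \<open>The ring of integers of the quadratic field\<close>

text \<open>The element \<open>ZT a b\<close> stands for \<open>a + b \<tau>\<close>.\<close>

datatype zt = ZT (rat_part: int) (tau_part: int)

lemma zt_eq_iff: "x = y \<longleftrightarrow> rat_part x = rat_part y \<and> tau_part x = tau_part y"
  by (cases x; cases y) auto

instantiation zt :: comm_ring_1
begin

definition "0 = ZT 0 0"
definition "1 = ZT 1 0"
definition "x + y = ZT (rat_part x + rat_part y) (tau_part x + tau_part y)"
definition "x - y = ZT (rat_part x - rat_part y) (tau_part x - tau_part y)"
definition "- x = ZT (- rat_part x) (- tau_part x)"
definition "x * y = ZT (rat_part x * rat_part y + tau_part x * tau_part y) (rat_part x * tau_part y + tau_part x * rat_part y + tau_part x * tau_part y)"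

instance
  by standard
    (auto simp: zero_zt_def one_zt_def plus_zt_def minus_zt_def uminus_zt_def times_zt_def algebra_simps)

end

lemma zt_sel [simp]:
  "rat_part 0 = 0" "tau_part 0 = 0" "rat_part 1 = 1" "tau_part 1 = 0"
  "rat_part (x + y) = rat_part x + rat_part y" "tau_part (x + y) = tau_part x + tau_part y"
  "rat_part (x - y) = rat_part x - rat_part y" "tau_part (x - y) = tau_part x - tau_part y"
  "rat_part (- x) = - rat_part x" "tau_part (- x) = - tau_part x"
  "rat_part (x * y) = rat_part x * rat_part y + tau_part x * tau_part y"
  "tau_part (x * y) = rat_part x * tau_part y + tau_part x * rat_part y + tau_part x * tau_part y"
  by (simp_all add: zero_zt_def one_zt_def plus_zt_def minus_zt_def uminus_zt_def times_zt_def)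

lemma zt_of_nat [simp]: "rat_part (of_nat n) = int n" "tau_part (of_nat n) = 0"
  by (induction n) auto

lemma zt_of_int [simp]: "rat_part (of_int n) = n" "tau_part (of_int n) = 0"
  by (cases n; simp)+

lemma zt_numeral [simp]: "rat_part (numeral n) = numeral n" "tau_part (numeral n) = 0"
  using zt_of_nat[of "numeral n"] by simp_all

definition tz :: zt where "tz = ZT 0 1"

lemma tz_sel [simp]: "rat_part tz = 0" "tau_part tz = 1"
  by (simp_all add: tz_def)

lemma tz_square: "tz * tz = tz + 1"
  by (simp add: zt_eq_iff)

lemma tz_mult: "tz * (tz * x) = x + tz * x"
  by (simp add: zt_eq_iff)

definition rz :: "zt \<Rightarrow> real" where
  "rz x = of_int (rat_part x) + of_int (tau_part x) * tau"

lemma tau_square: "tau * tau = tau + 1"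
  by (simp add: tau_def field_simps)

lemma tau_mult: "tau * (tau * x) = x + tau * x"
  using tau_square by (simp add: mult.assoc[symmetric] distrib_right)

lemma rz_simps [simp]:
  "rz 0 = 0" "rz 1 = 1" "rz (x + y) = rz x + rz y" "rz (x - y) = rz x - rz y" "rz (- x) = - rz x"
  "rz tz = tau" "rz (of_int n) = of_int n" "rz (of_nat m) = of_nat m" "rz (numeral k) = numeral k"
  by (simp_all add: rz_def algebra_simps)

lemma rz_mult [simp]: "rz (x * y) = rz x * rz y"
proof -
  have "of_int (tau_part x) * of_int (tau_part y) * (tau * tau) = of_int (tau_part x) * of_int (tau_part y) * (tau + 1)"
    by (simp only: tau_square)
  then show ?thesis by (simp add: rz_def algebra_simps)
qed

lemma sqrt5_irrational: "sqrt 5 \<notin> \<rat>"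
proof
  assume "sqrt 5 \<in> \<rat>"
  then obtain m n where n: "n \<noteq> 0" "\<bar>sqrt 5\<bar> = real m / real n" and cop: "coprime m n"
    by (rule Rats_abs_nat_div_natE)
  then have "(real m)\<^sup>2 = 5 * (real n)\<^sup>2"
    by (metis abs_of_nonneg divide_eq_eq of_nat_0_eq_iff power_mult_distrib real_sqrt_ge_zero
        real_sqrt_pow2 zero_le_numeral)
  then have eq: "m\<^sup>2 = 5 * n\<^sup>2"
    by (metis of_nat_eq_iff of_nat_mult of_nat_numeral of_nat_power)
  have p5: "prime (5::nat)" by simp
  have "5 dvd m" using eq p5 prime_dvd_power by (metis dvd_triv_left)
  then obtain k where "m = 5 * k" ..
  with eq have "n\<^sup>2 = 5 * k\<^sup>2" by (simp add: power2_eq_square)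
  then have "5 dvd n" using p5 prime_dvd_power by (metis dvd_triv_left)
  with \<open>5 dvd m\<close> cop show False
    by (metis coprime_common_divisor_nat numeral_eq_one_iff semiring_norm(86))
qed

lemma rat_sqrt5_eq_0:
  assumes "of_rat a + of_rat b * sqrt 5 = 0"
  shows "a = 0 \<and> b = 0"
proof -
  have "b = 0"
  proof (rule ccontr)
    assume "b \<noteq> 0"
    then have "sqrt 5 = of_rat (- a / b)"
      using assms by (simp add: of_rat_divide of_rat_minus field_simps)
    then show False using sqrt5_irrational by (metis Rats_of_rat)
  qed
  then show ?thesis using assms by simp
qed

lemma rz_eq_0_iff [simp]: "rz x = 0 \<longleftrightarrow> x = 0"
proof
  assume "rz x = 0"
  then have "of_rat (of_int (rat_part x) + of_int (tau_part x) / 2) + of_rat (of_int (tau_part x) / 2) * sqrt 5 = (0::real)"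
    by (simp add: rz_def tau_def of_rat_add of_rat_mult of_rat_divide field_simps)
  from rat_sqrt5_eq_0[OF this] show "x = 0" by (simp add: zt_eq_iff)
qed simp

lemma rz_inj [simp]: "rz x = rz y \<longleftrightarrow> x = y"
  using rz_eq_0_iff[of "x - y"] by (simp del: rz_eq_0_iff)

instance zt :: idom
proof
  fix x y :: zt assume "x \<noteq> 0" "y \<noteq> 0"
  then have "rz (x * y) \<noteq> 0" by simp
  then show "x * y \<noteq> 0" by (metis rz_simps(1))
qed

instance zt :: ring_char_0
  by standard (auto intro!: injI simp: zt_eq_iff)

lemma rz_range: "Z_tau = range rz"
proof (intro equalityI subsetI)
  fix x assume "x \<in> Z_tau"
  then obtain a b where "x = rz (ZT a b)" by (auto simp: Z_tau_def rz_def)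
  then show "x \<in> range rz" by simp
qed (auto simp: Z_tau_def rz_def)

definition cj :: "zt \<Rightarrow> zt" where "cj x = ZT (rat_part x + tau_part x) (- tau_part x)"

lemma cj_sel [simp]: "rat_part (cj x) = rat_part x + tau_part x" "tau_part (cj x) = - tau_part x"
  by (simp_all add: cj_def)

lemma cj_simps [simp]:
  "cj 0 = 0" "cj 1 = 1" "cj (x + y) = cj x + cj y" "cj (x - y) = cj x - cj y" "cj (- x) = - cj x"
  "cj (x * y) = cj x * cj y" "cj (of_int n) = of_int n" "cj (of_nat m) = of_nat m"
  "cj (numeral k) = numeral k" "cj (cj x) = x" "cj tz = 1 - tz"
  by (simp_all add: zt_eq_iff algebra_simps)

lemma cj_eq_iff [simp]: "cj x = cj y \<longleftrightarrow> x = y"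
  by (metis cj_simps(10))

lemma cj_eq_0_iff [simp]: "cj x = 0 \<longleftrightarrow> x = 0"
  using cj_eq_iff[of x 0] by (simp del: cj_eq_iff)

lemma cj_fixed_imp: "cj x = x \<Longrightarrow> x = of_int (rat_part x)"
  by (simp add: zt_eq_iff)

definition nz :: "zt \<Rightarrow> int" where
  "nz x = (rat_part x)\<^sup>2 + rat_part x * tau_part x - (tau_part x)\<^sup>2"

lemma nz_eq: "of_int (nz x) = x * cj x"
  by (simp add: zt_eq_iff nz_def power2_eq_square algebra_simps)

lemma nz_mult: "nz (x * y) = nz x * nz y"
proof -
  have "(of_int (nz (x * y)) :: zt) = of_int (nz x * nz y)"
    by (simp add: nz_eq mult_ac)
  then show ?thesis by (simp only: of_int_eq_iff)
qed

lemma nz_simps [simp]: "nz 0 = 0" "nz 1 = 1" "nz (of_int n) = n\<^sup>2" "nz (- x) = nz x" "nz (cj x) = nz x"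
  by (simp_all add: nz_def power2_eq_square algebra_simps)

lemma nz_eq_0_iff [simp]: "nz x = 0 \<longleftrightarrow> x = 0"
proof
  assume "nz x = 0"
  then have "x * cj x = 0" using nz_eq[of x] by simp
  then show "x = 0" by simp
qed simp

lemma zt_unit_iff: "x dvd 1 \<longleftrightarrow> \<bar>nz x\<bar> = 1"
proof
  assume "x dvd 1"
  then obtain y where "1 = x * y" ..
  then have "nz x * nz y = 1" by (metis nz_mult nz_simps(2))
  then show "\<bar>nz x\<bar> = 1" by (simp add: zmult_eq_1_iff) auto
next
  assume "\<bar>nz x\<bar> = 1"
  then have "of_int (nz x) dvd (1 :: zt)"
    by (metis abs_1 abs_eq_iff dvd_refl minus_dvd_iff of_int_1 of_int_minus)
  then show "x dvd 1" by (metis dvd_mult_left nz_eq)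
qed

lemma Z_tau_unit_iff: "Z_tau_unit (rz x) \<longleftrightarrow> x dvd 1"
  unfolding Z_tau_unit_def rz_range
  by (auto simp: dvd_def rz_mult[symmetric] simp del: rz_mult) (metis rz_inj rz_simps(2))+

lemma K_norm_eq:
  "real_of_int (k\<^sup>2 + k * l - l\<^sup>2) = K_norm (real_of_int k + real_of_int l * tau)"
proof -
  have "K_conj (real_of_int k + real_of_int l * tau) = of_int k + of_int l - of_int l * tau"
    unfolding K_conj_def
  proof (rule the_equality)
    show "\<exists>a b. real_of_int k + real_of_int l * tau = of_rat a + of_rat b * sqrt 5 \<and>
        real_of_int k + real_of_int l - real_of_int l * tau = of_rat a - of_rat b * sqrt 5"
      by (rule exI[of _ "of_int k + of_int l / 2"], rule exI[of _ "of_int l / 2"])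
        (simp add: tau_def of_rat_add of_rat_mult of_rat_divide field_simps)
  next
    fix \<beta> :: real
    assume "\<exists>a b. real_of_int k + real_of_int l * tau = of_rat a + of_rat b * sqrt 5 \<and>
        \<beta> = of_rat a - of_rat b * sqrt 5"
    then obtain a b where ab: "real_of_int k + real_of_int l * tau = of_rat a + of_rat b * sqrt 5"
        "\<beta> = of_rat a - of_rat b * sqrt 5" by blast
    have "of_rat (a - of_int k - of_int l / 2) + of_rat (b - of_int l / 2) * sqrt 5 = (0::real)"
      using ab(1)
      by (simp add: tau_def of_rat_diff of_rat_add of_rat_divide algebra_simps add_divide_distrib)
    from rat_sqrt5_eq_0[OF this] have a: "a = of_int k + of_int l / 2" and b: "b = of_int l / 2"
      by auto
    have "real_of_rat a = of_int k + of_int l / 2" "real_of_rat b = of_int l / 2"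
      unfolding a b by (simp_all add: of_rat_add of_rat_divide)
    then show "\<beta> = real_of_int k + real_of_int l - real_of_int l * tau"
      by (simp add: ab(2) tau_def of_rat_add of_rat_divide add_divide_distrib algebra_simps)
  qed
  then show ?thesis
    unfolding K_norm_def by (simp only:) (simp add: power2_eq_square algebra_simps tau_square tau_mult)
qed

subsection \<open>Division with remainder and prime factorisation\<close>

lemma nearest_multiple:
  fixes u n :: int
  assumes "n \<noteq> 0"
  shows "\<exists>q. 2 * \<bar>u - n * q\<bar> \<le> \<bar>n\<bar>"
proof (rule exI[of _ "round (of_int u / of_int n :: real)"])
  let ?q = "round (of_int u / of_int n :: real)"
  have "\<bar>real_of_int ?q - of_int u / of_int n\<bar> \<le> 1/2"
    by (rule of_int_round_abs_le)
  then have "\<bar>real_of_int n\<bar> * \<bar>real_of_int ?q - of_int u / of_int n\<bar> \<le> \<bar>real_of_int n\<bar> * (1/2)"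
    by (intro mult_left_mono) auto
  then have "\<bar>real_of_int n * (real_of_int ?q - of_int u / of_int n)\<bar> \<le> \<bar>real_of_int n\<bar> / 2"
    by (simp add: abs_mult)
  moreover have "real_of_int n * (real_of_int ?q - of_int u / of_int n) = of_int (n * ?q - u)"
    using assms by (simp add: field_simps)
  ultimately have "\<bar>real_of_int (n * ?q - u)\<bar> \<le> \<bar>real_of_int n\<bar> / 2" by metis
  then have "real_of_int (2 * \<bar>u - n * ?q\<bar>) \<le> real_of_int \<bar>n\<bar>" by (simp add: abs_minus_commute mult.commute)
  then show "2 * \<bar>u - n * ?q\<bar> \<le> \<bar>n\<bar>" by (simp only: of_int_le_iff)
qed

text \<open>Rounding the coordinates of \<open>a / b\<close> leaves an error \<open>e + f
  \<tau>\<close> with \<open>\<bar>e\<bar>, \<bar>f\<bar> \<le> 1/2\<close>, and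
  \<open>\<bar>e\<^sup>2 + e f - f\<^sup>2\<bar> \<le> 3/4\<close>. To stay within the integers
  everything is multiplied by the norm of \<open>b\<close>.\<close>

lemma zt_euclidean:
  assumes "b \<noteq> 0"
  shows "\<exists>q. \<bar>nz (a - b * q)\<bar> < \<bar>nz b\<bar>"
proof -
  define x where "x = a * cj b"
  define N where "N = nz b"
  have N: "N \<noteq> 0" using assms by (simp add: N_def)
  obtain q0 where q0: "2 * \<bar>rat_part x - N * q0\<bar> \<le> \<bar>N\<bar>" using nearest_multiple[OF N] by blast
  obtain q1 where q1: "2 * \<bar>tau_part x - N * q1\<bar> \<le> \<bar>N\<bar>" using nearest_multiple[OF N] by blast
  define e f where "e = rat_part x - N * q0" and "f = tau_part x - N * q1"
  define r where "r = a - b * ZT q0 q1"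
  have "r * cj b = x - of_int N * ZT q0 q1"
    by (simp add: r_def x_def N_def nz_eq algebra_simps)
  then have "nz (r * cj b) = e\<^sup>2 + e * f - f\<^sup>2"
    by (simp add: nz_def e_def f_def)
  then have "nz r * N = e\<^sup>2 + e * f - f\<^sup>2"
    by (simp only: nz_mult nz_simps N_def)
  moreover have "\<bar>e\<^sup>2 + e * f - f\<^sup>2\<bar> < N\<^sup>2"
  proof -
    have b: "2 * \<bar>e\<bar> \<le> \<bar>N\<bar>" "2 * \<bar>f\<bar> \<le> \<bar>N\<bar>" using q0 q1 by (simp_all add: e_def f_def)
    have "(2 * \<bar>e\<bar>) * (2 * \<bar>e\<bar>) \<le> \<bar>N\<bar> * \<bar>N\<bar>" "(2 * \<bar>f\<bar>) * (2 * \<bar>f\<bar>) \<le> \<bar>N\<bar> * \<bar>N\<bar>"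
      "(2 * \<bar>e\<bar>) * (2 * \<bar>f\<bar>) \<le> \<bar>N\<bar> * \<bar>N\<bar>"
      by (intro mult_mono b; simp)+
    then have "4 * e\<^sup>2 \<le> N\<^sup>2" "4 * f\<^sup>2 \<le> N\<^sup>2" "4 * \<bar>e * f\<bar> \<le> N\<^sup>2"
      by (simp_all add: power2_eq_square abs_mult)
    moreover have "N\<^sup>2 > 0" "e\<^sup>2 \<ge> 0" "f\<^sup>2 \<ge> 0" using N by auto
    ultimately show ?thesis by linarith
  qed
  ultimately have "\<bar>nz r\<bar> * \<bar>N\<bar> < \<bar>N\<bar> * \<bar>N\<bar>"
    by (simp add: abs_mult[symmetric] power2_eq_square)
  then have "\<bar>nz r\<bar> < \<bar>N\<bar>" using mult_less_cancel_right_pos[of "\<bar>N\<bar>"] N by fastforce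
  then show ?thesis unfolding r_def N_def by blast
qed

lemma zt_bezout: "\<exists>g u v. g = u * a + v * b \<and> g dvd a \<and> g dvd (b :: zt)"
proof (induction "nat \<bar>nz b\<bar>" arbitrary: a b rule: less_induct)
  case less
  show ?case
  proof (cases "b = 0")
    case True
    then have "a = 1 * a + 0 * b \<and> a dvd a \<and> a dvd b" by simp
    then show ?thesis by blast
  next
    case False
    then obtain q where q: "\<bar>nz (a - b * q)\<bar> < \<bar>nz b\<bar>" using zt_euclidean by blast
    then have "nat \<bar>nz (a - b * q)\<bar> < nat \<bar>nz b\<bar>" by linarith
    from less[OF this, of b] obtain g u v where
      g: "g = u * b + v * (a - b * q)" "g dvd b" "g dvd a - b * q" by blast
    have "g dvd a" using g(2,3) by (metis diff_add_cancel dvd_add dvd_mult2)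
    moreover have "g = v * a + (u - v * q) * b" using g(1) by (simp add: algebra_simps)
    ultimately show ?thesis using g(2) by blast
  qed
qed

lemma zt_irreducible_imp_prime:
  assumes "irreducible (p :: zt)"
  shows "prime_elem p"
proof (rule prime_elemI)
  show "p \<noteq> 0" "\<not> p dvd 1" using assms by (auto simp: irreducible_def)
  fix a b assume dvd: "p dvd a * b"
  obtain g u v where g: "g = u * a + v * p" "g dvd a" "g dvd p" using zt_bezout by blast
  from g(3) obtain k where "p = g * k" ..
  then consider "g dvd 1" | "k dvd 1" using irreducibleD[OF assms] by blast
  then show "p dvd a \<or> p dvd b"
  proof cases
    case 1
    then obtain w where "1 = g * w" ..
    then have "b = g * w * b" by (metis mult_1)
    also have "\<dots> = (w * u) * (a * b) + p * (w * v * b)" by (simp add: g(1) algebra_simps)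
    finally have b: "b = (w * u) * (a * b) + p * (w * v * b)" .
    have "p dvd (w * u) * (a * b) + p * (w * v * b)"
      by (intro dvd_add dvd_mult dvd dvd_triv_left)
    then show ?thesis using b by simp
  next
    case 2
    then obtain j where j: "1 = k * j" by (rule dvdE)
    then have "g = p * j" using \<open>p = g * k\<close> by (simp add: mult.assoc)
    then have "p dvd g" by simp
    from dvd_trans[OF this g(2)] show ?thesis ..
  qed
qed

lemma zt_prime_imp_irreducible:
  assumes "prime_elem (p :: zt)"
  shows "irreducible p"
proof (rule irreducibleI)
  show p0: "p \<noteq> 0" "\<not> p dvd 1" using assms by (auto simp: prime_elem_def)
  have *: "b dvd 1" if ab: "p = a * b" and dvd: "p dvd a" for a b
  proof -
    obtain k where "a = p * k" using dvd by (rule dvdE)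
    then have "p * 1 = p * (k * b)" using ab by (metis mult.assoc mult.right_neutral)
    then have "1 = b * k" using mult_left_cancel[OF p0(1)] by (metis mult.commute)
    then show ?thesis by (rule dvdI)
  qed
  fix a b assume ab: "p = a * b"
  then have "p dvd a \<or> p dvd b" using prime_elem_dvd_multD[OF assms, of a b] by simp
  then show "a dvd 1 \<or> b dvd 1" using *[of a b] *[of b a] ab by (auto simp: mult.commute)
qed

lemma zt_prime_divisor:
  assumes "n \<noteq> (0 :: zt)" "\<not> n dvd 1"
  shows "\<exists>p. prime_elem p \<and> p dvd n"
  using assms
proof (induction "nat \<bar>nz n\<bar>" arbitrary: n rule: less_induct)
  case less
  show ?case
  proof (cases "irreducible n")
    case True
    from zt_irreducible_imp_prime[OF this] show ?thesis by (intro exI[of _ n]) simp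
  next
    case False
    then obtain a b where ab: "n = a * b" "\<not> a dvd 1" "\<not> b dvd 1"
      using less.prems by (auto simp: irreducible_def)
    have "nz b \<noteq> 0" using ab less.prems by auto
    then have "\<bar>nz b\<bar> > 1"
      using ab(3) unfolding zt_unit_iff by linarith
    moreover have "\<bar>nz a\<bar> > 0" using ab less.prems by auto
    ultimately have "\<bar>nz a\<bar> * 1 < \<bar>nz a\<bar> * \<bar>nz b\<bar>" by (intro mult_strict_left_mono) auto
    then have "\<bar>nz a\<bar> < \<bar>nz n\<bar>" by (simp add: ab nz_mult abs_mult)
    then have "nat \<bar>nz a\<bar> < nat \<bar>nz n\<bar>" by linarith
    then obtain p where "prime_elem p" "p dvd a"
      using less.hyps[of a] ab less.prems by auto
    then show ?thesis using ab dvd_mult2 by blast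
  qed
qed

text \<open>The induction hypothesis covers all divisors of \<open>n\<close>, since a Hecke
  recursion expresses the value at \<open>p n\<close> by the values at \<open>n\<close> and
  \<open>n / p\<close>.\<close>

lemma zt_prime_induct [consumes 1, case_names unit prime]:
  assumes "n \<noteq> (0 :: zt)"
  assumes "\<And>u. u dvd 1 \<Longrightarrow> P u"
  assumes "\<And>p n. prime_elem p \<Longrightarrow> n \<noteq> 0 \<Longrightarrow> (\<And>k. k \<noteq> 0 \<Longrightarrow> k dvd n \<Longrightarrow> P k) \<Longrightarrow> P (p * n)"
  shows "P n"
  using assms(1)
proof (induction "nat \<bar>nz n\<bar>" arbitrary: n rule: less_induct)
  case less
  show ?case
  proof (cases "n dvd 1")
    case False
    then obtain p m where p: "prime_elem p" "n = p * m"
      using zt_prime_divisor less.prems by (metis dvd_def)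
    have m0: "m \<noteq> 0" using p less.prems by auto
    show ?thesis unfolding p(2)
    proof (rule assms(3)[OF p(1) m0])
      fix k assume k: "k \<noteq> 0" "k dvd m"
      then obtain j where j: "m = k * j" by (auto elim: dvdE)
      have "nz p \<noteq> 0" "\<not> p dvd 1" using p(1) by (auto simp: prime_elem_def)
      then have "\<bar>nz p\<bar> > 1" unfolding zt_unit_iff by linarith
      moreover have "\<bar>nz j\<bar> \<ge> 1" 
      proof -
        have "nz j \<noteq> 0" using j m0 by auto
        then show ?thesis by linarith
      qed
      ultimately have "\<bar>nz p\<bar> * \<bar>nz j\<bar> > 1"
        using mult_mono[of "\<bar>nz p\<bar>" "\<bar>nz p\<bar>" 1 "\<bar>nz j\<bar>"] by auto
      then have "\<bar>nz k\<bar> * 1 < \<bar>nz k\<bar> * (\<bar>nz p\<bar> * \<bar>nz j\<bar>)"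
        using k by (intro mult_strict_left_mono) auto
      then have "\<bar>nz k\<bar> < \<bar>nz n\<bar>" by (simp add: p j nz_mult abs_mult mult_ac)
      then have "nat \<bar>nz k\<bar> < nat \<bar>nz n\<bar>" by linarith
      from less.hyps[OF this k(1)] show "P k" .
    qed
  qed (use assms(2) in blast)
qed

lemma zt_prime_bezout:
  assumes "prime_elem (p :: zt)" "\<not> p dvd x"
  shows "\<exists>u v. u * p + v * x = 1"
proof -
  obtain g u v where g: "g = u * p + v * x" "g dvd p" "g dvd x" using zt_bezout by blast
  have "irreducible p" using assms(1) by (rule zt_prime_imp_irreducible)
  moreover obtain k where k0: "p = g * k" using g(2) by (rule dvdE)
  ultimately have k: "p = g * k" "g dvd 1 \<or> k dvd 1" using irreducibleD by blast+
  have "\<not> k dvd 1"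
  proof
    assume "k dvd 1"
    then obtain j where j: "1 = k * j" by (rule dvdE)
    then have "g = p * j" using k(1) by (simp add: mult.assoc)
    then have "p dvd g" by simp
    from dvd_trans[OF this g(3)] show False using assms(2) by simp
  qed
  then have "g dvd 1" using k(2) by blast
  then obtain w where "1 = g * w" by (rule dvdE)
  then have "(w * u) * p + (w * v) * x = 1" using g(1) by (simp add: algebra_simps)
  then show ?thesis by blast
qed

subsection \<open>Associated elements\<close>

definition assoc :: "zt \<Rightarrow> zt \<Rightarrow> bool" (infix \<open>\<sim>\<close> 50) where
  "x \<sim> y \<longleftrightarrow> x dvd y \<and> y dvd x"

lemma assoc_refl [simp]: "x \<sim> x"
  and assoc_sym: "x \<sim> y \<Longrightarrow> y \<sim> x"
  and assoc_trans [trans]: "x \<sim> y \<Longrightarrow> y \<sim> z \<Longrightarrow> x \<sim> z"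
  by (auto simp: assoc_def intro: dvd_trans)

lemma assoc_0_iff [simp]: "x \<sim> 0 \<longleftrightarrow> x = 0" "0 \<sim> x \<longleftrightarrow> x = 0"
  by (auto simp: assoc_def)

lemma assoc_1_iff [simp]: "x \<sim> 1 \<longleftrightarrow> x dvd 1"
  by (auto simp: assoc_def)

lemma assoc_mult: "x \<sim> y \<Longrightarrow> z \<sim> w \<Longrightarrow> x * z \<sim> y * w"
  by (auto simp: assoc_def mult_dvd_mono)

lemma assoc_mult_cancel: "z \<noteq> 0 \<Longrightarrow> z * x \<sim> z * y \<longleftrightarrow> x \<sim> y"
  by (simp add: assoc_def)

lemma assoc_unit_iff: "x \<sim> y \<longleftrightarrow> (\<exists>u. u dvd 1 \<and> y = x * u)"
proof
  assume "x \<sim> y"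
  then have "x dvd y" "y dvd x" by (auto simp: assoc_def)
  then obtain u v where uv: "y = x * u" "x = y * v" by (metis dvd_def)
  show "\<exists>u. u dvd 1 \<and> y = x * u"
  proof (cases "x = 0")
    case True
    then show ?thesis using uv(1) by (intro exI[of _ 1]) simp
  next
    case False
    have "x * (u * v) = x * 1" using uv by (metis mult.assoc mult.right_neutral)
    then have "u * v = 1" using mult_left_cancel[OF False] by blast
    then show ?thesis using uv(1) by (metis dvd_triv_left)
  qed
next
  assume "\<exists>u. u dvd 1 \<and> y = x * u"
  then obtain u where u: "u dvd 1" "y = x * u" by blast
  from u(1) obtain w where "1 = u * w" by (rule dvdE)
  then have "x = y * w" using u(2) by (metis mult.assoc mult.right_neutral)
  then show "x \<sim> y" unfolding assoc_def using u(2) by (metis dvd_triv_left)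
qed

lemma assocE:
  assumes "x \<sim> y"
  obtains u where "u dvd 1" "y = x * u"
  using assms that unfolding assoc_unit_iff by metis

lemma assoc_abs_nz: "x \<sim> y \<Longrightarrow> \<bar>nz x\<bar> = \<bar>nz y\<bar>"
  by (auto simp: assoc_unit_iff zt_unit_iff nz_mult abs_mult)

lemma assoc_mult_unit: "u dvd 1 \<Longrightarrow> x * u \<sim> x"
  by (metis assoc_sym assoc_unit_iff)

lemma prime_square_proper_factor:
  assumes "prime_elem p" "x * y \<sim> p * p" "\<not> x dvd 1" "\<not> y dvd 1"
  shows "x \<sim> p"
proof -
  have p0: "p \<noteq> 0" using assms(1) by auto
  have key: "k dvd 1" if "k * z \<sim> p" "\<not> z dvd 1" for k z
  proof -
    from that(1) obtain w where w: "w dvd 1" "p = (k * z) * w" by (rule assocE)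
    then have "p = k * (z * w)" by (simp add: mult.assoc)
    from irreducibleD[OF zt_prime_imp_irreducible[OF assms(1)] this]
    show ?thesis using that(2) dvd_mult_left[of z w 1] by blast
  qed
  have "p dvd x * y" using assms(2) dvd_mult_left[of p p "x * y"] by (simp add: assoc_def)
  then consider "p dvd x" | "p dvd y" using prime_elem_dvd_multD[OF assms(1)] by blast
  then show ?thesis
  proof cases
    case 1
    then obtain k where k: "x = p * k" ..
    then have "k * y \<sim> p" using assms(2) p0 by (simp add: mult.assoc assoc_mult_cancel)
    from key[OF this assms(4)] show ?thesis using k assoc_mult_unit by simp
  next
    case 2
    then obtain k where k: "y = p * k" ..
    have "p * (k * x) \<sim> p * p" using assms(2) by (simp add: k mult_ac)
    then have *: "k * x \<sim> p" using p0 by (simp add: assoc_mult_cancel)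
    have "x * k \<sim> x" by (rule assoc_mult_unit) (rule key[OF * assms(3)])
    then have "x \<sim> k * x" by (simp add: assoc_sym mult.commute)
    then show ?thesis using * by (rule assoc_trans)
  qed
qed

text \<open>Ideals of \<open>\<int>[\<tau>]\<close> are represented by generators, one chosen from
  each class of associated elements.\<close>

definition rep :: "zt \<Rightarrow> zt" where "rep x = (SOME y. y \<sim> x)"

lemma rep_assoc [simp]: "rep x \<sim> x"
  unfolding rep_def by (rule someI[of _ x]) simp

lemma rep_eq_iff: "rep x = rep y \<longleftrightarrow> x \<sim> y"
proof
  assume "rep x = rep y"
  then show "x \<sim> y" using rep_assoc[of x] rep_assoc[of y] assoc_sym assoc_trans by metis
next
  assume "x \<sim> y"
  then have "z \<sim> x \<longleftrightarrow> z \<sim> y" for z using assoc_sym assoc_trans by blast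
  then show "rep x = rep y" by (simp add: rep_def)
qed

lemma rep_rep [simp]: "rep (rep x) = rep x"
  by (simp add: rep_eq_iff)

definition reps :: "zt set" where "reps = rep ` (- {0})"

lemma rep_in_reps: "x \<noteq> 0 \<Longrightarrow> rep x \<in> reps"
  by (auto simp: reps_def)

lemma reps_iff: "x \<in> reps \<longleftrightarrow> x \<noteq> 0 \<and> rep x = x"
proof
  assume "x \<in> reps"
  then obtain y where "y \<noteq> 0" "x = rep y" by (auto simp: reps_def)
  moreover have "rep y \<noteq> 0" using rep_assoc[of y] \<open>y \<noteq> 0\<close> by (metis assoc_0_iff(2))
  ultimately show "x \<noteq> 0 \<and> rep x = x" by simp
next
  assume "x \<noteq> 0 \<and> rep x = x"
  then show "x \<in> reps" unfolding reps_def by (intro image_eqI[of _ _ x]) auto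
qed

lemma reps_eqI: "x \<in> reps \<Longrightarrow> y \<in> reps \<Longrightarrow> x \<sim> y \<Longrightarrow> x = y"
  by (metis reps_iff rep_eq_iff)

subsection \<open>The index of an ideal\<close>

definition zmod :: "zt \<Rightarrow> zt set" where "zmod n = range ((*) n)"

lemma mem_zmod: "x \<in> zmod n \<longleftrightarrow> n dvd x"
  by (auto simp: zmod_def dvd_def)

lemma add_subgroup_zmod: "add_subgroup (zmod n)"
  by (auto simp: add_subgroup_def mem_zmod)

lemma group_index_zmod_of_int:
  assumes "m > 0"
  shows "group_index UNIV (zmod (of_int m)) = nat (m\<^sup>2)"
proof -
  have "group_index UNIV (zmod (of_int m)) = card ((\<lambda>x. (rat_part x mod m, tau_part x mod m)) ` UNIV)"
  proof (rule group_index_eq_card_image)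
    fix x y :: zt
    have "of_int m dvd z \<longleftrightarrow> m dvd rat_part z \<and> m dvd tau_part z" for z :: zt
      by (auto simp: dvd_def zt_eq_iff) (metis zt.sel)
    then show "x - y \<in> zmod (of_int m) \<longleftrightarrow> (rat_part x mod m, tau_part x mod m) = (rat_part y mod m, tau_part y mod m)"
      by (simp add: mem_zmod mod_eq_dvd_iff)
  qed
  also have "(\<lambda>x. (rat_part x mod m, tau_part x mod m)) ` UNIV = {0..<m} \<times> {0..<m}"
  proof (intro equalityI subsetI)
    fix v assume "v \<in> {0..<m} \<times> {0..<m}"
    then show "v \<in> range (\<lambda>x. (rat_part x mod m, tau_part x mod m))"
      by (auto simp: image_iff intro!: exI[of _ "ZT (fst v) (snd v)"])
  qed (use assms in auto)
  finally show ?thesis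
    using assms by (simp add: card_cartesian_product power2_eq_square nat_mult_distrib)
qed

text \<open>The Galois automorphism exchanges the ideals of an element and of its conjugate, so these have
  the same index; the product of the two indices is the index of a rational integer.\<close>

lemma group_index_zmod:
  assumes "n \<noteq> 0"
  shows "group_index UNIV (zmod n) = nat \<bar>nz n\<bar>"
proof -
  have "cj ` zmod n = zmod (cj n)"
    by (auto simp: zmod_def image_image) (metis cj_simps(10) rangeI)
  moreover have "range cj = UNIV" by (metis cj_simps(10) surjI)
  ultimately have c: "group_index UNIV (zmod (cj n)) = group_index UNIV (zmod n)"
    using group_index_inj_image[of cj UNIV "zmod n"] by (simp add: inj_def)
  have "(*) n ` UNIV = zmod n" "(*) n ` zmod (cj n) = zmod (n * cj n)"
    by (auto simp: zmod_def image_image mult.assoc)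
  then have i: "group_index (zmod n) (zmod (n * cj n)) = group_index UNIV (zmod (cj n))"
    using group_index_inj_image[of "(*) n" UNIV "zmod (cj n)"] assms
    by (simp add: inj_def right_diff_distrib)
  have "(of_int \<bar>nz n\<bar> :: zt) \<sim> of_int (nz n)" by (auto simp: assoc_def abs_if)
  then have z: "zmod (of_int \<bar>nz n\<bar>) = zmod (n * cj n)"
    unfolding nz_eq[symmetric] by (auto simp: mem_zmod assoc_def intro: dvd_trans)
  have "group_index UNIV (zmod (n * cj n)) =
      group_index UNIV (zmod n) * group_index (zmod n) (zmod (n * cj n))"
    by (intro group_index_tower add_subgroup_zmod add_subgroup_UNIV)
      (auto simp: mem_zmod intro: dvd_mult_left)
  also have "\<dots> = (group_index UNIV (zmod n))\<^sup>2" by (simp add: i c power2_eq_square)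
  finally have "(group_index UNIV (zmod n))\<^sup>2 = (nat \<bar>nz n\<bar>)\<^sup>2"
    using group_index_zmod_of_int[of "\<bar>nz n\<bar>"] assms
    by (simp add: z power2_eq_square nat_mult_distrib[symmetric])
  then show ?thesis by (simp add: power2_eq_iff_nonneg)
qed

section \<open>The icosian ring\<close>

text \<open>The icosians are represented by their coordinates in the basis \<open>1\<close>,
  \<open>i\<close>, \<open>(1 + i + j + k) / 2\<close>, \<open>((1 - \<tau>) + \<tau> i + k) /
  2\<close> over \<open>\<int>[\<tau>]\<close>.\<close>

datatype ico = Ico (cA: zt) (cB: zt) (cC: zt) (cD: zt)

lemma ico_eq_iff: "x = y \<longleftrightarrow> cA x = cA y \<and> cB x = cB y \<and> cC x = cC y \<and> cD x = cD y"
  by (cases x; cases y) auto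

definition emb :: "ico \<Rightarrow> real ^ 4" where
  "emb x = vector
     [rz (cA x) + rz (cC x) / 2 + rz (cD x) * (1 - tau) / 2,
      rz (cB x) + rz (cC x) / 2 + rz (cD x) * tau / 2,
      rz (cC x) / 2,
      rz (cC x) / 2 + rz (cD x) / 2]"

lemma emb_inj: "emb x = emb y \<longleftrightarrow> x = y"
  by (auto simp: emb_def vec_eq_iff forall_4 ico_eq_iff)

text \<open>The product is given by the multiplication table of the basis. The laws of a ring need
  not be verified on these formulas: they carry over from the quaternions along the injection
  \<open>emb\<close>.\<close>

instantiation ico :: "{zero, one, plus, minus, uminus, times}"
begin

definition "0 = Ico 0 0 0 0"
definition "1 = Ico 1 0 0 0"
definition "x + y = Ico (cA x + cA y) (cB x + cB y) (cC x + cC y) (cD x + cD y)"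
definition "x - y = Ico (cA x - cA y) (cB x - cB y) (cC x - cC y) (cD x - cD y)"
definition "- x = Ico (- cA x) (- cB x) (- cC x) (- cD x)"
definition "x * y = Ico
  (cA x * cA y - cB x * cB y + (tz - 1) * (cB x * cC y) - tz * (cC x * cB y) - cC x * cC y
    - cC x * cD y - tz * (cD x * cB y) - cD x * cD y)
  (cA x * cB y + cB x * cA y + (1 - tz) * (cB x * cC y) + (1 - tz) * (cB x * cD y) + tz * (cC x * cB y)
    + cC x * cD y - cD x * cC y)
  (cA x * cC y + cC x * cA y - cB x * cC y - cB x * cD y + cC x * cB y + cC x * cC y + cD x * cB y
    + (1 - tz) * (cD x * cC y))
  (cA x * cD y + cD x * cA y + 2 * (cB x * cC y) + cB x * cD y - 2 * (cC x * cB y)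
    + (1 - tz) * (cC x * cD y) - cD x * cB y + tz * (cD x * cC y) + (1 - tz) * (cD x * cD y))"

instance ..

end

lemmas ico_defs = zero_ico_def one_ico_def plus_ico_def minus_ico_def uminus_ico_def times_ico_def

lemma emb_linear [simp]:
  "emb 0 = 0" "emb (x + y) = emb x + emb y" "emb (x - y) = emb x - emb y" "emb (- x) = - emb x"
  by (simp_all add: emb_def ico_defs vec_eq_iff forall_4 algebra_simps add_divide_distrib
      diff_divide_distrib)

lemma emb_1: "emb 1 = vector [1, 0, 0, 0]"
  by (simp add: emb_def ico_defs vec_eq_iff forall_4)

lemma emb_mult [simp]: "emb (x * y) = emb x \<star> emb y"
  by (simp add: emb_def times_ico_def qmult_def vec_eq_iff forall_4 field_simps tau_square tau_mult)

instance ico :: ring_1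
proof
  fix a b c :: ico
  show "a * b * c = a * (b * c)"
    unfolding emb_inj[symmetric] by (simp add: qmult_assoc)
  show "(a + b) * c = a * c + b * c" "a * (b + c) = a * b + a * c"
    unfolding emb_inj[symmetric] by (simp_all add: qmult_def vec_eq_iff forall_4 algebra_simps)
  show "1 * a = a" "a * 1 = a"
    unfolding emb_inj[symmetric] by (simp_all add: emb_1 qmult_one)
  show "(0 :: ico) \<noteq> 1" by (simp add: ico_defs)
qed (simp_all add: ico_defs ico_eq_iff algebra_simps)

lemma ico_sel [simp]:
  "cA 0 = 0" "cB 0 = 0" "cC 0 = 0" "cD 0 = 0"
  "cA 1 = 1" "cB 1 = 0" "cC 1 = 0" "cD 1 = 0"
  "cA (x + y) = cA x + cA y" "cB (x + y) = cB x + cB y" "cC (x + y) = cC x + cC y" "cD (x + y) = cD x + cD y"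
  "cA (x - y) = cA x - cA y" "cB (x - y) = cB x - cB y" "cC (x - y) = cC x - cC y" "cD (x - y) = cD x - cD y"
  "cA (- x) = - cA x" "cB (- x) = - cB x" "cC (- x) = - cC x" "cD (- x) = - cD x"
  by (simp_all add: ico_defs)

lemma emb_inj': "inj emb" by (simp add: inj_def emb_inj)

lemma emb_range: "icosians = range emb"
proof -
  let ?b = "vector [1, 0, 0, 0] :: real ^ 4" and ?c = "vector [0, 1, 0, 0] :: real ^ 4"
  let ?d = "(1/2) *\<^sub>R vector [1, 1, 1, 1] :: real ^ 4"
  let ?e = "(1/2) *\<^sub>R vector [1 - tau, tau, 0, 1] :: real ^ 4"
  have ne: "?b \<noteq> ?c" "?b \<noteq> ?d" "?b \<noteq> ?e" "?c \<noteq> ?d" "?c \<noteq> ?e" "?d \<noteq> ?e"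
    by (simp_all add: vec_eq_iff forall_4)
  have sum: "(\<Sum>b\<in>{?b, ?c, ?d, ?e}. f b *\<^sub>R b) = f ?b *\<^sub>R ?b + (f ?c *\<^sub>R ?c + (f ?d *\<^sub>R ?d + f ?e *\<^sub>R ?e))" for f
    using ne by simp
  have e: "emb (Ico a b c d) = rz a *\<^sub>R ?b + (rz b *\<^sub>R ?c + (rz c *\<^sub>R ?d + rz d *\<^sub>R ?e))" for a b c d
    by (simp add: emb_def vec_eq_iff forall_4 algebra_simps)
  show ?thesis
  proof (intro equalityI subsetI)
    fix x assume "x \<in> icosians"
    then obtain f where x: "x = (\<Sum>b\<in>{?b, ?c, ?d, ?e}. f b *\<^sub>R b)"
      and f: "\<forall>b\<in>{?b, ?c, ?d, ?e}. f b \<in> Z_tau"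
      unfolding icosians_def span_over_def by blast
    from f have "f ?b \<in> range rz" "f ?c \<in> range rz" "f ?d \<in> range rz" "f ?e \<in> range rz"
      unfolding rz_range by simp_all
    then obtain a b c d where "f ?b = rz a" "f ?c = rz b" "f ?d = rz c" "f ?e = rz d"
      by (elim imageE) (rule that)
    then have "x = emb (Ico a b c d)" unfolding e x sum by simp
    then show "x \<in> range emb" by simp
  next
    fix x assume "x \<in> range emb"
    then obtain a b c d where x: "x = emb (Ico a b c d)" by (metis ico.exhaust imageE)
    define f where "f v = (if v = ?b then rz a else if v = ?c then rz b else if v = ?d then rz c else rz d)" for v
    have f: "f ?b = rz a" "f ?c = rz b" "f ?d = rz c" "f ?e = rz d"
      using ne unfolding f_def by (simp_all only: if_False if_True simp_thms) (metis+)?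
    have "x = (\<Sum>b\<in>{?b, ?c, ?d, ?e}. f b *\<^sub>R b)" unfolding x e sum f ..
    moreover have "\<forall>b\<in>{?b, ?c, ?d, ?e}. f b \<in> Z_tau" unfolding rz_range f_def by auto
    ultimately show "x \<in> icosians"
      unfolding icosians_def span_over_def by blast
  qed
qed

subsection \<open>Scalars, conjugation, trace and norm\<close>

definition sc :: "zt \<Rightarrow> ico" where "sc c = Ico c 0 0 0"

lemma sc_sel [simp]: "cA (sc c) = c" "cB (sc c) = 0" "cC (sc c) = 0" "cD (sc c) = 0"
  by (simp_all add: sc_def)

lemma sc_mult_sel [simp]:
  "cA (sc c * x) = c * cA x" "cB (sc c * x) = c * cB x" "cC (sc c * x) = c * cC x" "cD (sc c * x) = c * cD x"
  by (simp_all add: times_ico_def)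

lemma sc_commute: "x * sc c = sc c * x"
  by (simp add: ico_eq_iff times_ico_def mult.commute)

lemma sc_left_commute: "x * (sc c * y) = sc c * (x * y)"
  by (metis mult.assoc sc_commute)

lemma sc_simps [simp]:
  "sc 0 = 0" "sc 1 = 1" "sc (a + b) = sc a + sc b" "sc (a - b) = sc a - sc b" "sc (- a) = - sc a"
  "sc (a * b) = sc a * sc b"
  by (simp_all add: ico_eq_iff)

lemma sc_inj [simp]: "sc a = sc b \<longleftrightarrow> a = b"
  by (simp add: sc_def)

lemma sc_eq_0_iff [simp]: "sc a = 0 \<longleftrightarrow> a = 0"
  by (simp add: ico_eq_iff)

lemma sc_mult_cancel [simp]: "sc c * x = sc c * y \<longleftrightarrow> c = 0 \<or> x = y"
  by (auto simp: ico_eq_iff)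

lemma sc_mult_eq_0_iff [simp]: "sc c * x = 0 \<longleftrightarrow> c = 0 \<or> x = 0"
  by (auto simp: ico_eq_iff)

lemma emb_sc [simp]: "emb (sc c * x) = rz c *\<^sub>R emb x"
  by (simp add: emb_def vec_eq_iff forall_4 algebra_simps)

definition tr :: "ico \<Rightarrow> zt" where "tr x = 2 * cA x + cC x + (1 - tz) * cD x"

definition bar :: "ico \<Rightarrow> ico" where "bar x = sc (tr x) - x"

definition nr :: "ico \<Rightarrow> zt" where "nr x = cA (x * bar x)"

lemma tr_linear [simp]:
  "tr 0 = 0" "tr (x + y) = tr x + tr y" "tr (x - y) = tr x - tr y" "tr (- x) = - tr x"
  "tr (sc c * x) = c * tr x" "tr (sc c) = 2 * c" "tr 1 = 2"
  by (simp_all add: tr_def algebra_simps)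

definition qconj :: "real ^ 4 \<Rightarrow> real ^ 4" where
  "qconj v = vector [v $ 1, - v $ 2, - v $ 3, - v $ 4]"

lemma qconj_qmult: "qconj (u \<star> v) = qconj v \<star> qconj u"
  by (simp add: qconj_def qmult_def vec_eq_iff forall_4 algebra_simps)

lemma qmult_qconj: "v \<star> qconj v = (v \<bullet> v) *\<^sub>R vector [1, 0, 0, 0]"
  "qconj v \<star> v = (v \<bullet> v) *\<^sub>R vector [1, 0, 0, 0]"
  by (simp_all add: qconj_def qmult_def vec_eq_iff forall_4 inner_vec_def sum_4 algebra_simps)

lemma emb_bar [simp]: "emb (bar x) = qconj (emb x)"
  by (simp add: emb_def bar_def tr_def qconj_def vec_eq_iff forall_4 field_simps)

lemma bar_linear [simp]:
  "bar 0 = 0" "bar (x + y) = bar x + bar y" "bar (x - y) = bar x - bar y" "bar (- x) = - bar x"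
  "bar 1 = 1" "bar (sc c) = sc c" "bar (bar x) = x"
  by (simp_all add: bar_def ico_eq_iff algebra_simps)

lemma bar_mult [simp]: "bar (x * y) = bar y * bar x"
  unfolding emb_inj[symmetric] by (simp add: qconj_qmult)

lemma mult_bar: "x * bar x = sc (nr x)" and bar_mult_self: "bar x * x = sc (nr x)"
proof -
  have "cB (x * bar x) = 0" "cC (x * bar x) = 0" "cD (x * bar x) = 0"
    by (simp_all add: times_ico_def bar_def tr_def algebra_simps tz_square tz_mult)
  then show *: "x * bar x = sc (nr x)" by (simp add: ico_eq_iff nr_def)
  have "emb (bar x * x) = emb (x * bar x)" by (simp add: qmult_qconj)
  then have "bar x * x = x * bar x" by (simp only: emb_inj)
  then show "bar x * x = sc (nr x)" using * by simp
qed

lemma rz_nr: "rz (nr x) = emb x \<bullet> emb x"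
proof -
  have "emb (sc (nr x) * 1) = (emb x \<bullet> emb x) *\<^sub>R vector [1, 0, 0, 0]"
    using mult_bar[of x, symmetric] by (simp add: qmult_qconj)
  then show ?thesis by (simp only: emb_sc emb_1) (simp add: vec_eq_iff forall_4)
qed

lemma nr_mult [simp]: "nr (x * y) = nr x * nr y"
proof -
  have "sc (nr (x * y)) = x * (y * bar y) * bar x" by (simp add: mult_bar[symmetric] mult.assoc)
  also have "\<dots> = sc (nr y) * (x * bar x)" by (simp only: mult_bar[of y] sc_commute[of x] mult.assoc)
  also have "\<dots> = sc (nr x * nr y)" by (simp add: mult_bar mult.commute[of "nr x"])
  finally show ?thesis by (simp only: sc_inj)
qed

lemma nr_simps [simp]: "nr 0 = 0" "nr 1 = 1" "nr (sc c) = c * c" "nr (- x) = nr x" "nr (bar x) = nr x"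
proof -
  show "nr (bar x) = nr x" using mult_bar[of "bar x"] bar_mult_self[of x] by simp
qed (simp_all add: nr_def)

lemma nr_eq_0_iff [simp]: "nr x = 0 \<longleftrightarrow> x = 0"
proof
  assume "nr x = 0"
  then have "emb x = emb 0" using rz_nr[of x] by simp
  then show "x = 0" by (simp only: emb_inj)
qed simp

lemma nr_diff: "nr (x - y) = nr x - tr (x * bar y) + nr y"
proof -
  have "y * bar x = sc (tr (x * bar y)) - x * bar y"
    using bar_mult[of x "bar y"] unfolding bar_def[of "x * bar y"] by simp
  then have "sc (nr (x - y)) = sc (nr x - tr (x * bar y) + nr y)"
    by (simp add: mult_bar[symmetric] algebra_simps)
  then show ?thesis by (simp only: sc_inj)
qed

lemma ico_mult_eq_0_iff [simp]: "(x :: ico) * y = 0 \<longleftrightarrow> x = 0 \<or> y = 0"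
  by (metis mult_eq_0_iff mult_zero_left mult_zero_right nr_eq_0_iff nr_mult)

lemma ico_mult_left_cancel [simp]: "(x :: ico) * y = x * z \<longleftrightarrow> x = 0 \<or> y = z"
  using ico_mult_eq_0_iff[of x "y - z"] by (simp add: right_diff_distrib del: ico_mult_eq_0_iff)

lemma ico_mult_right_cancel [simp]: "(y :: ico) * x = z * x \<longleftrightarrow> x = 0 \<or> y = z"
  using ico_mult_eq_0_iff[of "y - z" x] by (auto simp add: left_diff_distrib simp del: ico_mult_eq_0_iff)

lemma tr_mult_commute: "tr (x * y) = tr (y * x)"
  by (simp add: tr_def times_ico_def algebra_simps tz_square tz_mult)

subsection \<open>The twist\<close>

text \<open>The twist maps the quaternion \<open>(x\<^sub>0, x\<^sub>1, x\<^sub>2,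
  x\<^sub>3)\<close> to \<open>(x\<^sub>0', x\<^sub>1', x\<^sub>3', x\<^sub>2')\<close>. It fixes
  the first three elements of the basis and maps the fourth one to the difference of the third and
  the fourth.\<close>

definition tw :: "ico \<Rightarrow> ico" where
  "tw x = Ico (cj (cA x)) (cj (cB x)) (cj (cC x) + cj (cD x)) (- cj (cD x))"

lemma tw_sel [simp]:
  "cA (tw x) = cj (cA x)" "cB (tw x) = cj (cB x)" "cC (tw x) = cj (cC x) + cj (cD x)" "cD (tw x) = - cj (cD x)"
  by (simp_all add: tw_def)

lemma tw_linear [simp]:
  "tw 0 = 0" "tw 1 = 1" "tw (x + y) = tw x + tw y" "tw (x - y) = tw x - tw y" "tw (- x) = - tw x"
  "tw (sc c) = sc (cj c)" "tw (tw x) = x"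
  by (simp_all add: ico_eq_iff)

lemma tw_mult [simp]: "tw (x * y) = tw y * tw x"
  by (simp add: ico_eq_iff times_ico_def algebra_simps tz_square tz_mult)

lemma tw_bar: "tw (bar x) = bar (tw x)"
  by (simp add: bar_def tr_def ico_eq_iff algebra_simps)

lemma nr_tw [simp]: "nr (tw x) = cj (nr x)"
proof -
  have "sc (nr (tw x)) = tw (bar x * x)" by (simp add: tw_bar mult_bar)
  then show ?thesis by (simp add: bar_mult_self)
qed

lemma tw_inj [simp]: "tw x = tw y \<longleftrightarrow> x = y" by (metis tw_linear(7))

lemma tw_eq_0_iff [simp]: "tw x = 0 \<longleftrightarrow> x = 0" using tw_inj[of x 0] by (simp del: tw_inj)

text \<open>The absolute norm, a positive integer for each non-zero icosian.\<close>

definition anorm :: "ico \<Rightarrow> int" where "anorm x = nz (nr x)"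

lemma anorm_mult: "anorm (x * y) = anorm x * anorm y" by (simp add: anorm_def nz_mult)

lemma anorm_sc: "anorm (sc c) = (nz c)\<^sup>2" by (simp add: anorm_def nz_mult power2_eq_square)

text \<open>The norm of an icosian is totally positive, as its conjugate is the norm of the twisted
  icosian.\<close>

lemma anorm_pos: "x \<noteq> 0 \<Longrightarrow> anorm x > 0"
proof -
  assume "x \<noteq> 0"
  then have "rz (nr x) > 0" "rz (nr (tw x)) > 0" by (auto simp: rz_nr simp del: nr_tw dest: arg_cong[of _ _ emb] simp: emb_inj[of _ 0, simplified])
  then have "rz (nr x * cj (nr x)) > 0" by simp
  then have "rz (of_int (anorm x)) > 0" by (simp add: anorm_def nz_eq)
  then show ?thesis by simp
qed

lemma anorm_simps [simp]: "anorm 0 = 0" "anorm 1 = 1" "anorm (bar x) = anorm x" "anorm (tw x) = anorm x"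
  by (simp_all add: anorm_def)

lemma anorm_eq_0_iff [simp]: "anorm x = 0 \<longleftrightarrow> x = 0" by (simp add: anorm_def)

definition iunit :: "ico \<Rightarrow> bool" where "iunit u \<longleftrightarrow> nr u dvd 1"

lemma iunit_iff_anorm: "iunit u \<longleftrightarrow> anorm u = 1"
  unfolding iunit_def zt_unit_iff anorm_def[symmetric] using anorm_pos[of u] by (cases "u = 0") auto

lemma iunit_inverse:
  assumes "iunit u"
  shows "\<exists>v. iunit v \<and> u * v = 1 \<and> v * u = 1"
proof -
  obtain w where w: "1 = nr u * w" using assms unfolding iunit_def by (rule dvdE)
  have "u * (bar u * sc w) = sc (nr u * w)"
    by (simp only: mult.assoc[symmetric] mult_bar sc_simps)
  moreover have "bar u * sc w * u = sc (nr u * w)"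
    by (simp only: sc_commute[of "bar u"] mult.assoc bar_mult_self sc_simps(6)[symmetric] mult.commute[of w])
  moreover have "iunit (bar u * sc w)"
  proof -
    have "1 = (nr u * (w * w)) * nr u" using w by (metis mult.assoc mult.commute mult_1)
    then have "1 = nr (bar u * sc w) * nr u" by simp
    then show ?thesis unfolding iunit_def by (rule dvdI)
  qed
  ultimately show ?thesis using w by (metis sc_simps(2))
qed

subsection \<open>Divisibility by scalars\<close>

definition sdvd :: "zt \<Rightarrow> ico \<Rightarrow> bool" where
  "sdvd c x \<longleftrightarrow> (\<exists>y. x = sc c * y)"

lemma sdvd_iff: "sdvd c x \<longleftrightarrow> c dvd cA x \<and> c dvd cB x \<and> c dvd cC x \<and> c dvd cD x"
proof
  assume "c dvd cA x \<and> c dvd cB x \<and> c dvd cC x \<and> c dvd cD x"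
  then obtain k l m n where "cA x = c * k" "cB x = c * l" "cC x = c * m" "cD x = c * n"
    by (auto elim!: dvdE)
  then have "x = sc c * Ico k l m n" by (simp add: ico_eq_iff)
  then show "sdvd c x" unfolding sdvd_def ..
qed (auto simp: sdvd_def)

lemma sdvdI: "x = sc c * y \<Longrightarrow> sdvd c x" by (auto simp: sdvd_def)

lemma sdvd_0 [simp]: "sdvd c 0" by (simp add: sdvd_iff)

lemma sdvd_add: "sdvd c x \<Longrightarrow> sdvd c y \<Longrightarrow> sdvd c (x + y)"
  and sdvd_diff: "sdvd c x \<Longrightarrow> sdvd c y \<Longrightarrow> sdvd c (x - y)"
  by (simp_all add: sdvd_iff)

lemma sdvd_mult_right: "sdvd c x \<Longrightarrow> sdvd c (x * y)"
  unfolding sdvd_def by (metis mult.assoc)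

lemma sdvd_mult_left: "sdvd c y \<Longrightarrow> sdvd c (x * y)"
  unfolding sdvd_def by (metis sc_left_commute)

lemma sdvd_sc_iff [simp]: "sdvd c (sc d) \<longleftrightarrow> c dvd d" by (simp add: sdvd_iff)

lemma sdvd_dvd_trans: "c dvd d \<Longrightarrow> sdvd d x \<Longrightarrow> sdvd c x"
  by (auto simp: sdvd_iff intro: dvd_trans)

lemma sdvd_sc_mult_cancel: "c \<noteq> 0 \<Longrightarrow> sdvd (c * d) (sc c * x) \<longleftrightarrow> sdvd d x"
  by (simp add: sdvd_iff)

lemma sdvd_tr: "sdvd c x \<Longrightarrow> c dvd tr x" by (auto simp: sdvd_def)

lemma sdvd_prime_sc_mult:
  assumes "prime_elem c" "sdvd c (sc d * x)"
  shows "c dvd d \<or> sdvd c x"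
  using assms by (auto simp: sdvd_iff prime_elem_dvd_mult_iff)

lemma tw_sdvd: "sdvd c x \<Longrightarrow> sdvd (cj c) (tw x)"
  by (auto simp: sdvd_def) (metis sc_commute)

subsection \<open>The index of a principal right ideal\<close>

definition rid :: "ico \<Rightarrow> ico set" where "rid p = range ((*) p)"

lemma rid_mult_in [simp]: "p * x \<in> rid p" by (auto simp: rid_def)

lemma rid_self [simp]: "p \<in> rid p" using rid_mult_in[of p 1] by simp

lemma rid_multE: "x \<in> rid p \<Longrightarrow> (\<And>y. x = p * y \<Longrightarrow> P) \<Longrightarrow> P" by (auto simp: rid_def)

lemma mem_rid_sc: "x \<in> rid (sc c) \<longleftrightarrow> sdvd c x" by (auto simp: rid_def sdvd_def)

lemma rid_1 [simp]: "rid 1 = UNIV" by (auto simp: rid_def)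

lemma rid_subset_iff: "rid p \<subseteq> rid q \<longleftrightarrow> p \<in> rid q"
proof
  show "p \<in> rid q" if "rid p \<subseteq> rid q" using that rid_self by blast
qed (auto simp: rid_def mult.assoc)

lemma rid_mult_subset: "rid (p * q) \<subseteq> rid p" by (simp add: rid_subset_iff)

lemma times_image_rid: "(*) p ` rid q = rid (p * q)"
  by (auto simp: rid_def image_image mult.assoc)

lemma add_subgroup_rid [simp]: "add_subgroup (rid p)"
  unfolding rid_def by (rule add_subgroup_image) (simp_all add: right_diff_distrib)

lemma inj_times: "p \<noteq> (0 :: ico) \<Longrightarrow> inj ((*) p)" by (simp add: inj_def)

lemma group_index_rid_mult:
  assumes "p \<noteq> 0"
  shows "group_index UNIV (rid (p * q)) = group_index UNIV (rid p) * group_index UNIV (rid q)"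
proof -
  have "group_index UNIV (rid (p * q)) = group_index UNIV (rid p) * group_index (rid p) (rid (p * q))"
    by (intro group_index_tower) (auto simp: rid_mult_subset)
  also have "group_index (rid p) (rid (p * q)) = group_index ((*) p ` UNIV) ((*) p ` rid q)"
    by (simp only: times_image_rid rid_def[symmetric])
  also have "\<dots> = group_index UNIV (rid q)"
    by (intro group_index_inj_image inj_times assms right_diff_distrib)
  finally show ?thesis .
qed

lemma group_index_rid_sc:
  assumes "n \<noteq> 0"
  shows "group_index UNIV (rid (sc n)) = nat \<bar>nz n\<bar> ^ 4"
proof -
  obtain c where c: "\<And>x. x - c x \<in> zmod n" "\<And>x y. c x = c y \<longleftrightarrow> x - y \<in> zmod n"
    using coset_representatives[OF add_subgroup_zmod] by blast
  have C: "card (range c) = nat \<bar>nz n\<bar>"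
    using group_index_eq_card_image[of UNIV "zmod n" c] group_index_zmod[OF assms] by (simp add: c(2))
  let ?f = "\<lambda>x. (c (cA x), c (cB x), c (cC x), c (cD x))"
  have "group_index UNIV (rid (sc n)) = card (range ?f)"
    by (rule group_index_eq_card_image) (simp add: mem_rid_sc sdvd_iff c(2) mem_zmod)
  also have "range ?f = range c \<times> range c \<times> range c \<times> range c"
  proof (intro equalityI subsetI)
    fix v assume "v \<in> range c \<times> range c \<times> range c \<times> range c"
    then obtain x y z w where "v = (c x, c y, c z, c w)" by auto
    then have "v = ?f (Ico x y z w)" by simp
    then show "v \<in> range ?f" by blast
  qed auto
  finally show ?thesis by (simp add: card_cartesian_product C power4_eq_xxxx)
qed

text \<open>The icosian \<open>a + b i + c j + d k\<close>.\<close>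

definition lipschitz :: "zt \<Rightarrow> zt \<Rightarrow> zt \<Rightarrow> zt \<Rightarrow> ico" where
  "lipschitz a b c d = Ico (a - c - (d - c) * (1 - tz)) (b - c - (d - c) * tz) (2 * c) (2 * (d - c))"

lemma emb_lipschitz: "emb (lipschitz a b c d) = vector [rz a, rz b, rz c, rz d]"
  by (simp add: emb_def lipschitz_def vec_eq_iff forall_4 field_simps)

lemma nr_lipschitz: "nr (lipschitz a b c d) = a * a + b * b + c * c + d * d"
proof -
  have "rz (nr (lipschitz a b c d)) = rz (a * a + b * b + c * c + d * d)"
    by (simp add: rz_nr emb_lipschitz inner_vec_def sum_4)
  then show ?thesis by (simp only: rz_inj)
qed

text \<open>Any non-zero pure quaternion that is orthogonal to the imaginary part of \<open>p\<close> conjugates \<open>p\<close> into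
  its conjugate.\<close>

lemma bar_is_conjugate: "\<exists>u. u \<noteq> 0 \<and> u * p = bar p * u"
proof -
  define b c where "b = 2 * cB p + cC p + tz * cD p" and "c = cC p"
  define u where "u = (if b = 0 \<and> c = 0 then lipschitz 0 1 0 0 else lipschitz 0 c (- b) 0)"
  have "nr u \<noteq> 0"
  proof (cases "b = 0 \<and> c = 0")
    case False
    then have "rz c * rz c + rz b * rz b \<noteq> 0"
      by (metis add_nonneg_eq_0_iff mult_eq_0_iff rz_eq_0_iff zero_le_square)
    then have "rz (c * c + b * b) \<noteq> rz 0" by (metis rz_mult rz_simps(1,3))
    moreover have "nr u = c * c + b * b" using False unfolding u_def by (simp only: if_False nr_lipschitz) simp
    ultimately show ?thesis by metis
  qed (simp add: u_def nr_lipschitz)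
  then have "u \<noteq> 0" by auto
  moreover have "u * p = bar p * u"
  proof -
    have p: "rz b = 2 * (emb p $ 2)" "rz c = 2 * (emb p $ 3)"
      by (simp_all add: b_def c_def emb_def algebra_simps)
    have "emb (u * p) = emb (bar p * u)"
    proof (cases "b = 0 \<and> c = 0")
      case True
      then have "emb p $ 2 = 0" "emb p $ 3 = 0" using p by auto
      then show ?thesis using True
        by (simp add: u_def emb_lipschitz qmult_def qconj_def vec_eq_iff forall_4)
    next
      case False
      then have "u = lipschitz 0 c (- b) 0" unfolding u_def by (simp only: if_False)
      then have "emb u = vector [0, 2 * (emb p $ 3), - 2 * (emb p $ 2), 0]"
        by (simp add: emb_lipschitz p)
      then show ?thesis
        by (simp add: qmult_def qconj_def vec_eq_iff forall_4 algebra_simps)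
    qed
    then show ?thesis by (simp only: emb_inj)
  qed
  ultimately show ?thesis by blast
qed

text \<open>By the previous lemma, a multiplicative function cannot distinguish \<open>p\<close>
  from its conjugate, and the product of the two is the scalar given by the norm of
  \<open>p\<close>. This computes the index of a principal right ideal, and later also that of a
  sublattice.\<close>

lemma multiplicative_eq_norm_square:
  fixes j :: "ico \<Rightarrow> nat"
  assumes mult: "\<And>p q. p \<noteq> 0 \<Longrightarrow> q \<noteq> 0 \<Longrightarrow> j (p * q) = j p * j q"
    and sc: "\<And>c. c \<noteq> 0 \<Longrightarrow> j (sc c) = nat \<bar>nz c\<bar> ^ 4"
    and "p \<noteq> 0"
  shows "j p = nat (anorm p) ^ 2"
proof -
  have nz: "bar x \<noteq> 0" "j x * j (bar x) = nat (anorm x) ^ 4" if "x \<noteq> 0" for x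
  proof -
    show b: "bar x \<noteq> 0" using that by (metis bar_linear(1,7))
    have "j x * j (bar x) = j (sc (nr x))" using mult[OF that b] by (simp add: mult_bar)
    also have "\<dots> = nat (anorm x) ^ 4" using sc[of "nr x"] anorm_pos[OF that] that by (simp add: anorm_def)
    finally show "j x * j (bar x) = nat (anorm x) ^ 4" .
  qed
  obtain u where u: "u \<noteq> 0" "u * p = bar p * u" using bar_is_conjugate by blast
  have "j u \<noteq> 0" using nz(2)[OF u(1)] anorm_pos[OF u(1)] by (metis mult_0 power_not_zero zero_less_nat_eq less_irrefl)
  moreover have "j u * j p = j (bar p) * j u"
    using mult[OF u(1) assms(3)] mult[OF nz(1)[OF assms(3)] u(1)] u(2) by metis
  ultimately have "j (bar p) = j p" by simp
  with nz(2)[OF assms(3)] have "(j p)\<^sup>2 = (nat (anorm p) ^ 2)\<^sup>2"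
    by (simp only: power_mult[symmetric]) (simp add: power2_eq_square)
  then show ?thesis using power2_eq_iff_nonneg[of "j p" "nat (anorm p) ^ 2"] by blast
qed

lemma group_index_rid: "p \<noteq> 0 \<Longrightarrow> group_index UNIV (rid p) = nat (anorm p) ^ 2"
  by (rule multiplicative_eq_norm_square) (simp_all add: group_index_rid_mult group_index_rid_sc)

section \<open>The Euclidean algorithm for icosians\<close>

lemma round_error: "(t - of_int (round t))\<^sup>2 \<le> 1/4" for t :: real
proof -
  have "\<bar>t - of_int (round t)\<bar> \<le> 1/2" using of_int_round_abs_le[of t] by (simp add: abs_minus_commute)
  then have "\<bar>t - of_int (round t)\<bar>\<^sup>2 \<le> (1/2)\<^sup>2" by (intro power_mono) auto
  then show ?thesis by (simp add: power2_eq_square)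
qed

text \<open>Moving a coordinate to the second nearest integer changes its squared error \<open>e\<^sup>2\<close> into
  \<open>(1 - \<bar>e\<bar>)\<^sup>2\<close>.\<close>

lemma second_nearest:
  fixes t :: real
  shows "\<exists>a::int. odd (a - round t) \<and>
    (t - of_int a)\<^sup>2 = (t - of_int (round t))\<^sup>2 + 1 - 2 * \<bar>t - of_int (round t)\<bar>"
proof (cases "t \<ge> of_int (round t)")
  case True
  then show ?thesis by (intro exI[of _ "round t + 1"]) (simp add: power2_eq_square algebra_simps)
next
  case False
  then show ?thesis by (intro exI[of _ "round t - 1"]) (simp add: power2_eq_square algebra_simps)
qed

lemma D4_covering_aux:
  fixes t e1 e2 e3 :: real
  assumes "e1 \<le> \<bar>t - of_int (round t)\<bar>" "e2 \<le> \<bar>t - of_int (round t)\<bar>" "e3 \<le> \<bar>t - of_int (round t)\<bar>"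
    "0 \<le> e1" "0 \<le> e2" "0 \<le> e3"
  shows "\<exists>a::int. odd (a - round t) \<and> (t - of_int a)\<^sup>2 + e1\<^sup>2 + e2\<^sup>2 + e3\<^sup>2 \<le> 1"
proof -
  define e where "e = \<bar>t - of_int (round t)\<bar>"
  have e: "e \<le> 1/2" using of_int_round_abs_le[of t] by (simp add: e_def abs_minus_commute)
  have "e1\<^sup>2 \<le> e\<^sup>2" "e2\<^sup>2 \<le> e\<^sup>2" "e3\<^sup>2 \<le> e\<^sup>2" using assms by (simp_all only: e_def power_mono)
  moreover have "e * (2 * e) \<le> e * 1" using e by (intro mult_left_mono) (auto simp: e_def)
  moreover obtain a :: int where a: "odd (a - round t)" "(t - of_int a)\<^sup>2 = e\<^sup>2 + 1 - 2 * e"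
    using second_nearest[of t] by (auto simp: e_def)
  ultimately have "(t - of_int a)\<^sup>2 + e1\<^sup>2 + e2\<^sup>2 + e3\<^sup>2 \<le> 1" by (simp add: power2_eq_square)
  then show ?thesis using a(1) by blast
qed

text \<open>The integer vectors with even coordinate sum have covering radius \<open>1\<close>: if
  rounding all coordinates produces an odd sum, the coordinate with the largest error is moved to
  its second nearest integer.\<close>

lemma D4_covering:
  fixes t0 t1 t2 t3 :: real
  shows "\<exists>a b c d :: int. even (a + b + c + d) \<and>
    (t0 - of_int a)\<^sup>2 + (t1 - of_int b)\<^sup>2 + (t2 - of_int c)\<^sup>2 + (t3 - of_int d)\<^sup>2 \<le> 1"
proof (cases "even (round t0 + round t1 + round t2 + round t3)")
  case True
  then show ?thesis
    using round_error[of t0] round_error[of t1] round_error[of t2] round_error[of t3]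
    by (intro exI[of _ "round t0"] exI[of _ "round t1"] exI[of _ "round t2"] exI[of _ "round t3"]) auto
next
  case False
  define e where "e t = \<bar>t - of_int (round t)\<bar>" for t :: real
  have sq: "(e t)\<^sup>2 = (t - of_int (round t))\<^sup>2" "0 \<le> e t" for t by (simp_all add: e_def)
  consider "e t1 \<le> e t0" "e t2 \<le> e t0" "e t3 \<le> e t0" | "e t0 \<le> e t1" "e t2 \<le> e t1" "e t3 \<le> e t1"
    | "e t0 \<le> e t2" "e t1 \<le> e t2" "e t3 \<le> e t2" | "e t0 \<le> e t3" "e t1 \<le> e t3" "e t2 \<le> e t3"
    by linarith
  then show ?thesis
  proof cases
    case 1
    obtain a :: int where "odd (a - round t0)" "(t0 - of_int a)\<^sup>2 + (e t1)\<^sup>2 + (e t2)\<^sup>2 + (e t3)\<^sup>2 \<le> 1"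
      using D4_covering_aux[of "e t1" t0 "e t2" "e t3", folded e_def, OF 1 sq(2) sq(2) sq(2)] by blast
    moreover from this(1) False have "even (a + round t1 + round t2 + round t3)" by presburger
    ultimately show ?thesis unfolding sq
      by (intro exI[of _ "a"] exI[of _ "round t1"] exI[of _ "round t2"] exI[of _ "round t3"]) (simp add: add_ac)
  next
    case 2
    obtain a :: int where "odd (a - round t1)" "(t1 - of_int a)\<^sup>2 + (e t0)\<^sup>2 + (e t2)\<^sup>2 + (e t3)\<^sup>2 \<le> 1"
      using D4_covering_aux[of "e t0" t1 "e t2" "e t3", folded e_def, OF 2 sq(2) sq(2) sq(2)] by blast
    moreover from this(1) False have "even (round t0 + a + round t2 + round t3)" by presburger
    ultimately show ?thesis unfolding sq
      by (intro exI[of _ "round t0"] exI[of _ "a"] exI[of _ "round t2"] exI[of _ "round t3"]) (simp add: add_ac)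
  next
    case 3
    obtain a :: int where "odd (a - round t2)" "(t2 - of_int a)\<^sup>2 + (e t0)\<^sup>2 + (e t1)\<^sup>2 + (e t3)\<^sup>2 \<le> 1"
      using D4_covering_aux[of "e t0" t2 "e t1" "e t3", folded e_def, OF 3 sq(2) sq(2) sq(2)] by blast
    moreover from this(1) False have "even (round t0 + round t1 + a + round t3)" by presburger
    ultimately show ?thesis unfolding sq
      by (intro exI[of _ "round t0"] exI[of _ "round t1"] exI[of _ "a"] exI[of _ "round t3"]) (simp add: add_ac)
  next
    case 4
    obtain a :: int where "odd (a - round t3)" "(t3 - of_int a)\<^sup>2 + (e t0)\<^sup>2 + (e t1)\<^sup>2 + (e t2)\<^sup>2 \<le> 1"
      using D4_covering_aux[of "e t0" t3 "e t1" "e t2", folded e_def, OF 4 sq(2) sq(2) sq(2)] by blast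
    moreover from this(1) False have "even (round t0 + round t1 + round t2 + a)" by presburger
    ultimately show ?thesis unfolding sq
      by (intro exI[of _ "round t0"] exI[of _ "round t1"] exI[of _ "round t2"] exI[of _ "a"]) (simp add: add_ac)
  qed
qed

text \<open>In doubled coordinates the Hurwitz quaternions are the integer vectors whose entries all have
  the same parity.\<close>

lemma near_parity:
  fixes t :: real
  shows "\<exists>a b :: int. even a \<and> odd b \<and>
    (t - of_int a)\<^sup>2 \<le> \<bar>t - of_int a\<bar> \<and> (t - of_int b)\<^sup>2 \<le> 1 - \<bar>t - of_int a\<bar>"
proof -
  define a where "a = 2 * round (t / 2)"
  define e where "e = \<bar>t - of_int a\<bar>"
  have "\<bar>of_int (round (t / 2)) - t / 2\<bar> \<le> 1/2" by (rule of_int_round_abs_le)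
  then have "\<bar>t - 2 * of_int (round (t / 2))\<bar> \<le> 1" by linarith
  then have e: "0 \<le> e" "e \<le> 1" by (simp_all add: e_def a_def)
  define b where "b = (if t \<ge> of_int a then a + 1 else a - 1)"
  have "\<bar>t - of_int b\<bar> = 1 - e" using e by (auto simp: b_def e_def)
  then have "(t - of_int b)\<^sup>2 = (1 - e) * (1 - e)" by (metis power2_abs power2_eq_square)
  moreover have "(t - of_int a)\<^sup>2 = e * e" by (simp add: e_def power2_eq_square)
  moreover have "e * e \<le> e" "(1 - e) * (1 - e) \<le> 1 - e" using e by (simp_all add: mult_left_le)
  ultimately have "(t - of_int a)\<^sup>2 \<le> e" "(t - of_int b)\<^sup>2 \<le> 1 - e" by simp_all
  moreover have "even a" "odd b" by (auto simp: a_def b_def)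
  ultimately show ?thesis unfolding e_def by blast
qed

lemma hurwitz_covering:
  fixes t0 t1 t2 t3 :: real
  shows "\<exists>a b c d :: int. even (a - b) \<and> even (a - c) \<and> even (a - d) \<and>
    (t0 - of_int a)\<^sup>2 + (t1 - of_int b)\<^sup>2 + (t2 - of_int c)\<^sup>2 + (t3 - of_int d)\<^sup>2 \<le> 2"
proof -
  obtain a0 b0 where 0: "even a0" "odd b0" "(t0 - of_int a0)\<^sup>2 \<le> \<bar>t0 - of_int a0\<bar>"
    "(t0 - of_int b0)\<^sup>2 \<le> 1 - \<bar>t0 - of_int a0\<bar>" using near_parity by blast
  obtain a1 b1 where 1: "even a1" "odd b1" "(t1 - of_int a1)\<^sup>2 \<le> \<bar>t1 - of_int a1\<bar>"
    "(t1 - of_int b1)\<^sup>2 \<le> 1 - \<bar>t1 - of_int a1\<bar>" using near_parity by blast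
  obtain a2 b2 where 2: "even a2" "odd b2" "(t2 - of_int a2)\<^sup>2 \<le> \<bar>t2 - of_int a2\<bar>"
    "(t2 - of_int b2)\<^sup>2 \<le> 1 - \<bar>t2 - of_int a2\<bar>" using near_parity by blast
  obtain a3 b3 where 3: "even a3" "odd b3" "(t3 - of_int a3)\<^sup>2 \<le> \<bar>t3 - of_int a3\<bar>"
    "(t3 - of_int b3)\<^sup>2 \<le> 1 - \<bar>t3 - of_int a3\<bar>" using near_parity by blast
  show ?thesis
  proof (cases "\<bar>t0 - of_int a0\<bar> + \<bar>t1 - of_int a1\<bar> + \<bar>t2 - of_int a2\<bar> + \<bar>t3 - of_int a3\<bar> \<le> 2")
    case True
    then have "(t0 - of_int a0)\<^sup>2 + (t1 - of_int a1)\<^sup>2 + (t2 - of_int a2)\<^sup>2 + (t3 - of_int a3)\<^sup>2 \<le> 2"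
      using 0(3) 1(3) 2(3) 3(3) by linarith
    moreover have "even (a0 - a1)" "even (a0 - a2)" "even (a0 - a3)" using 0 1 2 3 by auto
    ultimately show ?thesis by blast
  next
    case False
    then have "(t0 - of_int b0)\<^sup>2 + (t1 - of_int b1)\<^sup>2 + (t2 - of_int b2)\<^sup>2 + (t3 - of_int b3)\<^sup>2 \<le> 2"
      using 0(4) 1(4) 2(4) 3(4) by linarith
    moreover have "even (b0 - b1)" "even (b0 - b2)" "even (b0 - b3)" using 0 1 2 3 by auto
    ultimately show ?thesis by blast
  qed
qed

text \<open>Every quaternion over the field is \<open>u + v (\<tau> - 1)\<close> with rational
  \<open>u\<close> and \<open>v\<close>; the eight integers below are the coordinates of \<open>2
  u\<close> and \<open>2 v\<close> for an icosian. The basis \<open>1, \<tau> - 1\<close> is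
  chosen because it is orthonormal for the form that maps \<open>\<alpha>\<close> to the sum
  \<open>a + b\<close> of the coordinates of \<open>\<alpha>\<^sup>2 = a + b \<tau>\<close>. The
  sum of the coordinates of the norm of an icosian is therefore a sum of eight squares.\<close>

definition U0 where "U0 x = 2 * (rat_part (cA x) + tau_part (cA x)) + rat_part (cC x) + tau_part (cC x) - tau_part (cD x)"
definition U1 where "U1 x = 2 * (rat_part (cB x) + tau_part (cB x)) + rat_part (cC x) + tau_part (cC x) + rat_part (cD x) + 2 * tau_part (cD x)"
definition U2 where "U2 x = rat_part (cC x) + tau_part (cC x)"
definition U3 where "U3 x = rat_part (cC x) + tau_part (cC x) + rat_part (cD x) + tau_part (cD x)"
definition V0 where "V0 x = 2 * tau_part (cA x) + tau_part (cC x) - rat_part (cD x)"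
definition V1 where "V1 x = 2 * tau_part (cB x) + tau_part (cC x) + rat_part (cD x) + tau_part (cD x)"
definition V2 where "V2 x = tau_part (cC x)"
definition V3 where "V3 x = tau_part (cC x) + tau_part (cD x)"

lemmas UV_defs = U0_def U1_def U2_def U3_def V0_def V1_def V2_def V3_def

definition trace_form :: "ico \<Rightarrow> int" where
  "trace_form x = (U0 x)\<^sup>2 + (U1 x)\<^sup>2 + (U2 x)\<^sup>2 + (U3 x)\<^sup>2 + (V0 x)\<^sup>2 + (V1 x)\<^sup>2 + (V2 x)\<^sup>2 + (V3 x)\<^sup>2"

lemma trace_form_eq: "trace_form x = 4 * (rat_part (nr x) + tau_part (nr x))"
  by (simp add: trace_form_def UV_defs nr_def bar_def tr_def times_ico_def power2_eq_square algebra_simps)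

text \<open>An instance of the inequality of the arithmetic and the geometric mean: for a norm
  \<open>a + b \<tau>\<close> one has \<open>5 (a + b)\<^sup>2 - 4 (a\<^sup>2 + a b - b\<^sup>2) =
  (a + 3 b)\<^sup>2\<close>.\<close>

lemma anorm_le_trace_form: "64 * anorm x \<le> 5 * (trace_form x)\<^sup>2"
proof -
  define a b where "a = rat_part (nr x)" and "b = tau_part (nr x)"
  have "5 * (trace_form x)\<^sup>2 - 64 * anorm x = 16 * (a + 3 * b)\<^sup>2"
    by (simp add: trace_form_eq anorm_def nz_def a_def[symmetric] b_def[symmetric] power2_eq_square algebra_simps)
  moreover have "0 \<le> 16 * (a + 3 * b)\<^sup>2" by simp
  ultimately show ?thesis by linarith
qed

text \<open>In doubled coordinates the vector \<open>u\<close> of an icosian is any integer vector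
  \<open>w\<close> with even coordinate sum. Once it is fixed, \<open>v\<close> ranges over a
  translate, which depends on \<open>w\<close>, of the doubled Hurwitz quaternions.\<close>

lemma UV_surj:
  fixes w0 w1 w2 w3 r0 r1 r2 r3 :: int
  assumes "even (w0 + w1 + w2 + w3)" "even (r0 - r2 - w0 - w3)" "even (r1 - r2 - w2 - w3)"
    "even (r3 - r2 - w0 - w2)"
  shows "\<exists>y. U0 y = w0 \<and> U1 y = w1 \<and> U2 y = w2 \<and> U3 y = w3 \<and>
    V0 y = r0 \<and> V1 y = r1 \<and> V2 y = r2 \<and> V3 y = r3"
proof -
  have "even (r0 - r3 + w3 - w2)" "even (w0 - w2 + r3 - r2)" "even (r1 - r2 - w3 + w2)" "even (w1 - w3 - r3 + r2)"
    using assms by presburger+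
  then obtain k l m n where k: "r0 - r3 + w3 - w2 = 2 * k" "w0 - w2 + r3 - r2 = 2 * l"
    "r1 - r2 - w3 + w2 = 2 * m" "w1 - w3 - r3 + r2 = 2 * n" by (metis evenE)
  show ?thesis
    by (rule exI[of _ "Ico (ZT (l - k) k) (ZT (n - m) m) (ZT (w2 - r2) r2) (ZT (w3 - w2 - r3 + r2) (r3 - r2))"])
      (use k in \<open>simp add: UV_defs\<close>)
qed

text \<open>In these doubled coordinates, \<open>2 u\<close> can be matched within squared
  distance \<open>1\<close> first, and then \<open>2 v\<close> within squared distance
  \<open>2\<close>.\<close>

lemma icosian_covering:
  fixes s0 s1 s2 s3 t0 t1 t2 t3 :: real
  shows "\<exists>y. (s0 - of_int (U0 y))\<^sup>2 + (s1 - of_int (U1 y))\<^sup>2 + (s2 - of_int (U2 y))\<^sup>2 + (s3 - of_int (U3 y))\<^sup>2 +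
    ((t0 - of_int (V0 y))\<^sup>2 + (t1 - of_int (V1 y))\<^sup>2 + (t2 - of_int (V2 y))\<^sup>2 + (t3 - of_int (V3 y))\<^sup>2) \<le> 3"
proof -
  obtain w0 w1 w2 w3 :: int where w: "even (w0 + w1 + w2 + w3)"
    "(s0 - of_int w0)\<^sup>2 + (s1 - of_int w1)\<^sup>2 + (s2 - of_int w2)\<^sup>2 + (s3 - of_int w3)\<^sup>2 \<le> 1"
    using D4_covering by blast
  obtain a b c d :: int where h: "even (a - b)" "even (a - c)" "even (a - d)"
    "(t0 - of_int (w0 + w3) - of_int a)\<^sup>2 + (t1 - of_int (w2 + w3) - of_int b)\<^sup>2 + (t2 - of_int c)\<^sup>2 +
      (t3 - of_int (w0 + w2) - of_int d)\<^sup>2 \<le> 2"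
    using hurwitz_covering[of "t0 - of_int (w0 + w3)" "t1 - of_int (w2 + w3)" t2 "t3 - of_int (w0 + w2)"]
    by blast
  have "even (a + (w0 + w3) - c - w0 - w3)" "even (b + (w2 + w3) - c - w2 - w3)" "even (d + (w0 + w2) - c - w0 - w2)"
    using h(1-3) by presburger+
  from UV_surj[OF w(1) this] obtain y where y: "U0 y = w0" "U1 y = w1" "U2 y = w2" "U3 y = w3"
    "V0 y = a + (w0 + w3)" "V1 y = b + (w2 + w3)" "V2 y = c" "V3 y = d + (w0 + w2)" by blast
  show ?thesis
    using w(2) h(4) by (intro exI[of _ y]) (simp add: y algebra_simps)
qed

text \<open>The covering bound \<open>3\<close> is good enough, as \<open>5 \<sqdot> 3\<^sup>2 /
  64 = 45 / 64 < 1\<close>.\<close>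

lemma icosian_rounding:
  fixes N :: int
  assumes "N > 0"
  shows "\<exists>y. anorm (z - sc (of_int N) * y) < N ^ 4"
proof -
  have lin: "U0 (z - sc (of_int N) * y) = U0 z - N * U0 y" "U1 (z - sc (of_int N) * y) = U1 z - N * U1 y"
    "U2 (z - sc (of_int N) * y) = U2 z - N * U2 y" "U3 (z - sc (of_int N) * y) = U3 z - N * U3 y"
    "V0 (z - sc (of_int N) * y) = V0 z - N * V0 y" "V1 (z - sc (of_int N) * y) = V1 z - N * V1 y"
    "V2 (z - sc (of_int N) * y) = V2 z - N * V2 y" "V3 (z - sc (of_int N) * y) = V3 z - N * V3 y" for y
    by (simp_all add: UV_defs algebra_simps)
  let ?n = "real_of_int N"
  obtain y where y: "(of_int (U0 z) / ?n - of_int (U0 y))\<^sup>2 + (of_int (U1 z) / ?n - of_int (U1 y))\<^sup>2 +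
      (of_int (U2 z) / ?n - of_int (U2 y))\<^sup>2 + (of_int (U3 z) / ?n - of_int (U3 y))\<^sup>2 +
      ((of_int (V0 z) / ?n - of_int (V0 y))\<^sup>2 + (of_int (V1 z) / ?n - of_int (V1 y))\<^sup>2 +
      (of_int (V2 z) / ?n - of_int (V2 y))\<^sup>2 + (of_int (V3 z) / ?n - of_int (V3 y))\<^sup>2) \<le> 3"
    using icosian_covering by blast
  have sq: "?n\<^sup>2 * (of_int u / ?n - of_int v)\<^sup>2 = of_int ((u - N * v)\<^sup>2)" for u v
    using assms by (simp add: power2_eq_square field_simps)
  have "real_of_int (trace_form (z - sc (of_int N) * y)) \<le> ?n\<^sup>2 * 3"
    using mult_left_mono[OF y, of "?n\<^sup>2"] by (simp only: distrib_left sq trace_form_def lin) simp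
  then have "real_of_int (trace_form (z - sc (of_int N) * y)) \<le> real_of_int (N\<^sup>2 * 3)" by simp
  then have "trace_form (z - sc (of_int N) * y) \<le> N\<^sup>2 * 3" by (simp only: of_int_le_iff)
  moreover have "0 \<le> trace_form (z - sc (of_int N) * y)" by (simp add: trace_form_def)
  ultimately have "(trace_form (z - sc (of_int N) * y))\<^sup>2 \<le> (N\<^sup>2 * 3)\<^sup>2" by (intro power_mono)
  then have "64 * anorm (z - sc (of_int N) * y) \<le> 45 * N ^ 4"
    using anorm_le_trace_form[of "z - sc (of_int N) * y"] by (simp add: power_mult_distrib flip: power_mult)
  moreover have "0 < N ^ 4" using assms by simp
  ultimately have "anorm (z - sc (of_int N) * y) < N ^ 4" by linarith
  then show ?thesis ..
qed

text \<open>The quotient of \<open>a\<close> by \<open>p\<close> becomes an icosian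
  \<open>z\<close> divided by an integer \<open>N\<close> after multiplication by the conjugate of
  \<open>p\<close> and by the Galois conjugate of its norm.\<close>

lemma icosian_euclidean:
  assumes "p \<noteq> 0"
  shows "\<exists>y. anorm (a - p * y) < anorm p"
proof -
  define N where "N = anorm p"
  have N: "N > 0" using assms anorm_pos by (simp add: N_def)
  have n: "of_int N = cj (nr p) * nr p" by (simp add: N_def anorm_def nz_eq mult.commute)
  define z where "z = sc (cj (nr p)) * (bar p * a)"
  obtain y where y: "anorm (z - sc (of_int N) * y) < N ^ 4" using icosian_rounding[OF N] by blast
  have "z - sc (of_int N) * y = sc (cj (nr p)) * (bar p * (a - p * y))"
    by (simp add: z_def n right_diff_distrib mult.assoc bar_mult_self[symmetric])
  then have "anorm (z - sc (of_int N) * y) = N\<^sup>2 * (N * anorm (a - p * y))"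
    by (simp add: anorm_mult anorm_sc) (simp add: N_def anorm_def)
  with y have "(N * N * N) * anorm (a - p * y) < (N * N * N) * N"
    by (simp add: power2_eq_square power4_eq_xxxx mult_ac)
  then have "anorm (a - p * y) < N" using N by (metis mult_less_cancel_left_pos mult_pos_pos)
  then show ?thesis unfolding N_def ..
qed

definition RI :: "ico set \<Rightarrow> bool" where
  "RI J \<longleftrightarrow> add_subgroup J \<and> (\<forall>x\<in>J. \<forall>a. x * a \<in> J)"

lemma RI_rid: "RI (rid p)"
  by (auto simp: RI_def elim!: rid_multE simp: mult.assoc)

lemma RI_sum: "RI J \<Longrightarrow> RI K \<Longrightarrow> RI {x + y | x y. x \<in> J \<and> y \<in> K}"
proof -
  assume J: "RI J" and K: "RI K"
  have s: "add_subgroup J" "add_subgroup K" using J K by (auto simp: RI_def)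
  show ?thesis
    unfolding RI_def
  proof (intro conjI add_subgroupI ballI allI)
    show "0 \<in> {x + y | x y. x \<in> J \<and> y \<in> K}" using s add_subgroup_0 by force
  next
    fix v w assume "v \<in> {x + y | x y. x \<in> J \<and> y \<in> K}" "w \<in> {x + y | x y. x \<in> J \<and> y \<in> K}"
    then obtain x y x' y' where *: "v = x + y" "w = x' + y'" "x \<in> J" "y \<in> K" "x' \<in> J" "y' \<in> K" by blast
    then have "v - w = (x - x') + (y - y')" by simp
    moreover have "x - x' \<in> J" "y - y' \<in> K" using * s by (auto intro: add_subgroup_diff)
    ultimately show "v - w \<in> {x + y | x y. x \<in> J \<and> y \<in> K}" by blast
  next
    fix v a assume "v \<in> {x + y | x y. x \<in> J \<and> y \<in> K}"
    then obtain x y where *: "v = x + y" "x \<in> J" "y \<in> K" by blast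
    then have "v * a = x * a + y * a" "x * a \<in> J" "y * a \<in> K"
      using J K by (auto simp: RI_def distrib_right)
    then show "v * a \<in> {x + y | x y. x \<in> J \<and> y \<in> K}" by blast
  qed
qed

lemma RI_principal:
  assumes "RI J" "J \<noteq> {0}"
  shows "\<exists>p. p \<noteq> 0 \<and> J = rid p"
proof -
  have sub: "add_subgroup J" using assms by (simp add: RI_def)
  then obtain q where "q \<in> J \<and> q \<noteq> 0" using assms(2) add_subgroup_0 by blast
  then obtain p where p: "p \<in> J \<and> p \<noteq> 0" "\<And>q. q \<in> J \<and> q \<noteq> 0 \<Longrightarrow> nat (anorm p) \<le> nat (anorm q)"
    using ex_has_least_nat[of "\<lambda>p. p \<in> J \<and> p \<noteq> 0" q "\<lambda>p. nat (anorm p)"] by blast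
  have "J \<subseteq> rid p"
  proof
    fix a assume a: "a \<in> J"
    obtain y where y: "anorm (a - p * y) < anorm p" using icosian_euclidean p(1) by blast
    have "a - p * y \<in> J" using a p(1) assms(1) by (simp add: RI_def add_subgroup_diff)
    then have "a - p * y = 0" using p(2)[of "a - p * y"] y anorm_pos p(1) by fastforce
    then show "a \<in> rid p" by simp
  qed
  moreover have "rid p \<subseteq> J" using p(1) assms(1) by (auto simp: RI_def elim!: rid_multE)
  ultimately show ?thesis using p(1) by blast
qed

section \<open>Icosians of norm divisible by a given prime\<close>

text \<open>The squares \<open>x\<^sup>2\<close> and the numbers \<open>-1 - y\<^sup>2\<close>
  with \<open>0 \<le> x, y \<le> (l - 1) / 2\<close> each fill more than half of the residue
  classes, so they have a class in common.\<close>

lemma sum_two_squares_minus_one: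
  fixes l :: nat
  assumes "prime l" "odd l"
  shows "\<exists>x y :: int. int l dvd 1 + x\<^sup>2 + y\<^sup>2"
proof -
  define k where "k = (int l - 1) div 2"
  have k: "int l = 2 * k + 1" using assms(2) by (auto simp: k_def elim: oddE)
  have k0: "k \<ge> 0" using prime_gt_0_nat[OF assms(1)] by (simp add: k_def)
  have pr: "prime (int l)" using assms(1) by simp
  have inj: "x = y" if "x \<in> {0..k}" "y \<in> {0..k}" "int l dvd x\<^sup>2 - y\<^sup>2" for x y :: int
  proof -
    have "x\<^sup>2 - y\<^sup>2 = (x - y) * (x + y)" by (simp add: power2_eq_square algebra_simps)
    then have "int l dvd x - y \<or> int l dvd x + y" using that(3) pr by (simp add: prime_dvd_mult_iff)
    then show ?thesis
    proof
      assume "int l dvd x - y"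
      then have "x - y = 0" using zdvd_imp_le[of "int l" "x - y"] zdvd_imp_le[of "int l" "y - x"] that k
        by (smt (verit, ccfv_SIG) atLeastAtMost_iff dvd_diff_commute)
      then show ?thesis by simp
    next
      assume "int l dvd x + y"
      then have "x + y = 0" using zdvd_imp_le[of "int l" "x + y"] that k by (smt (verit) atLeastAtMost_iff)
      then show ?thesis using that by auto
    qed
  qed
  define A B where "A = (\<lambda>x. x\<^sup>2 mod int l) ` {0..k}" and "B = (\<lambda>y. (- 1 - y\<^sup>2) mod int l) ` {0..k}"
  have "inj_on (\<lambda>x. x\<^sup>2 mod int l) {0..k}"
    by (rule inj_onI) (metis inj mod_eq_dvd_iff)
  then have cA: "card A = nat (k + 1)" unfolding A_def by (simp add: card_image)
  have "inj_on (\<lambda>y. (- 1 - y\<^sup>2) mod int l) {0..k}"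
  proof (rule inj_onI)
    fix x y assume xy: "x \<in> {0..k}" "y \<in> {0..k}" "(- 1 - x\<^sup>2) mod int l = (- 1 - y\<^sup>2) mod int l"
    then have "int l dvd y\<^sup>2 - x\<^sup>2" by (simp add: mod_eq_dvd_iff)
    then show "x = y" using inj[OF xy(2,1)] by simp
  qed
  then have cB: "card B = nat (k + 1)" unfolding B_def by (simp add: card_image)
  have "A \<inter> B \<noteq> {}"
  proof
    assume "A \<inter> B = {}"
    then have "card (A \<union> B) = nat (k + 1) + nat (k + 1)"
      by (subst card_Un_disjoint) (auto simp: cA cB, auto simp: A_def B_def)
    moreover have "A \<union> B \<subseteq> {0..<int l}"
      using prime_gt_0_nat[OF assms(1)] by (auto simp: A_def B_def)
    then have "card (A \<union> B) \<le> card {0..<int l}" by (intro card_mono) auto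
    ultimately show False using k k0 by simp
  qed
  then obtain x y :: int where "x\<^sup>2 mod int l = (- 1 - y\<^sup>2) mod int l" by (auto simp: A_def B_def)
  then have "int l dvd x\<^sup>2 - (- 1 - y\<^sup>2)" by (simp add: mod_eq_dvd_iff)
  then have "int l dvd 1 + x\<^sup>2 + y\<^sup>2" by (simp add: algebra_simps)
  then show ?thesis by blast
qed

lemma zt_prime_below:
  assumes "prime_elem p"
  shows "\<exists>l. prime l \<and> p dvd (of_nat l :: zt)"
proof -
  have nu: "\<not> p dvd 1" using assms by (simp add: prime_elem_def)
  have "\<exists>l. prime l \<and> p dvd (of_nat l :: zt)" if "n > 0" "p dvd of_nat n" for n :: nat
    using that
  proof (induction n rule: less_induct)
    case (less n)
    have "n \<noteq> 1" using nu less.prems by auto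
    then obtain q where q: "prime q" "q dvd n" using prime_factor_nat by blast
    then obtain m where m: "n = q * m" by (auto elim: dvdE)
    then have "p dvd of_nat q \<or> p dvd of_nat m"
      using less.prems assms by (simp add: prime_elem_dvd_mult_iff)
    then show ?case
    proof
      assume "p dvd of_nat m"
      moreover have "m > 0" "m < n" using m less.prems prime_gt_1_nat[OF q(1)] by auto
      ultimately show ?thesis using less.IH by blast
    qed (use q in blast)
  qed
  moreover have "p dvd of_int (nz p)" by (simp add: nz_eq)
  then have "p dvd of_nat (nat \<bar>nz p\<bar>)" by (simp add: abs_if)
  moreover have "nat \<bar>nz p\<bar> > 0" using assms by (auto simp: prime_elem_def)
  ultimately show ?thesis by blast
qed

text \<open>If \<open>p\<close> divides the odd prime \<open>l\<close> and \<open>l\<close>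
  divides \<open>1 + x\<^sup>2 + y\<^sup>2\<close>, then \<open>1 + x i + y j\<close> will do; if
  \<open>p\<close> divides \<open>2\<close>, then \<open>1 + i\<close> will.\<close>

lemma null_icosian_exists:
  assumes "prime_elem p"
  shows "\<exists>x. \<not> sdvd p x \<and> p dvd nr x"
proof -
  have nu: "\<not> p dvd 1" using assms by (simp add: prime_elem_def)
  obtain l where l: "prime l" "p dvd of_nat l" using zt_prime_below[OF assms] by blast
  show ?thesis
  proof (cases "l = 2")
    case True
    then have "\<not> sdvd p (lipschitz 1 1 0 0) \<and> p dvd nr (lipschitz 1 1 0 0)"
      using l(2) nu unfolding nr_lipschitz by (auto simp: sdvd_iff lipschitz_def)
    then show ?thesis by blast
  next
    case False
    then have odd: "odd l" using l(1) primes_dvd_imp_eq two_is_prime_nat by blast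
    then obtain m where m: "l = 2 * m + 1" by (auto elim: oddE)
    have p2: "\<not> p dvd 2"
    proof
      assume "p dvd 2"
      then have "p dvd of_nat l - 2 * of_nat m" using l(2) by (intro dvd_diff) auto
      then show False using nu by (simp add: m)
    qed
    obtain x y :: int where xy: "int l dvd 1 + x\<^sup>2 + y\<^sup>2" using sum_two_squares_minus_one l(1) odd by blast
    then obtain k where "1 + x\<^sup>2 + y\<^sup>2 = int l * k" ..
    then have "(of_int (1 + x\<^sup>2 + y\<^sup>2) :: zt) = of_int (int l * k)" by (simp only:)
    then have "(of_int (1 + x\<^sup>2 + y\<^sup>2) :: zt) = of_nat l * of_int k" by simp
    then have d: "p dvd of_int (1 + x\<^sup>2 + y\<^sup>2)" using l(2) by simp
    let ?q = "lipschitz 1 (of_int x) (of_int y) 0"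
    have "nr ?q = of_int (1 + x\<^sup>2 + y\<^sup>2)" by (simp add: nr_lipschitz power2_eq_square)
    then have "p dvd nr ?q" using d by simp
    moreover have "\<not> sdvd p ?q"
    proof
      assume "sdvd p ?q"
      then have a: "p dvd 2 * of_int y" "p dvd 1 - of_int y - (0 - of_int y) * (1 - tz)"
        by (auto simp: sdvd_iff lipschitz_def)
      then have "p dvd of_int y" using p2 assms by (simp add: prime_elem_dvd_mult_iff)
      then have "p dvd (1 - of_int y - (0 - of_int y) * (1 - tz)) + tz * of_int y"
        using a(2) by (intro dvd_add) auto
      then show False using nu by (simp add: algebra_simps)
    qed
    ultimately show ?thesis by blast
  qed
qed

section \<open>Counting right ideals by their norm\<close>

lemma prime_dvd_prime_assoc:
  assumes "prime_elem p" "prime_elem q" "p dvd q"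
  shows "p \<sim> q"
proof -
  from assms(3) obtain k where k: "q = p * k" by (rule dvdE)
  have "\<not> p dvd 1" using assms(1) by (simp add: prime_elem_def)
  then have "k dvd 1" using irreducibleD[OF zt_prime_imp_irreducible[OF assms(2)] k] by blast
  then show ?thesis unfolding k by (intro assoc_sym[OF assoc_mult_unit])
qed

lemma rid_eqI:
  assumes "p \<in> rid q" "nr p \<sim> nr q" "q \<noteq> 0"
  shows "rid p = rid q"
proof -
  obtain y where y: "p = q * y" using assms(1) by (rule rid_multE)
  then have "nr q * nr y \<sim> nr q * 1" using assms(2) by simp
  then have "nr y \<sim> 1" using assms(3) assoc_mult_cancel[of "nr q" "nr y" 1] by simp
  then have "iunit y" by (simp add: iunit_def)
  then obtain v where "y * v = 1" using iunit_inverse by blast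
  then have "q = p * v" using y by (simp add: mult.assoc)
  then have "q \<in> rid p" by simp
  then show ?thesis using assms(1) by (simp add: rid_subset_iff subset_antisym)
qed

lemma rid_eq_imp_assoc:
  assumes "rid p = rid q"
  shows "nr p \<sim> nr q"
proof -
  have "p \<in> rid q" "q \<in> rid p" using assms rid_self by blast+
  then obtain y z where "p = q * y" "q = p * z" by (metis rid_multE)
  then have "nr p = nr q * nr y" "nr q = nr p * nr z" using nr_mult by metis+
  then show ?thesis unfolding assoc_def by (metis dvd_triv_left)
qed

lemma rid_eq_UNIV_iff: "rid p = UNIV \<longleftrightarrow> iunit p"
proof
  assume "rid p = UNIV"
  then show "iunit p" using rid_eq_imp_assoc[of p 1] by (simp add: iunit_def)
next
  assume "iunit p"
  then show "rid p = UNIV" using rid_eqI[of p 1] by (simp add: iunit_def)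
qed

lemma sc_mem_rid:
  assumes "nr a dvd n"
  shows "sc n \<in> rid a"
proof -
  obtain k where "n = nr a * k" using assms by (rule dvdE)
  then have "sc n = a * (bar a * sc k)" by (simp add: mult.assoc[symmetric] mult_bar)
  then show ?thesis by simp
qed

definition ideals_of_norm :: "zt \<Rightarrow> ico set set" where "ideals_of_norm n = {rid a | a. nr a \<sim> n}"

lemma ideals_of_norm_I: "nr a \<sim> n \<Longrightarrow> rid a \<in> ideals_of_norm n" by (auto simp: ideals_of_norm_def)

lemma ideals_of_norm_E:
  assumes "J \<in> ideals_of_norm n"
  obtains a where "J = rid a" "nr a \<sim> n"
  using assms by (auto simp: ideals_of_norm_def)

lemma ideals_of_norm_assoc: "n \<sim> m \<Longrightarrow> ideals_of_norm n = ideals_of_norm m"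
  unfolding ideals_of_norm_def by (metis (no_types) assoc_sym assoc_trans)

lemma ideals_of_norm_unit: "n dvd 1 \<Longrightarrow> ideals_of_norm n = {UNIV}"
proof -
  assume "n dvd 1"
  then have "ideals_of_norm n = ideals_of_norm 1" by (intro ideals_of_norm_assoc) simp
  also have "\<dots> = {UNIV}"
    using rid_eq_UNIV_iff ideals_of_norm_I[of 1 1] by (auto simp: ideals_of_norm_def iunit_def)
  finally show ?thesis .
qed

lemma finite_ideals_of_norm:
  assumes "n \<noteq> 0"
  shows "finite (ideals_of_norm n)"
proof (rule finite_subset)
  show "ideals_of_norm n \<subseteq> {H. add_subgroup H \<and> rid (sc n) \<subseteq> H \<and> H \<subseteq> UNIV}"
  proof
    fix J assume "J \<in> ideals_of_norm n"
    then obtain a where "J = rid a" "nr a \<sim> n" by (rule ideals_of_norm_E)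
    then show "J \<in> {H. add_subgroup H \<and> rid (sc n) \<subseteq> H \<and> H \<subseteq> UNIV}"
      by (simp add: rid_subset_iff assoc_def sc_mem_rid)
  qed
  show "finite {H. add_subgroup H \<and> rid (sc n) \<subseteq> H \<and> H \<subseteq> UNIV}"
    using assms by (intro finite_intermediate_subgroups) (simp_all add: group_index_rid_sc)
qed

subsection \<open>Right ideals of prime norm\<close>

lemma RI_nr_dvd:
  assumes "c dvd nr p" "x \<in> {y + z | y z. y \<in> rid p \<and> z \<in> rid (sc c)}"
  shows "c dvd nr x"
proof -
  obtain y z where x: "x = p * y + sc c * z" using assms(2) by (auto simp: rid_def)
  have "nr x = nr (p * y) - tr (p * y * bar (- (sc c * z))) + nr (- (sc c * z))"
    using nr_diff[of "p * y" "- (sc c * z)"] by (simp add: x)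
  moreover have "c dvd tr (p * y * bar (- (sc c * z)))"
    by (intro sdvd_tr sdvd_mult_left sdvdI[of _ _ "- bar z"]) (simp add: sc_commute[of "bar z"])
  ultimately show ?thesis using assms(1) by (simp add: mult.assoc)
qed

text \<open>The ideal in question is generated by \<open>p\<close> and \<open>c\<close>. It is
  proper, as all its elements have a norm divisible by \<open>c\<close>, and it is larger than the
  ideal generated by \<open>c\<close>. This leaves \<open>c\<close> as the only possible norm of
  its generator.\<close>

lemma ideals_of_norm_prime_containing:
  assumes c: "prime_elem c" and p: "\<not> sdvd c p" "c dvd nr p"
  shows "\<exists>!J. J \<in> ideals_of_norm c \<and> p \<in> J"
proof -
  define S where "S = {y + z | y z. y \<in> rid p \<and> z \<in> rid (sc c)}"
  have "RI S" unfolding S_def by (intro RI_sum RI_rid)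
  have pS: "p \<in> S"
    unfolding S_def using rid_self[of p] add_subgroup_0[OF add_subgroup_rid, of "sc c"] by force
  have cS: "sc c \<in> S"
    unfolding S_def using rid_self[of "sc c"] add_subgroup_0[OF add_subgroup_rid, of p] by force
  have c0: "c \<noteq> 0" "\<not> c dvd 1" using c by (auto simp: prime_elem_def)
  have "p \<noteq> 0" using p(1) by auto
  then obtain b where b: "b \<noteq> 0" "S = rid b"
    using RI_principal[OF \<open>RI S\<close>] pS by blast
  have bc: "c dvd nr b" using RI_nr_dvd[OF p(2)] b(2) rid_self[of b] unfolding S_def by blast
  obtain d where d: "sc c = b * d" using cS unfolding b(2) by (rule rid_multE)
  have "nr b * nr d \<sim> c * c" using arg_cong[OF d, of nr] by simp
  moreover have "\<not> nr b dvd 1" using bc c0(2) dvd_trans by blast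
  moreover have "\<not> nr d dvd 1"
  proof
    \<comment> \<open>If \<open>d\<close> were a unit, \<open>p\<close> would lie in the ideal of \<open>c\<close>.\<close>
    assume "nr d dvd 1"
    then obtain v where "d * v = 1" using iunit_inverse unfolding iunit_def by blast
    then have "b = sc c * v" using d by (simp add: mult.assoc)
    moreover obtain y where "p = b * y" using pS unfolding b(2) by (rule rid_multE)
    ultimately have "p = sc c * (v * y)" by (simp add: mult.assoc)
    then show False using p(1) sdvdI by blast
  qed
  ultimately have nb: "nr b \<sim> c" by (rule prime_square_proper_factor[OF c])
  show ?thesis
  proof (rule ex1I[of _ S])
    show "S \<in> ideals_of_norm c \<and> p \<in> S" using nb pS by (simp add: b(2) ideals_of_norm_I)
  next
    fix J assume J: "J \<in> ideals_of_norm c \<and> p \<in> J"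
    then obtain a where a: "J = rid a" "nr a \<sim> c" by (auto elim: ideals_of_norm_E)
    have "sc c \<in> J" unfolding a(1) using a(2) by (intro sc_mem_rid) (simp add: assoc_def)
    then have "S \<subseteq> J"
      using J rid_subset_iff[of p a] rid_subset_iff[of "sc c" a] add_subgroup_add[OF add_subgroup_rid[of a]]
      unfolding S_def a(1) by blast
    then have "b \<in> rid a" unfolding b(2) a(1) by (simp add: rid_subset_iff)
    moreover have "nr b \<sim> nr a" using nb a(2) assoc_sym assoc_trans by blast
    moreover have "a \<noteq> 0" using a(2) c0 by auto
    ultimately show "J = S" unfolding b(2) a(1) by (metis rid_eqI)
  qed
qed

lemma ideals_of_norm_prime_not_sdvd:
  assumes "prime_elem c" "nr a \<sim> c"
  shows "\<not> sdvd c a"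
proof
  assume "sdvd c a"
  then obtain y where y: "a = sc c * y" by (auto simp: sdvd_def)
  then have "c * (c * nr y) \<sim> c * 1" using assms(2) by (simp add: mult.assoc)
  moreover have "c \<noteq> 0" "\<not> c dvd 1" using assms(1) by (auto simp: prime_elem_def)
  ultimately have "c * nr y dvd 1" using assoc_mult_cancel[of c "c * nr y" 1] by simp
  then show False using \<open>\<not> c dvd 1\<close> dvd_mult_left by blast
qed

text \<open>The trace form is unimodular: the dual of the chosen basis consists of icosians, which are the
  right factors below. An icosian is recovered from its traces against the basis.\<close>

lemma trace_reconstruction:
  "p = sc (tr (p * Ico 1 0 0 0)) * Ico (- 1) 1 tz (1 - 2 * tz)
     + sc (tr (p * Ico 0 1 0 0)) * Ico 1 (- 2) (1 - tz) (2 * tz - 1)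
     + sc (tr (p * Ico 0 0 1 0)) * Ico tz (1 - tz) (- 2) 2
     + sc (tr (p * Ico 0 0 0 1)) * Ico (1 - 2 * tz) (2 * tz - 1) 2 (- 4)"
  by (simp add: ico_eq_iff tr_def times_ico_def algebra_simps tz_square tz_mult)

text \<open>The sum of \<open>e z e*\<close> over a basis and its dual basis with respect to the
  trace form is the same for all bases; for \<open>1, i, j, k\<close> it is visibly the trace of
  \<open>z\<close>.\<close>

lemma trace_casimir:
  "sc (tr z) = Ico 1 0 0 0 * z * Ico (- 1) 1 tz (1 - 2 * tz)
     + Ico 0 1 0 0 * z * Ico 1 (- 2) (1 - tz) (2 * tz - 1)
     + Ico 0 0 1 0 * z * Ico tz (1 - tz) (- 2) 2
     + Ico 0 0 0 1 * z * Ico (1 - 2 * tz) (2 * tz - 1) 2 (- 4)"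
  by (simp add: ico_eq_iff tr_def times_ico_def algebra_simps tz_square tz_mult)

lemma trace_nondegenerate:
  assumes "\<And>x. c dvd tr (p * x)"
  shows "sdvd c p"
  by (subst trace_reconstruction) (intro sdvd_add sdvd_mult_right, simp_all add: assms)

text \<open>The icosian ring modulo a prime is a simple ring. Explicitly, the two-sided ideal generated by an
  icosian contains all its traces \<open>tr (p y)\<close>, and these do not all vanish modulo \<open>c\<close> if \<open>p\<close> does not.\<close>

lemma icosian_prime:
  assumes "prime_elem c" "\<And>x. sdvd c (p * x * q)"
  shows "sdvd c p \<or> sdvd c q"
proof (rule ccontr)
  assume n: "\<not> (sdvd c p \<or> sdvd c q)"
  have "c dvd tr (p * y)" for y
  proof -
    have "sdvd c (Ico a b d e * (y * p) * Ico f g h k * q)" for a b d e f g h k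
      using sdvd_mult_left[OF assms(2)[of "Ico f g h k"], of "Ico a b d e * y"]
      by (simp only: mult.assoc)
    then have "sdvd c (sc (tr (y * p)) * q)"
      by (subst trace_casimir) (simp only: distrib_right sdvd_add)
    then show ?thesis using sdvd_prime_sc_mult[OF assms(1)] n tr_mult_commute by metis
  qed
  then show False using trace_nondegenerate n by blast
qed

text \<open>The trace maps a right ideal outside the multiples of \<open>c\<close> onto the
  residue field of \<open>c\<close>.\<close>

lemma group_index_trace_kernel:
  assumes c: "prime_elem c" and a: "\<not> sdvd c a"
  shows "\<exists>f. f \<in> rid a \<and> c dvd tr f - 1"
    and "group_index (rid a) {x \<in> rid a. c dvd tr x} = nat \<bar>nz c\<bar>"
proof -
  have "c \<noteq> 0" using c by auto
  obtain y where y: "\<not> c dvd tr (a * y)" using trace_nondegenerate a by blast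
  obtain u v where uv: "u * c + v * tr (a * y) = 1" using zt_prime_bezout[OF c y] by blast
  have tr: "tr (a * (sc (v * d) * y)) = d * (v * tr (a * y))" for d
    by (simp only: sc_left_commute[of a] tr_linear(5) mult.commute[of v d] mult.assoc)
  have surj: "\<exists>f. f \<in> rid a \<and> c dvd tr f - d" for d
  proof -
    have "tr (a * (sc (v * d) * y)) - d = d * (v * tr (a * y) - 1)"
      unfolding tr by (simp add: algebra_simps)
    also have "v * tr (a * y) - 1 = c * (- u)" using uv by (simp add: algebra_simps)
    finally have "tr (a * (sc (v * d) * y)) - d = c * (- u * d)" by (simp add: mult_ac)
    then have "c dvd tr (a * (sc (v * d) * y)) - d" by (rule dvdI)
    then show ?thesis using rid_mult_in by blast
  qed
  then show "\<exists>f. f \<in> rid a \<and> c dvd tr f - 1" by blast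
  obtain r where r: "\<And>x. x - r x \<in> zmod c" "\<And>x y. r x = r y \<longleftrightarrow> x - y \<in> zmod c"
    using coset_representatives[OF add_subgroup_zmod] by blast
  have "group_index (rid a) {x \<in> rid a. c dvd tr x} = card ((\<lambda>x. r (tr x)) ` rid a)"
    by (rule group_index_eq_card_image) (auto simp: r(2) mem_zmod add_subgroup_diff)
  also have "(\<lambda>x. r (tr x)) ` rid a = range r"
  proof (intro equalityI subsetI)
    fix v assume "v \<in> range r"
    then obtain d where "v = r d" by auto
    moreover obtain f where "f \<in> rid a" "c dvd tr f - d" using surj by blast
    ultimately have "v = r (tr f)" using r(2) mem_zmod by metis
    then show "v \<in> (\<lambda>x. r (tr x)) ` rid a" using \<open>f \<in> rid a\<close> by blast
  qed auto
  also have "card (range r) = nat \<bar>nz c\<bar>"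
    using group_index_eq_card_image[of UNIV "zmod c" r] group_index_zmod[OF \<open>c \<noteq> 0\<close>]
    by (simp add: r(2))
  finally show "group_index (rid a) {x \<in> rid a. c dvd tr x} = nat \<bar>nz c\<bar>" .
qed

text \<open>Fix one ideal \<open>a \<I>\<close> of norm \<open>c\<close>. Any other ideal
  \<open>J\<close> of norm \<open>c\<close> is a complement of it modulo \<open>c\<close>, so that
  \<open>1 = f + e\<close> with \<open>f\<close> in \<open>a \<I>\<close> and \<open>e\<close> in
  \<open>J\<close>, where \<open>f\<close> is unique modulo \<open>c\<close>. Comparing norms,
  \<open>f\<close> has trace \<open>1\<close> modulo \<open>c\<close>, and conversely every such
  \<open>f\<close> determines \<open>J\<close> as the ideal of norm \<open>c\<close> that contains
  \<open>1 - f\<close>. These \<open>f\<close> form a coset of the kernel of the trace, which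
  contains \<open>c \<I>\<close> with index the norm of \<open>c\<close>.\<close>

lemma card_ideals_of_norm_prime:
  assumes c: "prime_elem c"
  shows "card (ideals_of_norm c) = nat \<bar>nz c\<bar> + 1"
proof -
  define q where "q = nat \<bar>nz c\<bar>"
  have c0: "c \<noteq> 0" "\<not> c dvd 1" using c by (auto simp: prime_elem_def)
  have q0: "q > 0" using c0 by (simp add: q_def)
  obtain x where "\<not> sdvd c x" "c dvd nr x" using null_icosian_exists[OF c] by blast
  then obtain A where "A \<in> ideals_of_norm c" using ideals_of_norm_prime_containing[OF c] by blast
  then obtain a where a: "A = rid a" "nr a \<sim> c" by (rule ideals_of_norm_E)
  have aA: "rid a \<in> ideals_of_norm c" using a(2) by (rule ideals_of_norm_I)
  have na: "\<not> sdvd c a" using ideals_of_norm_prime_not_sdvd c a(2) by blast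
  have a0: "a \<noteq> 0" using a(2) c0 by auto
  have nr_a: "c dvd nr f" if "f \<in> rid a" for f
    using that a(2) by (auto elim!: rid_multE simp: assoc_def)
  define K where "K = {x \<in> rid a. c dvd tr x}"
  have subK: "add_subgroup K"
    unfolding K_def using add_subgroup_rid[of a] by (auto simp: add_subgroup_def)
  have cK: "rid (sc c) \<subseteq> K"
  proof
    fix x assume x: "x \<in> rid (sc c)"
    moreover have "rid (sc c) \<subseteq> rid a" using a(2) by (simp add: rid_subset_iff sc_mem_rid assoc_def)
    ultimately show "x \<in> K" by (auto simp: K_def mem_rid_sc sdvd_tr)
  qed
  have idxK: "group_index K (rid (sc c)) = q"
  proof -
    have "group_index UNIV (rid (sc c)) = group_index UNIV (rid a) * group_index (rid a) (rid (sc c))"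
      using cK by (intro group_index_tower) (auto simp: K_def)
    moreover have "group_index (rid a) (rid (sc c)) = group_index (rid a) K * group_index K (rid (sc c))"
      using cK subK by (intro group_index_tower) (auto simp: K_def)
    moreover have "group_index (rid a) K = q"
      unfolding K_def q_def by (rule group_index_trace_kernel[OF c na])
    moreover have "nat (anorm a) = q" using assoc_abs_nz[OF a(2)] anorm_pos[OF a0] by (simp add: q_def anorm_def)
    then have "group_index UNIV (rid a) = q\<^sup>2" using group_index_rid[OF a0] by simp
    moreover have "group_index UNIV (rid (sc c)) = q ^ 4" using group_index_rid_sc[OF c0(1)] by (simp add: q_def)
    ultimately have "q ^ 4 = q\<^sup>2 * (q * group_index K (rid (sc c)))" by metis
    then have "q ^ 3 * group_index K (rid (sc c)) = q ^ 3 * q"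
      by (auto simp add: power2_eq_square power3_eq_cube power4_eq_xxxx mult_ac)
    then show ?thesis using q0 by (metis mult_left_cancel power_not_zero not_gr_zero)
  qed
  obtain f where f: "f \<in> rid a" "c dvd tr f - 1" using group_index_trace_kernel(1)[OF c na] by blast
  have null: "\<not> sdvd c (1 - g)" "c dvd nr (1 - g)" if g: "g \<in> rid a" "c dvd tr g - 1" for g
  proof -
    have "nr (1 - g) = nr g - (tr g - 1)"
      using nr_diff[of 1 g] by (simp add: bar_def)
    then show "c dvd nr (1 - g)" using nr_a[OF g(1)] g(2) by simp
    show "\<not> sdvd c (1 - g)"
    proof
      \<comment> \<open>Modulo \<open>c\<close>, \<open>g\<close> would be \<open>1\<close>, but its norm vanishes.\<close>
      assume "sdvd c (1 - g)"
      then have "sdvd c (bar g * (1 - g))" by (rule sdvd_mult_left)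
      then have "c dvd tr (bar g * (1 - g))" by (rule sdvd_tr)
      moreover have "tr (bar g * (1 - g)) = tr g - 2 * nr g"
        by (simp add: right_diff_distrib bar_mult_self) (simp add: bar_def)
      moreover have "c dvd 2 * nr g" using nr_a[OF g(1)] by simp
      ultimately have "c dvd (tr g - 2 * nr g) + 2 * nr g - (tr g - 1)"
        using g(2) by (metis dvd_add dvd_diff)
      then show False using c0(2) by simp
    qed
  qed
  define \<Phi> where "\<Phi> g = (THE J. J \<in> ideals_of_norm c \<and> 1 - g \<in> J)" for g
  have \<Phi>: "\<Phi> g \<in> ideals_of_norm c" "1 - g \<in> \<Phi> g" "\<And>J. J \<in> ideals_of_norm c \<Longrightarrow> 1 - g \<in> J \<Longrightarrow> J = \<Phi> g"
    if g: "g \<in> rid a" "c dvd tr g - 1" for g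
  proof -
    have ex: "\<exists>!J. J \<in> ideals_of_norm c \<and> 1 - g \<in> J" using ideals_of_norm_prime_containing[OF c null[OF g]] .
    show "\<Phi> g \<in> ideals_of_norm c" "1 - g \<in> \<Phi> g" using theI'[OF ex] by (simp_all add: \<Phi>_def)
    then show "\<And>J. J \<in> ideals_of_norm c \<Longrightarrow> 1 - g \<in> J \<Longrightarrow> J = \<Phi> g" using ex by blast
  qed
  have RSsub: "add_subgroup J" "\<And>x. sdvd c x \<Longrightarrow> x \<in> J" if J: "J \<in> ideals_of_norm c" for J
  proof -
    obtain b where b: "J = rid b" "nr b \<sim> c" using J by (rule ideals_of_norm_E)
    show "add_subgroup J" by (simp add: b)
    have "rid (sc c) \<subseteq> J" using b by (simp add: rid_subset_iff sc_mem_rid assoc_def)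
    then show "\<And>x. sdvd c x \<Longrightarrow> x \<in> J" by (auto simp: mem_rid_sc[symmetric])
  qed
  have one_notin: "1 \<notin> J" if J: "J \<in> ideals_of_norm c" for J
  proof
    assume "1 \<in> J"
    obtain b where b: "J = rid b" "nr b \<sim> c" using J by (rule ideals_of_norm_E)
    then have "rid 1 \<subseteq> rid b" using \<open>1 \<in> J\<close> by (simp only: rid_subset_iff)
    then have "nr b dvd 1" using rid_eq_UNIV_iff[of b] by (auto simp: iunit_def)
    then show False using b(2) c0(2) by (metis assoc_def dvd_trans)
  qed
  have fK: "f + k \<in> rid a" "c dvd tr (f + k) - 1" if "k \<in> K" for k
  proof -
    show "f + k \<in> rid a" using that f(1) add_subgroup_add[OF add_subgroup_rid] by (simp add: K_def)
    have "c dvd (tr f - 1) + tr k" using that f(2) by (intro dvd_add) (simp_all add: K_def)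
    then show "c dvd tr (f + k) - 1" by (simp add: algebra_simps)
  qed
  have "group_index K (rid (sc c)) = card ((\<lambda>k. \<Phi> (f + k)) ` K)"
  proof (rule group_index_eq_card_image)
    fix k l assume k: "k \<in> K" and l: "l \<in> K"
    let ?J = "\<Phi> (f + k)"
    have J: "?J \<in> ideals_of_norm c" "1 - (f + k) \<in> ?J" using \<Phi> fK[OF k] by blast+
    have diff: "(1 - (f + l)) - (1 - (f + k)) = k - l" by simp
    show "k - l \<in> rid (sc c) \<longleftrightarrow> \<Phi> (f + k) = \<Phi> (f + l)"
    proof
      assume "k - l \<in> rid (sc c)"
      then have "(1 - (f + l)) - (1 - (f + k)) \<in> ?J" using RSsub(2)[OF J(1)] by (simp add: diff mem_rid_sc)
      from add_subgroup_add[OF RSsub(1)[OF J(1)] this J(2)] have "1 - (f + l) \<in> ?J"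
        by (simp only: diff_add_cancel)
      then show "\<Phi> (f + k) = \<Phi> (f + l)" using \<Phi>(3)[OF fK[OF l] J(1)] by simp
    next
      assume eq: "\<Phi> (f + k) = \<Phi> (f + l)"
      then have "1 - (f + l) \<in> ?J" using \<Phi>(2)[OF fK[OF l]] by simp
      then have kl: "k - l \<in> ?J" using add_subgroup_diff[OF RSsub(1)[OF J(1)] _ J(2)] diff by metis
      have kla: "k - l \<in> rid a" using k l add_subgroup_diff[OF add_subgroup_rid] by (simp add: K_def)
      show "k - l \<in> rid (sc c)"
      proof (rule ccontr)
        \<comment> \<open>Otherwise \<open>rid a\<close> and the ideal of \<open>1 - (f + k)\<close> agree, and then contain \<open>1\<close>.\<close>
        assume "k - l \<notin> rid (sc c)"
        then have "\<not> sdvd c (k - l)" by (simp add: mem_rid_sc)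
        then have "\<exists>!J. J \<in> ideals_of_norm c \<and> k - l \<in> J" using ideals_of_norm_prime_containing[OF c] nr_a[OF kla] by blast
        then have "?J = rid a" using J(1) aA kl kla by blast
        then have "(1 - (f + k)) + (f + k) \<in> ?J"
          using J fK(1)[OF k] add_subgroup_add[OF RSsub(1)[OF J(1)]] by metis
        then show False using one_notin[OF J(1)] by simp
      qed
    qed
  qed
  moreover have "(\<lambda>k. \<Phi> (f + k)) ` K = ideals_of_norm c - {rid a}"
  proof (intro equalityI subsetI)
    fix J assume "J \<in> (\<lambda>k. \<Phi> (f + k)) ` K"
    then obtain k where k: "k \<in> K" "J = \<Phi> (f + k)" by blast
    have "J \<in> ideals_of_norm c" "1 - (f + k) \<in> J" using \<Phi> fK[OF k(1)] k(2) by blast+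
    moreover from this have "J \<noteq> rid a"
      using one_notin[of J] add_subgroup_add[OF add_subgroup_rid _ fK(1)[OF k(1)], of "1 - (f + k)"] by auto
    ultimately show "J \<in> ideals_of_norm c - {rid a}" by blast
  next
    fix J assume J: "J \<in> ideals_of_norm c - {rid a}"
    then obtain b where b: "J = rid b" "nr b \<sim> c" by (auto elim: ideals_of_norm_E)
    define S where "S = {y + z | y z. y \<in> rid a \<and> z \<in> rid b}"
    have "RI S" unfolding S_def by (intro RI_sum RI_rid)
    moreover have aS: "rid a \<subseteq> S" and bS: "rid b \<subseteq> S"
      unfolding S_def using add_subgroup_0[OF add_subgroup_rid] by force+
    moreover have "a \<in> S" using aS by auto
    ultimately obtain d where d: "S = rid d" "d \<noteq> 0" using RI_principal a0 by blast
    have dab: "a \<in> rid d" "b \<in> rid d" using aS bS unfolding d by (simp_all add: rid_subset_iff)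
    obtain e where e: "a = d * e" using dab(1) by (rule rid_multE)
    have "nr d * nr e dvd c" using a(2) by (simp add: e assoc_def)
    then have "nr d dvd c" by (rule dvd_mult_left)
    then obtain k where k: "c = nr d * k" by (rule dvdE)
    have "\<not> k dvd 1"
    proof
      assume "k dvd 1"
      then have "nr d \<sim> c" unfolding k by (rule assoc_sym[OF assoc_mult_unit])
      then have "nr a \<sim> nr d" "nr b \<sim> nr d" using a(2) b(2) assoc_sym assoc_trans by blast+
      then have "rid a = rid d" "rid b = rid d" using dab d(2) rid_eqI by blast+
      then show False using J b by simp
    qed
    then have "nr d dvd 1" using irreducibleD[OF zt_prime_imp_irreducible[OF c] k] by blast
    then have "S = UNIV" unfolding d using rid_eq_UNIV_iff iunit_def by blast
    then have "1 \<in> S" by simp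
    then obtain g h where gh: "1 = g + h" "g \<in> rid a" "h \<in> rid b" unfolding S_def by blast
    have h: "1 - g = h" unfolding gh(1) by simp
    have "c dvd nr (1 - g)" using gh(3) b(2) by (auto simp: h assoc_def elim!: rid_multE)
    moreover have "nr (1 - g) = nr g - (tr g - 1)" using nr_diff[of 1 g] by (simp add: bar_def)
    ultimately have "c dvd nr g - (nr g - (tr g - 1))" using nr_a[OF gh(2)] by (metis dvd_diff)
    then have g: "c dvd tr g - 1" by simp
    have "g - f \<in> K"
      using gh(2) f add_subgroup_diff[OF add_subgroup_rid] dvd_diff[OF g f(2)] by (simp add: K_def)
    moreover have "J = \<Phi> (f + (g - f))" using \<Phi>(3)[OF gh(2) g, of J] J b(1) gh(3) h by simp
    ultimately show "J \<in> (\<lambda>k. \<Phi> (f + k)) ` K" by blast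
  qed
  ultimately have "card (ideals_of_norm c - {rid a}) = q" using idxK by simp
  then show ?thesis using aA finite_ideals_of_norm[OF c0(1)] by (simp only: q_def[symmetric]) (metis Suc_eq_plus1 card_Suc_Diff1)
qed

subsection \<open>The recursion for the number of right ideals\<close>

lemma card_ideals_of_norm_above:
  assumes "nr a \<sim> c" "c \<noteq> 0"
  shows "card {J \<in> ideals_of_norm (c * n). J \<subseteq> rid a} = card (ideals_of_norm n)"
proof -
  have a0: "a \<noteq> 0" using assms by auto
  have "{J \<in> ideals_of_norm (c * n). J \<subseteq> rid a} = (`) ((*) a) ` ideals_of_norm n"
  proof (intro equalityI subsetI)
    fix J assume "J \<in> {J \<in> ideals_of_norm (c * n). J \<subseteq> rid a}"
    then obtain b where b: "J = rid b" "nr b \<sim> c * n" "b \<in> rid a"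
      by (auto elim!: ideals_of_norm_E simp: rid_subset_iff)
    obtain d where d: "b = a * d" using b(3) by (rule rid_multE)
    have "c * nr d \<sim> nr a * nr d" using assms(1) by (intro assoc_mult) (auto intro: assoc_sym)
    also have "nr a * nr d \<sim> c * n" using b(2) by (simp add: d)
    finally have "nr d \<sim> n" using assms(2) by (simp add: assoc_mult_cancel)
    then show "J \<in> (`) ((*) a) ` ideals_of_norm n" unfolding b(1) d times_image_rid[symmetric] by (intro imageI ideals_of_norm_I)
  next
    fix J assume "J \<in> (`) ((*) a) ` ideals_of_norm n"
    then obtain d where d: "J = rid (a * d)" "nr d \<sim> n" by (auto elim!: ideals_of_norm_E simp: times_image_rid)
    then show "J \<in> {J \<in> ideals_of_norm (c * n). J \<subseteq> rid a}"
      using assms(1) by (auto simp: rid_subset_iff intro!: ideals_of_norm_I assoc_mult)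
  qed
  moreover have "inj_on ((`) ((*) a)) (ideals_of_norm n)"
    using inj_times[OF a0] by (meson inj_image_eq_iff inj_onI)
  ultimately show ?thesis by (simp add: card_image)
qed

lemma card_ideals_of_norm_inside_scalar:
  assumes "c \<noteq> 0"
  shows "card {J \<in> ideals_of_norm (c * (c * m)). J \<subseteq> rid (sc c)} = card (ideals_of_norm m)"
  using card_ideals_of_norm_above[of "sc c" "c * c" m] assms by (simp add: mult.assoc)

text \<open>Count in two ways the pairs of a right ideal \<open>J\<close> of norm \<open>c
  n\<close> and a right ideal \<open>K\<close> of norm \<open>c\<close> that contains it. Given
  \<open>K\<close>, the ideals \<open>J\<close> correspond to those of norm \<open>n\<close>.
  Given \<open>J\<close>, there is exactly one \<open>K\<close>, unless \<open>J\<close> is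
  contained in \<open>c \<I>\<close>, in which case every \<open>K\<close> is possible.\<close>

lemma hecke_ideals_of_norm_aux:
  assumes c: "prime_elem c" and n: "n \<noteq> 0"
  shows "card (ideals_of_norm c) * card (ideals_of_norm n) = card (ideals_of_norm (c * n)) +
    nat \<bar>nz c\<bar> * card {J \<in> ideals_of_norm (c * n). J \<subseteq> rid (sc c)}"
proof -
  have c0: "c \<noteq> 0" using c by auto
  define B where "B = {J \<in> ideals_of_norm (c * n). J \<subseteq> rid (sc c)}"
  have fin: "finite (ideals_of_norm c)" "finite (ideals_of_norm (c * n))" using c0 n by (simp_all add: finite_ideals_of_norm)
  have k: "card {K \<in> ideals_of_norm c. J \<subseteq> K} = (if J \<in> B then nat \<bar>nz c\<bar> + 1 else 1)" if J: "J \<in> ideals_of_norm (c * n)" for J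
  proof -
    obtain b where b: "J = rid b" "nr b \<sim> c * n" using J by (rule ideals_of_norm_E)
    show ?thesis
    proof (cases "J \<in> B")
      case True
      have "J \<subseteq> K" if K: "K \<in> ideals_of_norm c" for K
      proof -
        obtain a where "K = rid a" "nr a \<sim> c" using K by (rule ideals_of_norm_E)
        then have "rid (sc c) \<subseteq> K" by (simp add: rid_subset_iff sc_mem_rid assoc_def)
        then show ?thesis using True by (auto simp: B_def)
      qed
      then have "{K \<in> ideals_of_norm c. J \<subseteq> K} = ideals_of_norm c" by auto
      then show ?thesis using True card_ideals_of_norm_prime[OF c] by simp
    next
      case False
      then have "\<not> sdvd c b" using J by (auto simp: B_def b rid_subset_iff mem_rid_sc)
      moreover have "c dvd nr b" using b(2) by (auto simp: assoc_def intro: dvd_mult_left)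
      ultimately have "\<exists>!K. K \<in> ideals_of_norm c \<and> b \<in> K" by (rule ideals_of_norm_prime_containing[OF c])
      then obtain K where K: "K \<in> ideals_of_norm c" "b \<in> K" "\<And>K'. K' \<in> ideals_of_norm c \<Longrightarrow> b \<in> K' \<Longrightarrow> K' = K" by metis
      have "J \<subseteq> K' \<longleftrightarrow> b \<in> K'" if K': "K' \<in> ideals_of_norm c" for K'
      proof -
        obtain a where "K' = rid a" "nr a \<sim> c" using K' by (rule ideals_of_norm_E)
        then show ?thesis unfolding b(1) by (simp add: rid_subset_iff)
      qed
      then have "{K \<in> ideals_of_norm c. J \<subseteq> K} = {K}" using K by blast
      then show ?thesis using False by simp
    qed
  qed
  have "card (ideals_of_norm c) * card (ideals_of_norm n) = (\<Sum>K\<in>ideals_of_norm c. card {J \<in> ideals_of_norm (c * n). J \<subseteq> K})"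
  proof -
    have "card {J \<in> ideals_of_norm (c * n). J \<subseteq> K} = card (ideals_of_norm n)" if "K \<in> ideals_of_norm c" for K
      using that card_ideals_of_norm_above[OF _ c0] by (auto simp: ideals_of_norm_def)
    then show ?thesis by simp
  qed
  also have "\<dots> = (\<Sum>J\<in>ideals_of_norm (c * n). if J \<in> B then nat \<bar>nz c\<bar> + 1 else 1)"
    using fin k by (intro sum_multicount_gen) auto
  also have "\<dots> = (\<Sum>J\<in>ideals_of_norm (c * n). 1 + (if J \<in> B then nat \<bar>nz c\<bar> else 0))"
    by (rule sum.cong) auto
  also have "\<dots> = card (ideals_of_norm (c * n)) + (\<Sum>J\<in>{J \<in> ideals_of_norm (c * n). J \<in> B}. nat \<bar>nz c\<bar>)"
    using fin by (subst sum.distrib) (simp add: sum.If_cases Int_def)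
  also have "{J \<in> ideals_of_norm (c * n). J \<in> B} = B" by (auto simp: B_def)
  finally show ?thesis by (simp add: B_def mult.commute)
qed

lemma hecke_ideals_of_norm:
  assumes c: "prime_elem c" and n: "n \<noteq> 0"
  shows "\<not> c dvd n \<Longrightarrow> (nat \<bar>nz c\<bar> + 1) * card (ideals_of_norm n) = card (ideals_of_norm (c * n))"
    and "n = c * m \<Longrightarrow> (nat \<bar>nz c\<bar> + 1) * card (ideals_of_norm n) = card (ideals_of_norm (c * n)) + nat \<bar>nz c\<bar> * card (ideals_of_norm m)"
proof -
  have c0: "c \<noteq> 0" using c by auto
  assume "\<not> c dvd n"
  have "\<not> J \<subseteq> rid (sc c)" if J: "J \<in> ideals_of_norm (c * n)" for J
  proof
    assume "J \<subseteq> rid (sc c)"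
    obtain b where b: "J = rid b" "nr b \<sim> c * n" using J by (rule ideals_of_norm_E)
    obtain d where "b = sc c * d" using \<open>J \<subseteq> rid (sc c)\<close> b by (auto simp: rid_subset_iff elim: rid_multE)
    then have "c * (c * nr d) \<sim> c * n" using b(2) by (simp add: mult.assoc)
    then have "c * nr d \<sim> n" using c0 by (simp add: assoc_mult_cancel)
    then show False using \<open>\<not> c dvd n\<close> by (auto simp: assoc_def intro: dvd_mult_left)
  qed
  then have "{J \<in> ideals_of_norm (c * n). J \<subseteq> rid (sc c)} = {}" by blast
  then show "(nat \<bar>nz c\<bar> + 1) * card (ideals_of_norm n) = card (ideals_of_norm (c * n))"
    using hecke_ideals_of_norm_aux[OF c n] by (simp only: card_ideals_of_norm_prime[OF c]) simp
next
  assume "n = c * m"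
  then show "(nat \<bar>nz c\<bar> + 1) * card (ideals_of_norm n) = card (ideals_of_norm (c * n)) + nat \<bar>nz c\<bar> * card (ideals_of_norm m)"
    using hecke_ideals_of_norm_aux[OF c n] card_ideals_of_norm_inside_scalar[of c m] c by (simp only: card_ideals_of_norm_prime[OF c]) auto
qed

definition divs :: "zt \<Rightarrow> zt set" where "divs n = {d \<in> reps. d dvd n}"

definition sigma :: "zt \<Rightarrow> nat" where "sigma n = (\<Sum>d\<in>divs n. nat \<bar>nz d\<bar>)"

lemma finite_divs:
  assumes "n \<noteq> 0"
  shows "finite (divs n)"
proof -
  have "inj_on zmod (divs n)"
  proof (rule inj_onI)
    fix x y assume xy: "x \<in> divs n" "y \<in> divs n" "zmod x = zmod y"
    have "x \<in> zmod y" unfolding xy(3)[symmetric] by (simp add: mem_zmod)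
    moreover have "y \<in> zmod x" unfolding xy(3) by (simp add: mem_zmod)
    ultimately have "x \<sim> y" by (simp add: mem_zmod assoc_def)
    then show "x = y" using xy(1,2) by (auto simp: divs_def intro: reps_eqI)
  qed
  moreover have "zmod ` divs n \<subseteq> {H. add_subgroup H \<and> zmod n \<subseteq> H \<and> H \<subseteq> UNIV}"
    by (auto simp: divs_def mem_zmod add_subgroup_zmod intro: dvd_trans)
  moreover have "finite {H. add_subgroup H \<and> zmod n \<subseteq> H \<and> H \<subseteq> UNIV}"
    using assms by (intro finite_intermediate_subgroups add_subgroup_zmod) (simp add: group_index_zmod)
  ultimately show ?thesis by (metis finite_subset inj_on_finite)
qed

lemma rep_dvd_iff [simp]: "rep x dvd n \<longleftrightarrow> x dvd n"
  using rep_assoc[of x] unfolding assoc_def by (metis dvd_trans)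

lemma sigma_unit: "u dvd 1 \<Longrightarrow> sigma u = 1"
proof -
  assume u: "u dvd 1"
  have "divs u = {rep 1}"
  proof (intro equalityI subsetI)
    fix d assume "d \<in> divs u"
    then have "d \<in> reps" "d \<sim> 1" using u by (auto simp: divs_def intro: dvd_trans)
    then show "d \<in> {rep 1}" by (metis reps_iff rep_eq_iff singletonI)
  qed (auto simp: divs_def intro: rep_in_reps)
  moreover have "\<bar>nz (rep 1)\<bar> = 1" using assoc_abs_nz[OF rep_assoc[of 1]] by simp
  ultimately show ?thesis by (simp add: sigma_def)
qed

text \<open>A divisor of \<open>c n\<close> that does not divide \<open>n\<close> is \<open>c\<close> times a divisor of \<open>n\<close>.\<close>

lemma sigma_aux:
  assumes c: "prime_elem c" and n: "n \<noteq> 0"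
  shows "sigma (c * n) + nat \<bar>nz c\<bar> * (\<Sum>d\<in>{d \<in> divs n. c * d dvd n}. nat \<bar>nz d\<bar>) =
    (nat \<bar>nz c\<bar> + 1) * sigma n"
proof -
  have c0: "c \<noteq> 0" using c by auto
  define E where "E = {d \<in> divs n. \<not> c * d dvd n}"
  have fin: "finite (divs n)" using n by (rule finite_divs)
  have g: "inj_on (\<lambda>d. rep (c * d)) E"
    by (rule inj_onI) (use c0 in \<open>auto simp: rep_eq_iff assoc_mult_cancel E_def divs_def intro: reps_eqI\<close>)
  have "divs (c * n) = divs n \<union> (\<lambda>d. rep (c * d)) ` E"
  proof (intro equalityI subsetI)
    fix d assume d: "d \<in> divs (c * n)"
    show "d \<in> divs n \<union> (\<lambda>d. rep (c * d)) ` E"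
    proof (cases "d dvd n")
      case False
      have "c dvd d"
      proof (rule ccontr)
        assume "\<not> c dvd d"
        then obtain u v where "u * c + v * d = 1" using zt_prime_bezout[OF c] by blast
        then have "n = (u * c + v * d) * n" by simp
        also have "\<dots> = u * (c * n) + d * (v * n)" by (simp add: algebra_simps)
        also have "d dvd \<dots>" using d by (auto simp: divs_def intro: dvd_mult)
        finally show False using False by simp
      qed
      then obtain k where k: "d = c * k" by (rule dvdE)
      then have kn: "k dvd n" "k \<noteq> 0" using d c0 by (auto simp: divs_def reps_iff)
      have "c * rep k \<sim> d" unfolding k by (intro assoc_mult) auto
      moreover from this have "\<not> c * rep k dvd n" using False by (auto simp: assoc_def intro: dvd_trans)
      moreover have "d = rep d" using d by (auto simp: divs_def reps_iff)
      ultimately have "d = rep (c * rep k)" "rep k \<in> E"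
        using kn by (auto simp: E_def divs_def rep_in_reps rep_eq_iff) (metis assoc_sym rep_eq_iff)
      then show ?thesis by blast
    qed (use d in \<open>auto simp: divs_def\<close>)
  next
    fix d assume "d \<in> divs n \<union> (\<lambda>d. rep (c * d)) ` E"
    moreover have "rep (c * k) \<in> reps" if "k \<in> reps" for k
      using that c0 by (intro rep_in_reps) (simp add: reps_iff)
    ultimately show "d \<in> divs (c * n)"
      by (auto simp: divs_def E_def intro: mult_dvd_mono)
  qed
  moreover have "divs n \<inter> (\<lambda>d. rep (c * d)) ` E = {}" by (auto simp: divs_def E_def)
  moreover have finE: "finite E" using fin by (simp add: E_def)
  ultimately have "sigma (c * n) = sigma n + (\<Sum>d\<in>(\<lambda>d. rep (c * d)) ` E. nat \<bar>nz d\<bar>)"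
    using fin by (simp add: sigma_def sum.union_disjoint)
  also have "(\<Sum>d\<in>(\<lambda>d. rep (c * d)) ` E. nat \<bar>nz d\<bar>) = (\<Sum>d\<in>E. nat \<bar>nz c\<bar> * nat \<bar>nz d\<bar>)"
  proof (subst sum.reindex[OF g], rule sum.cong)
    fix d
    have "\<bar>nz (rep (c * d))\<bar> = \<bar>nz c\<bar> * \<bar>nz d\<bar>"
      using assoc_abs_nz[OF rep_assoc] by (simp add: nz_mult abs_mult)
    then show "((\<lambda>d. nat \<bar>nz d\<bar>) \<circ> (\<lambda>d. rep (c * d))) d = nat \<bar>nz c\<bar> * nat \<bar>nz d\<bar>"
      by (simp add: nat_mult_distrib)
  qed simp
  finally have 1: "sigma (c * n) = sigma n + nat \<bar>nz c\<bar> * (\<Sum>d\<in>E. nat \<bar>nz d\<bar>)"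
    by (simp add: sum_distrib_left)
  have "sigma n = (\<Sum>d\<in>{d \<in> divs n. c * d dvd n} \<union> E. nat \<bar>nz d\<bar>)"
    unfolding sigma_def by (rule sum.cong) (auto simp: E_def)
  also have "\<dots> = (\<Sum>d\<in>{d \<in> divs n. c * d dvd n}. nat \<bar>nz d\<bar>) + (\<Sum>d\<in>E. nat \<bar>nz d\<bar>)"
    using fin finE by (intro sum.union_disjoint) (auto simp: E_def)
  finally have 2: "sigma n = (\<Sum>d\<in>{d \<in> divs n. c * d dvd n}. nat \<bar>nz d\<bar>) + (\<Sum>d\<in>E. nat \<bar>nz d\<bar>)" .
  show ?thesis unfolding 1 by (subst (2) 2) (simp add: algebra_simps 2)
qed

lemma hecke_sigma:
  assumes c: "prime_elem c" and n: "n \<noteq> 0"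
  shows "\<not> c dvd n \<Longrightarrow> (nat \<bar>nz c\<bar> + 1) * sigma n = sigma (c * n)"
    and "n = c * m \<Longrightarrow> (nat \<bar>nz c\<bar> + 1) * sigma n = sigma (c * n) + nat \<bar>nz c\<bar> * sigma m"
proof -
  assume "\<not> c dvd n"
  then have "{d \<in> divs n. c * d dvd n} = {}" by (auto dest: dvd_mult_left)
  then show "(nat \<bar>nz c\<bar> + 1) * sigma n = sigma (c * n)"
    using sigma_aux[OF c n] by (simp only: sum.empty)
next
  assume nm: "n = c * m"
  then have "{d \<in> divs n. c * d dvd n} = divs m" using n by (auto simp: divs_def)
  then show "(nat \<bar>nz c\<bar> + 1) * sigma n = sigma (c * n) + nat \<bar>nz c\<bar> * sigma m"
    using sigma_aux[OF c n] by (simp add: sigma_def)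
qed

theorem card_ideals_of_norm_eq_sigma: "n \<noteq> 0 \<Longrightarrow> card (ideals_of_norm n) = sigma n"
proof (induction n rule: zt_prime_induct)
  case (unit u)
  then show ?case by (simp add: ideals_of_norm_unit sigma_unit)
next
  case (prime p n)
  have n: "card (ideals_of_norm n) = sigma n" using prime.IH[of n] prime.hyps by simp
  show ?case
  proof (cases "p dvd n")
    case False
    then show ?thesis using hecke_ideals_of_norm(1)[OF prime.hyps(1,2) False] hecke_sigma(1)[OF prime.hyps(1,2) False] n by simp
  next
    case True
    then obtain m where m: "n = p * m" by (rule dvdE)
    then have "card (ideals_of_norm m) = sigma m" using prime.IH[of m] prime.hyps(2) by auto
    then show ?thesis
      using hecke_ideals_of_norm(2)[OF prime.hyps(1,2) m] hecke_sigma(2)[OF prime.hyps(1,2) m] n by simp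
  qed
qed

section \<open>Primitive icosians\<close>

definition prim :: "ico \<Rightarrow> bool" where "prim p \<longleftrightarrow> (\<forall>c. sdvd c p \<longrightarrow> c dvd 1)"

lemma primD: "prim p \<Longrightarrow> sdvd c p \<Longrightarrow> c dvd 1" by (simp add: prim_def)

lemma prim_nonzero: "prim p \<Longrightarrow> p \<noteq> 0"
  using primD[of p 0] by auto

lemma prim_iff_prime: "p \<noteq> 0 \<Longrightarrow> prim p \<longleftrightarrow> (\<forall>c. prime_elem c \<longrightarrow> \<not> sdvd c p)"
proof
  assume "prim p"
  then show "\<forall>c. prime_elem c \<longrightarrow> \<not> sdvd c p"
    by (auto simp: prime_elem_def dest: primD)
next
  assume p: "p \<noteq> 0" "\<forall>c. prime_elem c \<longrightarrow> \<not> sdvd c p"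
  show "prim p" unfolding prim_def
  proof (intro allI impI)
    fix c assume c: "sdvd c p"
    then have "c \<noteq> 0" using p(1) by (auto simp: sdvd_def)
    show "c dvd 1"
    proof (rule ccontr)
      assume "\<not> c dvd 1"
      then obtain d where "prime_elem d" "d dvd c" using zt_prime_divisor \<open>c \<noteq> 0\<close> by blast
      then show False using p(2) c sdvd_dvd_trans by blast
    qed
  qed
qed

lemma prim_1 [simp]: "prim 1" by (simp add: prim_def sdvd_iff)

lemma prim_mult_unit:
  assumes "prim p" "iunit u"
  shows "prim (p * u)"
proof -
  obtain v where v: "u * v = 1" using iunit_inverse[OF assms(2)] by blast
  have "sdvd c p" if "sdvd c (p * u)" for c
    using sdvd_mult_right[OF that, of v] by (simp add: mult.assoc v)
  then show ?thesis using assms(1) by (auto simp: prim_def)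
qed

lemma prim_bar: "prim p \<Longrightarrow> prim (bar p)"
proof -
  assume p: "prim p"
  have "sdvd c p" if c: "sdvd c (bar p)" for c
  proof -
    obtain y where "bar p = sc c * y" using c by (auto simp: sdvd_def)
    then have "bar (bar p) = bar (sc c * y)" by simp
    then have "p = sc c * bar y" by (simp add: sc_commute)
    then show ?thesis by (rule sdvdI)
  qed
  then show ?thesis using p by (auto simp: prim_def)
qed

lemma prim_decomposition:
  assumes "p \<noteq> 0"
  shows "\<exists>c q. c \<noteq> 0 \<and> prim q \<and> p = sc c * q"
  using assms
proof (induction "nat (anorm p)" arbitrary: p rule: less_induct)
  case less
  show ?case
  proof (cases "prim p")
    case True
    then have "1 \<noteq> (0::zt) \<and> prim p \<and> p = sc 1 * p" by simp
    then show ?thesis by blast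
  next
    case False
    then obtain d y where d: "\<not> d dvd 1" "p = sc d * y" by (auto simp: prim_def sdvd_def)
    then have y0: "y \<noteq> 0" "d \<noteq> 0" using less.prems by auto
    have "\<bar>nz d\<bar> \<noteq> 1" "nz d \<noteq> 0" using d(1) y0(2) by (auto simp: zt_unit_iff)
    then have "1 < \<bar>nz d\<bar>" by linarith
    then have "1 * 1 < \<bar>nz d\<bar> * \<bar>nz d\<bar>" by (intro mult_strict_mono) auto
    then have "1 < (nz d)\<^sup>2" by (simp add: power2_eq_square)
    then have "1 * anorm y < (nz d)\<^sup>2 * anorm y" using anorm_pos[OF y0(1)] by (intro mult_strict_right_mono)
    then have "anorm y < anorm p" by (simp add: d(2) anorm_mult anorm_sc)
    then have "nat (anorm y) < nat (anorm p)" using anorm_pos[OF y0(1)] by simp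
    then obtain c q where cq: "c \<noteq> 0" "prim q" "y = sc c * q" using less.hyps y0(1) by blast
    then have "d * c \<noteq> 0 \<and> prim q \<and> p = sc (d * c) * q" using y0 d(2) by (simp add: mult.assoc)
    then show ?thesis by blast
  qed
qed

text \<open>After division by a common divisor of \<open>c\<close> and \<open>d\<close>, a
  combination \<open>u c + v d = 1\<close> shows that \<open>p\<close> is a multiple of
  \<open>d\<close>.\<close>

lemma prim_decomposition_unique:
  assumes p: "prim p" and q: "prim q" and c: "c \<noteq> 0" and eq: "sc c * p = sc d * q"
  shows "c \<sim> d" "rid p = rid q"
proof -
  have half: "d dvd c" if "prim p" "prim q" "c \<noteq> 0" "sc c * p = sc d * q" for p q c d
  proof -
    obtain g u v where g: "g = u * c + v * d" "g dvd c" "g dvd d" using zt_bezout by blast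
    obtain c1 where c1: "c = g * c1" using g(2) by (rule dvdE)
    obtain d1 where d1: "d = g * d1" using g(3) by (rule dvdE)
    have g0: "g \<noteq> 0" using c1 that(3) by auto
    have "sc g * (sc c1 * p) = sc g * (sc d1 * q)" using that(4) by (simp add: c1 d1 mult.assoc)
    then have eq1: "sc c1 * p = sc d1 * q" using g0 by simp
    have "g * 1 = g * (u * c1 + v * d1)" using g(1) by (simp add: c1 d1 algebra_simps)
    then have 1: "u * c1 + v * d1 = 1" using mult_left_cancel[OF g0] by metis
    have "p = sc (u * c1 + v * d1) * p" by (simp only: 1) simp
    also have "\<dots> = sc u * (sc c1 * p) + sc (v * d1) * p" by (simp add: distrib_right mult.assoc)
    also have "\<dots> = sc (u * d1) * q + sc (v * d1) * p" by (simp add: eq1 mult.assoc)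
    also have "\<dots> = sc d1 * (sc u * q + sc v * p)" by (simp add: ico_eq_iff algebra_simps)
    finally have "d1 dvd 1" using primD[OF that(1)] sdvdI by blast
    then have "g * d1 dvd g" by (metis assoc_def assoc_mult_unit)
    then show "d dvd c" using g(2) unfolding d1 by (rule dvd_trans)
  qed
  have "prim q" "d \<noteq> 0" using q eq c prim_nonzero[OF p] by auto
  then show cd: "c \<sim> d" using half[OF p q c eq] half[OF q p _ eq[symmetric]] by (simp add: assoc_def)
  then obtain u where u: "u dvd 1" "d = c * u" by (rule assocE)
  have "sc c * p = sc c * (sc u * q)" using eq by (simp add: u mult.assoc)
  then have "p = q * sc u" using c by (simp add: sc_commute)
  moreover have "nr (q * sc u) \<sim> nr q"
    using u(1) assoc_mult_unit[of "u * u" "nr q"] by (simp add: zt_unit_iff nz_mult abs_mult)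
  ultimately show "rid p = rid q" using rid_eqI[of p q] prim_nonzero[OF q] by simp
qed

lemma rid_eq_imp_unit:
  assumes "rid p = rid q" "p \<noteq> 0"
  shows "\<exists>u. iunit u \<and> q = p * u"
proof -
  have "q \<in> rid p" using assms(1) rid_self by blast
  then obtain u where u: "q = p * u" by (rule rid_multE)
  have "nr p * 1 \<sim> nr p * nr u" using rid_eq_imp_assoc[OF assms(1)] by (simp add: u)
  then have "1 \<sim> nr u" using assms(2) by (simp only: assoc_mult_cancel nr_eq_0_iff not_False_eq_True)
  then have "iunit u" unfolding iunit_def by (simp add: assoc_def)
  then show ?thesis using u by blast
qed

lemma prim_rid_cong: "rid p = rid q \<Longrightarrow> prim p \<Longrightarrow> prim q"
  using rid_eq_imp_unit prim_nonzero prim_mult_unit by blast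

definition primitive_RI :: "ico set set" where "primitive_RI = {rid p | p. prim p}"

text \<open>Given a primitive \<open>p\<close>, at most one right ideal of prime norm \<open>c\<close> has a generator \<open>a\<close> for which \<open>p a\<close>
  is not primitive: the one that contains \<open>bar p\<close>. There are at least two ideals to choose from.\<close>

lemma prim_exists:
  assumes "n \<noteq> 0"
  shows "\<exists>p. prim p \<and> nr p \<sim> n"
  using assms
proof (induction n rule: zt_prime_induct)
  case (unit u)
  then have "prim 1 \<and> nr 1 \<sim> u" by (simp add: assoc_sym)
  then show ?case by blast
next
  case (prime c n)
  obtain p where p: "prim p" "nr p \<sim> n" using prime.IH[OF prime.hyps(2) dvd_refl] by metis
  have c0: "c \<noteq> 0" "\<not> c dvd 1" using prime.hyps(1) by (auto simp: prime_elem_def)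
  have p0: "p \<noteq> 0" using prim_nonzero[OF p(1)] .
  have nb: "\<not> sdvd c (bar p)" using primD[OF prim_bar[OF p(1)]] c0 by blast
  have "\<exists>K. K \<in> ideals_of_norm c \<and> (c dvd nr p \<longrightarrow> bar p \<notin> K)"
  proof (cases "c dvd nr p")
    case True
    then have "\<exists>!J. J \<in> ideals_of_norm c \<and> bar p \<in> J" using ideals_of_norm_prime_containing[OF prime.hyps(1) nb] by simp
    then obtain J where J: "J \<in> ideals_of_norm c" "\<And>K. K \<in> ideals_of_norm c \<Longrightarrow> bar p \<in> K \<Longrightarrow> K = J" by blast
    have "card (ideals_of_norm c) \<noteq> 1" using card_ideals_of_norm_prime[OF prime.hyps(1)] c0 by simp
    then have "ideals_of_norm c \<noteq> {J}" by auto
    then show ?thesis using J by blast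
  next
    case False
    have "card (ideals_of_norm c) \<noteq> 0" using card_ideals_of_norm_prime[OF prime.hyps(1)] by simp
    then have "ideals_of_norm c \<noteq> {}" by auto
    then show ?thesis using False by blast
  qed
  then obtain a where a: "nr a \<sim> c" "c dvd nr p \<Longrightarrow> bar p \<notin> rid a" by (auto elim: ideals_of_norm_E)
  obtain u where u: "u dvd 1" "c = nr a * u" using a(1) by (rule assocE)
  have a0: "a \<noteq> 0" using a(1) c0 by auto
  have "prim (p * a)"
  proof (subst prim_iff_prime, use p0 a0 in simp, intro allI impI notI)
    fix d assume d: "prime_elem d" "sdvd d (p * a)"
    have "sdvd d (p * a * bar a)" using d(2) by (rule sdvd_mult_right)
    then have "sdvd d (sc (nr a) * p)" by (simp add: mult.assoc mult_bar sc_commute)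
    moreover have "\<not> sdvd d p" using primD[OF p(1)] d(1) by (auto simp: prime_elem_def)
    ultimately have "d dvd nr a" using sdvd_prime_sc_mult[OF d(1)] by blast
    then have "d dvd c" using a(1) by (auto simp: assoc_def intro: dvd_trans)
    then have "c dvd d" using prime_dvd_prime_assoc[OF d(1) prime.hyps(1)] by (simp add: assoc_def)
    then have "sdvd c (p * a)" using d(2) by (rule sdvd_dvd_trans)
    then obtain b where b: "p * a = sc c * b" by (auto simp: sdvd_def)
    have "sc (nr a) * p = p * a * bar a" by (simp only: mult.assoc mult_bar sc_commute[of p])
    also have "\<dots> = sc (nr a) * (sc u * (b * bar a))" unfolding b by (simp only: u(2) sc_simps mult.assoc)
    finally have "sc (nr a) * p = sc (nr a) * (sc u * (b * bar a))" .
    then have "p = sc u * (b * bar a)" using a0 by (metis nr_eq_0_iff sc_mult_cancel)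
    then have "bar p = a * (bar b * sc u)" by (simp add: mult.assoc)
    then have "bar p \<in> rid a" "nr (bar p) = nr a * nr (bar b * sc u)" by (simp_all only: rid_mult_in nr_mult)
    moreover from this(2) have "c dvd nr (bar p)" using a(1) by (simp only: assoc_def dvd_mult2)
    ultimately show False using a(2) by simp
  qed
  moreover have "nr (p * a) \<sim> c * n" using assoc_mult[OF p(2) a(1)] by (simp add: mult.commute)
  ultimately show ?case by blast
qed

lemma scaled_rid: "(*) (sc c) ` rid p = rid (sc c * p)"
  by (rule times_image_rid)

text \<open>Splitting off the content of a generator, which a unit on the right does not change.\<close>

lemma bij_betw_content:
  "bij_betw (\<lambda>(c, J). (*) (sc c) ` J) (reps \<times> primitive_RI) {J. RI J \<and> J \<noteq> {0}}"
  unfolding bij_betw_def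
proof
  show "inj_on (\<lambda>(c, J). (*) (sc c) ` J) (reps \<times> primitive_RI)"
  proof (rule inj_onI, clarify)
    fix c J d K assume c: "c \<in> reps" "d \<in> reps" and JK: "J \<in> primitive_RI" "K \<in> primitive_RI" "(*) (sc c) ` J = (*) (sc d) ` K"
    obtain p q where p: "J = rid p" "prim p" and q: "K = rid q" "prim q" using JK by (auto simp: primitive_RI_def)
    have c0: "c \<noteq> 0" "d \<noteq> 0" using c by (auto simp: reps_iff)
    have "rid (sc c * p) = rid (sc d * q)" using JK(3) by (simp add: p q scaled_rid)
    then obtain u where u: "iunit u" "sc d * q = sc c * p * u"
      using rid_eq_imp_unit c0 prim_nonzero[OF p(2)] by (metis sc_mult_eq_0_iff)
    then have "sc c * (p * u) = sc d * q" by (simp add: mult.assoc)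
    from prim_decomposition_unique[OF prim_mult_unit[OF p(2) u(1)] q(2) c0(1) this]
    have "c \<sim> d" "rid (p * u) = rid q" by auto
    moreover have "rid (p * u) = rid p"
      using u(1) prim_nonzero[OF p(2)] by (intro rid_eqI) (auto simp: iunit_def assoc_mult_unit)
    ultimately show "c = d \<and> J = K" using c reps_eqI p q by auto
  qed
  show "(\<lambda>(c, J). (*) (sc c) ` J) ` (reps \<times> primitive_RI) = {J. RI J \<and> J \<noteq> {0}}"
  proof (intro equalityI subsetI)
    fix I assume "I \<in> (\<lambda>(c, J). (*) (sc c) ` J) ` (reps \<times> primitive_RI)"
    then obtain c p where "c \<in> reps" "prim p" "I = rid (sc c * p)"
      by (auto simp: primitive_RI_def scaled_rid)
    moreover from this have "sc c * p \<noteq> 0" using prim_nonzero by (auto simp: reps_iff)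
    moreover have "sc c * p \<in> rid (sc c * p)" by (rule rid_self)
    ultimately show "I \<in> {J. RI J \<and> J \<noteq> {0}}" using RI_rid by blast
  next
    fix I assume "I \<in> {J. RI J \<and> J \<noteq> {0}}"
    then obtain p where p: "p \<noteq> 0" "I = rid p" using RI_principal by blast
    obtain c q where c: "c \<noteq> 0" "prim q" "p = sc c * q" using prim_decomposition[OF p(1)] by blast
    obtain u where u: "u dvd 1" "rep c = c * u" using assoc_sym[OF rep_assoc[of c]] by (rule assocE)
    have "sc (rep c) * q = p * sc u" unfolding c(3) u(2) sc_commute[of "sc c * q"] by (simp add: ico_eq_iff mult_ac)
    moreover have "nr (p * sc u) \<sim> nr p"
      using u(1) assoc_mult_unit[of "u * u" "nr p"] by (simp add: zt_unit_iff nz_mult abs_mult)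
    ultimately have "rid (sc (rep c) * q) = rid p"
      using rid_eqI[of "p * sc u" p] p(1) by simp
    then have "I = (\<lambda>(c, J). (*) (sc c) ` J) (rep c, rid q)" using p by (simp add: scaled_rid)
    moreover have "(rep c, rid q) \<in> reps \<times> primitive_RI" using c by (auto simp: rep_in_reps primitive_RI_def)
    ultimately show "I \<in> (\<lambda>(c, J). (*) (sc c) ` J) ` (reps \<times> primitive_RI)" by (rule image_eqI)
  qed
qed

section \<open>The lattice fixed by the twist\<close>

definition Fix :: "ico set" where "Fix = {x. tw x = x}"

lemma Fix_iff: "x \<in> Fix \<longleftrightarrow> tw x = x" by (simp add: Fix_def)

lemma add_subgroup_Fix: "add_subgroup Fix" by (simp add: add_subgroup_def Fix_def)

lemma one_Fix [simp]: "1 \<in> Fix" by (simp add: Fix_def)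

lemma Fix_coordinates:
  "x \<in> Fix \<longleftrightarrow> (\<exists>a b e d. x = Ico (of_int a) (of_int b) (ZT e d) (ZT d (- 2 * d)))"
proof
  assume "x \<in> Fix"
  then have "x = Ico (of_int (rat_part (cA x))) (of_int (rat_part (cB x))) (ZT (rat_part (cC x)) (rat_part (cD x)))
      (ZT (rat_part (cD x)) (- 2 * rat_part (cD x)))"
    by (simp add: Fix_def ico_eq_iff zt_eq_iff)
  then show "\<exists>a b e d. x = Ico (of_int a) (of_int b) (ZT e d) (ZT d (- 2 * d))" by blast
qed (auto simp: Fix_def ico_eq_iff zt_eq_iff)

lemma Fix_coordinatesI [simp]: "Ico (of_int a) (of_int b) (ZT e d) (ZT d (- 2 * d)) \<in> Fix"
  unfolding Fix_coordinates by blast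

lemma L_lattice_eq: "L_lattice = emb ` Fix"
proof -
  let ?b = "vector [1, 0, 0, 0] :: real ^ 4" and ?c = "(1/2) *\<^sub>R vector [-1, 1, 1, 1] :: real ^ 4"
  let ?d = "vector [0, -1, 0, 0] :: real ^ 4" and ?e = "(1/2) *\<^sub>R vector [0, 1, tau - 1, -tau] :: real ^ 4"
  have ne: "?b \<noteq> ?c" "?b \<noteq> ?d" "?b \<noteq> ?e" "?c \<noteq> ?d" "?c \<noteq> ?e" "?d \<noteq> ?e"
    by (simp_all add: vec_eq_iff forall_4)
  have sum: "(\<Sum>b\<in>{?b, ?c, ?d, ?e}. f b *\<^sub>R b) = f ?b *\<^sub>R ?b + (f ?c *\<^sub>R ?c + (f ?d *\<^sub>R ?d + f ?e *\<^sub>R ?e))" for f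
    using ne by simp
  have e: "emb (Ico (of_int (a - b - d)) (of_int (2 * d - c)) (ZT (b - d) d) (ZT d (- 2 * d))) =
      of_int a *\<^sub>R ?b + (of_int b *\<^sub>R ?c + (of_int c *\<^sub>R ?d + of_int d *\<^sub>R ?e))" for a b c d
    by (simp add: emb_def vec_eq_iff forall_4 rz_def algebra_simps add_divide_distrib diff_divide_distrib tau_square tau_mult)
  show ?thesis
  proof (intro equalityI subsetI)
    fix x assume "x \<in> L_lattice"
    then obtain f where x: "x = (\<Sum>b\<in>{?b, ?c, ?d, ?e}. f b *\<^sub>R b)"
      and f: "\<forall>b\<in>{?b, ?c, ?d, ?e}. f b \<in> \<int>"
      unfolding L_lattice_def span_over_def by blast
    from f have "f ?b \<in> range of_int" "f ?c \<in> range of_int" "f ?d \<in> range of_int" "f ?e \<in> range of_int"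
      unfolding Ints_def by simp_all
    then obtain a b c d where "f ?b = of_int a" "f ?c = of_int b" "f ?d = of_int c" "f ?e = of_int d"
      by (elim imageE) (rule that)
    then have "x = emb (Ico (of_int (a - b - d)) (of_int (2 * d - c)) (ZT (b - d) d) (ZT d (- 2 * d)))"
      unfolding e x sum by simp
    then show "x \<in> emb ` Fix" using Fix_coordinatesI by (rule image_eqI)
  next
    fix x assume "x \<in> emb ` Fix"
    then obtain a' b' e' d where x': "x = emb (Ico (of_int a') (of_int b') (ZT e' d) (ZT d (- 2 * d)))"
      by (auto simp: Fix_coordinates)
    define b c a where "b = e' + d" and "c = 2 * d - b'" and "a = a' + e' + 2 * d"
    have "x = emb (Ico (of_int (a - b - d)) (of_int (2 * d - c)) (ZT (b - d) d) (ZT d (- 2 * d)))"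
      unfolding x' by (simp add: a_def b_def c_def)
    note x = this[unfolded e]
    define f :: "real ^ 4 \<Rightarrow> real" where "f v = (if v = ?b then of_int a else if v = ?c then of_int b else
       if v = ?d then of_int c else of_int d)" for v
    have f: "f ?b = of_int a" "f ?c = of_int b" "f ?d = of_int c" "f ?e = of_int d"
      using ne unfolding f_def by (simp_all only: if_False if_True simp_thms) (metis+)?
    have "x = (\<Sum>b\<in>{?b, ?c, ?d, ?e}. f b *\<^sub>R b)" unfolding x sum f ..
    moreover have "\<forall>b\<in>{?b, ?c, ?d, ?e}. f b \<in> \<int>" unfolding f_def by auto
    ultimately show "x \<in> L_lattice"
      unfolding L_lattice_def span_over_def by blast
  qed
qed

text \<open>The similarity \<open>x \<mapsto> p x p~\<close>.\<close>

definition twist_act :: "ico \<Rightarrow> ico \<Rightarrow> ico" where "twist_act p x = p * x * tw p"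

lemma twist_act_linear [simp]: "twist_act p (x + y) = twist_act p x + twist_act p y" "twist_act p (x - y) = twist_act p x - twist_act p y" "twist_act p 0 = 0"
  by (simp_all add: twist_act_def algebra_simps)

lemma twist_act_mult: "twist_act (p * q) x = twist_act p (twist_act q x)"
  by (simp add: twist_act_def mult.assoc)

lemma twist_act_1 [simp]: "twist_act 1 x = x" by (simp add: twist_act_def)

lemma twist_act_sc: "twist_act (sc c) x = sc (of_int (nz c)) * x"
  unfolding twist_act_def tw_linear sc_commute[of "sc c * x"] nz_eq by (simp add: ico_eq_iff mult_ac)

lemma twist_act_sc_commute: "twist_act p (sc c * x) = sc c * twist_act p x"
  by (simp add: twist_act_def sc_left_commute mult.assoc)

lemma twist_act_eq_iff: "p \<noteq> 0 \<Longrightarrow> twist_act p x = twist_act p y \<longleftrightarrow> x = y"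
  by (simp add: twist_act_def)

lemma inj_twist_act: "p \<noteq> 0 \<Longrightarrow> inj (twist_act p)" by (simp add: inj_def twist_act_eq_iff)

lemma twist_act_Fix: "x \<in> Fix \<Longrightarrow> twist_act p x \<in> Fix" by (simp add: Fix_def twist_act_def mult.assoc)

definition SL :: "ico \<Rightarrow> ico set" where "SL p = twist_act p ` Fix"

lemma SL_subset: "SL p \<subseteq> Fix" by (auto simp: SL_def twist_act_Fix)

lemma add_subgroup_SL: "add_subgroup (SL p)"
  unfolding SL_def by (intro add_subgroup_image add_subgroup_Fix) simp

lemma SL_1 [simp]: "SL 1 = Fix" by (simp add: SL_def)

lemma SL_mult: "SL (p * q) = twist_act p ` SL q"
  by (simp add: SL_def image_image twist_act_mult)

lemma SL_unit:
  assumes "iunit u"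
  shows "SL u = Fix"
proof -
  obtain v where v: "u * v = 1" using iunit_inverse[OF assms] by blast
  have "Fix = twist_act u ` SL v" using SL_mult[of u v] v by simp
  also have "\<dots> \<subseteq> SL u" unfolding SL_def using twist_act_Fix by blast
  finally show ?thesis using SL_subset by blast
qed

lemma SL_cong:
  assumes "rid p = rid q" "p \<noteq> 0"
  shows "SL p = SL q"
proof -
  obtain u where "iunit u" "q = p * u" using rid_eq_imp_unit[OF assms] by blast
  then show ?thesis by (simp add: SL_mult SL_unit) (simp add: SL_def)
qed

lemma group_index_Fix_multiple:
  assumes "m > 0"
  shows "group_index Fix ((*) (sc (of_int m)) ` Fix) = nat m ^ 4"
proof -
  let ?f = "\<lambda>x. (rat_part (cA x) mod m, rat_part (cB x) mod m, rat_part (cC x) mod m, rat_part (cD x) mod m)"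
  have mem: "z \<in> (*) (sc (of_int m)) ` Fix \<longleftrightarrow>
      m dvd rat_part (cA z) \<and> m dvd rat_part (cB z) \<and> m dvd rat_part (cC z) \<and> m dvd rat_part (cD z)" if z: "z \<in> Fix" for z
  proof
    assume "m dvd rat_part (cA z) \<and> m dvd rat_part (cB z) \<and> m dvd rat_part (cC z) \<and> m dvd rat_part (cD z)"
    then obtain a b e d where "rat_part (cA z) = m * a" "rat_part (cB z) = m * b" "rat_part (cC z) = m * e" "rat_part (cD z) = m * d"
      by (metis dvdE)
    then have "z = sc (of_int m) * Ico (of_int a) (of_int b) (ZT e d) (ZT d (- 2 * d))"
      using z by (auto simp: Fix_coordinates ico_eq_iff zt_eq_iff)
    then show "z \<in> (*) (sc (of_int m)) ` Fix" using Fix_coordinatesI by (rule image_eqI)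
  qed auto
  have "group_index Fix ((*) (sc (of_int m)) ` Fix) = card (?f ` Fix)"
    by (rule group_index_eq_card_image)
      (simp add: mem add_subgroup_diff[OF add_subgroup_Fix] mod_eq_dvd_iff)
  also have "?f ` Fix = {0..<m} \<times> {0..<m} \<times> {0..<m} \<times> {0..<m}"
  proof (intro equalityI subsetI)
    fix v assume "v \<in> {0..<m} \<times> {0..<m} \<times> {0..<m} \<times> {0..<m}"
    then obtain a b e d where "v = (a, b, e, d)" "a \<in> {0..<m}" "b \<in> {0..<m}" "e \<in> {0..<m}" "d \<in> {0..<m}"
      by auto
    then have "v = ?f (Ico (of_int a) (of_int b) (ZT e d) (ZT d (- 2 * d)))" by simp
    then show "v \<in> ?f ` Fix" using Fix_coordinatesI by (rule image_eqI)
  qed (use assms in auto)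
  finally show ?thesis using assms by (simp add: card_cartesian_product power4_eq_xxxx)
qed

lemma sc_abs_image: "(*) (sc (of_int \<bar>m\<bar>)) ` Fix = (*) (sc (of_int m)) ` Fix"
proof -
  have "(*) (sc (of_int (- m))) ` Fix = (*) (sc (of_int m)) ` Fix" for m
  proof -
    have "uminus ` Fix = Fix"
      using add_subgroup_minus[OF add_subgroup_Fix] by (auto simp: image_iff) (metis minus_minus)
    then have "(*) (sc (of_int (- m))) ` uminus ` Fix = (*) (sc (of_int (- m))) ` Fix" by simp
    then show ?thesis by (simp add: image_image)
  qed
  then show ?thesis by (simp add: abs_if)
qed

text \<open>For a scalar \<open>c\<close> the sublattice is the multiple of the lattice by the
  norm of \<open>c\<close>, a rational integer.\<close>

lemma group_index_SL:
  assumes "p \<noteq> 0"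
  shows "group_index Fix (SL p) = nat (anorm p) ^ 2"
proof (rule multiplicative_eq_norm_square[where j = "\<lambda>p. group_index Fix (SL p)", OF _ _ assms])
  fix p q :: ico assume p: "p \<noteq> 0"
  have "group_index Fix (SL (p * q)) = group_index Fix (SL p) * group_index (SL p) (SL (p * q))"
    using SL_subset[of q]
    by (intro group_index_tower add_subgroup_Fix add_subgroup_SL SL_subset) (auto simp: SL_mult, auto simp: SL_def)
  also have "group_index (SL p) (SL (p * q)) = group_index (twist_act p ` Fix) (twist_act p ` SL q)"
    by (simp only: SL_mult) (simp only: SL_def)
  also have "\<dots> = group_index Fix (SL q)" by (rule group_index_inj_image) (simp_all add: inj_twist_act p)
  finally show "group_index Fix (SL (p * q)) = group_index Fix (SL p) * group_index Fix (SL q)" .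
next
  fix c :: zt assume "c \<noteq> 0"
  have "SL (sc c) = (*) (sc (of_int (nz c))) ` Fix" unfolding SL_def twist_act_sc ..
  then show "group_index Fix (SL (sc c)) = nat \<bar>nz c\<bar> ^ 4"
    using group_index_Fix_multiple[of "\<bar>nz c\<bar>"] \<open>c \<noteq> 0\<close> by (simp add: sc_abs_image)
qed

text \<open>Up to the factor \<open>\<surd>5\<close>, the lattice spans the icosian ring over \<open>\<int>[\<tau>]\<close>: solve the two equations that
  express the twist-invariant elements \<open>x + x~\<close> and \<open>\<tau> x + \<tau>' x~\<close> in terms of \<open>x\<close> and its twist \<open>x~\<close>.\<close>

definition sqrt5 :: zt where "sqrt5 = 2 * tz - 1"

lemma sqrt5_Fix:
  "\<exists>y\<in>Fix. \<exists>z\<in>Fix. sc sqrt5 * x = y + sc (tz - 1) * z"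
proof (intro bexI)
  show "x + tw x \<in> Fix" by (simp add: Fix_def add.commute)
  show "sc tz * x + tw (sc tz * x) \<in> Fix" by (simp only: Fix_def tw_linear mem_Collect_eq add.commute)
  show "sc sqrt5 * x = (sc tz * x + tw (sc tz * x)) + sc (tz - 1) * (x + tw x)"
    unfolding tw_mult tw_linear sc_commute[of "tw x"] by (simp add: sqrt5_def ico_eq_iff algebra_simps)
qed

lemma int_coprime_sdvd:
  assumes "coprime m k" "sdvd (of_int m) (sc (of_int k) * x)"
  shows "sdvd (of_int m) x"
proof -
  obtain u v where "u * m + v * k = 1" using assms(1) by (metis bezout_int coprime_iff_gcd_eq_1)
  then have "of_int u * of_int m + of_int v * of_int k = (1 :: zt)" by (metis of_int_1 of_int_add of_int_mult)
  then have "x = sc (of_int u * of_int m + of_int v * of_int k) * x" by simp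
  also have "\<dots> = sc (of_int m) * (sc (of_int u) * x) + sc (of_int v) * (sc (of_int k) * x)"
    by (simp add: ico_eq_iff algebra_simps)
  finally show ?thesis using assms(2) by (metis sdvdI sdvd_add sdvd_mult_left)
qed

text \<open>If \<open>p L p~\<close> were contained in \<open>l L\<close> for a prime
  \<open>l\<close>, then \<open>p \<I> p~\<close> would vanish modulo a prime divisor of
  \<open>l\<close>. For \<open>l = 5\<close> the factor \<open>\<surd>5\<close> lost in passing
  from \<open>L\<close> to \<open>\<I>\<close> is harmless, since \<open>5\<close> is the square
  of \<open>\<surd>5\<close>.\<close>

lemma SL_primitive:
  assumes p: "prim p" and N: "\<And>x. x \<in> Fix \<Longrightarrow> sdvd (of_int N) (twist_act p x)"
  shows "\<bar>N\<bar> = 1"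
proof (rule ccontr)
  assume N1: "\<bar>N\<bar> \<noteq> 1"
  then obtain l where l: "prime l" "l dvd N"
    using prime_factor_int by blast
  have "sdvd (of_int l) (twist_act p x)" if x: "x \<in> Fix" for x
  proof -
    obtain k where "N = l * k" using l(2) by (rule dvdE)
    then have "(of_int l :: zt) dvd of_int N" by simp
    then show ?thesis using N[OF x] by (rule sdvd_dvd_trans)
  qed
  then have lat: "sdvd (of_int l) (twist_act p x)" if "x \<in> Fix" for x using that .
  have all: "sdvd (of_int l) (sc sqrt5 * twist_act p x)" for x
  proof -
    obtain y z where yz: "y \<in> Fix" "z \<in> Fix" "sc sqrt5 * x = y + sc (tz - 1) * z"
      using sqrt5_Fix by blast
    have "sc sqrt5 * twist_act p x = twist_act p y + sc (tz - 1) * twist_act p z"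
      unfolding twist_act_sc_commute[symmetric] yz(3) by (simp only: twist_act_linear)
    then show ?thesis using lat yz(1,2) by (simp only: sdvd_add sdvd_mult_left)
  qed
  have sq: "sqrt5 * sqrt5 = of_int 5" by (simp add: sqrt5_def zt_eq_iff)
  have "\<exists>c. prime_elem c \<and> (\<forall>x. sdvd c (twist_act p x))"
  proof (cases "l = 5")
    case True
    have s0: "sqrt5 \<noteq> 0" "\<not> sqrt5 dvd 1" by (simp_all add: zt_unit_iff nz_def sqrt5_def zt_eq_iff)
    from zt_prime_divisor[OF this] obtain c where c: "prime_elem c" "c dvd sqrt5" by metis
    have "sdvd sqrt5 (twist_act p x)" for x
      using all[of x] sdvd_sc_mult_cancel[OF s0(1), of sqrt5 "twist_act p x"] unfolding True sq[symmetric] by simp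
    then have "sdvd c (twist_act p x)" for x by (rule sdvd_dvd_trans[OF c(2)])
    then show ?thesis using c(1) by blast
  next
    case False
    have "prime (5 :: int)" by simp
    then have cop: "coprime l 5" using l(1) False by (metis primes_coprime)
    have "sdvd (of_int l) (sc (of_int 5) * twist_act p x)" for x
      using sdvd_mult_left[OF all[of x], of "sc sqrt5"] unfolding sq[symmetric] by (simp only: sc_simps mult.assoc)
    then have 1: "sdvd (of_int l) (twist_act p x)" for x by (rule int_coprime_sdvd[OF cop])
    have "(of_int l :: zt) \<noteq> 0" "\<not> (of_int l :: zt) dvd 1"
      using prime_gt_1_int[OF l(1)] by (simp_all add: zt_unit_iff power2_eq_1_iff)
    from zt_prime_divisor[OF this] obtain c :: zt where c: "prime_elem c" "c dvd of_int l" by blast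
    have "sdvd c (twist_act p x)" for x by (rule sdvd_dvd_trans[OF c(2) 1])
    then show ?thesis using c(1) by blast
  qed
  then obtain c where c: "prime_elem c" "\<And>x. sdvd c (p * x * tw p)" by (auto simp: twist_act_def)
  have nu: "\<not> c dvd 1" using c(1) by (simp add: prime_elem_def)
  from icosian_prime[OF c] show False
  proof
    assume "sdvd c p"
    then show False using primD[OF p] nu by blast
  next
    assume "sdvd c (tw p)"
    then have "sdvd (cj c) p" using tw_sdvd by fastforce
    then have "cj c dvd 1" using primD[OF p] by blast
    then show False using nu by (simp add: zt_unit_iff)
  qed
qed

text \<open>The similar sublattice \<open>m p L p~\<close>.\<close>

definition msl :: "nat \<Rightarrow> ico \<Rightarrow> ico set" where "msl m p = (*) (sc (of_nat m)) ` SL p"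

lemma msl_factor_eq:
  assumes p: "prim p" and q: "prim q" and m: "m \<ge> 1" "k \<ge> 1" and eq: "msl m p = msl k q"
  shows "m = k"
proof -
  have half: "k dvd m" if "prim p" "m \<ge> 1" "msl m p \<subseteq> msl k q" for m k p q
  proof -
    define g m1 k1 where "g = gcd m k" and "m1 = m div g" and "k1 = k div g"
    have g: "g > 0" "m = g * m1" "k = g * k1" using that by (auto simp: g_def m1_def k1_def)
    have cop: "coprime (int k1) (int m1)"
      using that(2) div_gcd_coprime[of m k] by (simp add: g_def m1_def k1_def coprime_commute)
    have "sdvd (of_int (int k1)) (twist_act p x)" if x: "x \<in> Fix" for x
    proof -
      have "sc (of_nat m) * twist_act p x \<in> msl k q"
        using \<open>msl m p \<subseteq> msl k q\<close> x by (auto simp: msl_def SL_def)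
      then obtain y where "sc (of_nat m) * twist_act p x = sc (of_nat k) * y" by (auto simp: msl_def)
      then have "sc (of_nat g) * (sc (of_nat m1) * twist_act p x) = sc (of_nat g) * (sc (of_nat k1) * y)"
        by (simp add: g mult.assoc)
      then have "sc (of_nat m1) * twist_act p x = sc (of_nat k1) * y" using g(1) by simp
      then have "sc (of_int (int m1)) * twist_act p x = sc (of_int (int k1)) * y" by simp
      then have "sdvd (of_int (int k1)) (sc (of_int (int m1)) * twist_act p x)" by (rule sdvdI)
      then show ?thesis by (rule int_coprime_sdvd[OF cop])
    qed
    from SL_primitive[OF that(1) this] have "k1 = 1" by simp
    then show "k dvd m" using g by simp
  qed
  show ?thesis using half[OF p m(1), of k q] half[OF q m(2), of m p] eq by (simp add: dvd_antisym)
qed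

text \<open>For equal sublattices, the icosian \<open>r\<close> obtained by multiplying
  \<open>q\<close> with the conjugate of \<open>p\<close> satisfies \<open>r L r~ = k L\<close>
  for an integer \<open>k\<close>. By primitivity \<open>r\<close> is a scalar times a
  unit.\<close>

lemma msl_inj:
  assumes p: "prim p" and q: "prim q" and m: "m \<ge> 1" "k \<ge> 1" and eq: "msl m p = msl k q"
  shows "m = k \<and> rid p = rid q"
proof -
  have mk: "m = k" using msl_factor_eq[OF assms] .
  have p0: "p \<noteq> 0" "q \<noteq> 0" using p q prim_nonzero by auto
  have "inj ((*) (sc (of_nat m :: zt)))" using m by (intro inj_times) simp
  then have SLeq: "SL p = SL q" using eq mk by (simp add: msl_def inj_image_eq_iff)
  define r where "r = bar p * q"
  have "bar p \<noteq> 0" using p0(1) anorm_pos[of p] by (metis anorm_simps(1,3) less_irrefl)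
  then have "r \<noteq> 0" using p0 by (simp add: r_def)
  then obtain c r0 where r: "c \<noteq> 0" "prim r0" "r = sc c * r0" using prim_decomposition by blast
  have "SL r = twist_act (bar p) ` SL p" unfolding r_def SL_mult SLeq ..
  also have "\<dots> = SL (sc (nr p))" unfolding SL_mult[symmetric] bar_mult_self ..
  also have "\<dots> = (*) (sc (of_int (anorm p))) ` Fix" unfolding SL_def twist_act_sc anorm_def ..
  finally have 1: "SL r = msl (nat (anorm p)) 1" using anorm_pos[OF p0(1)] by (simp add: msl_def)
  have "SL r = (*) (sc (of_int (nz c))) ` SL r0"
    unfolding r(3) SL_mult by (rule image_cong) (simp_all add: twist_act_sc)
  also have "\<dots> = twist_act r0 ` (*) (sc (of_int (nz c))) ` Fix" by (simp add: SL_def image_image twist_act_sc_commute)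
  also have "\<dots> = twist_act r0 ` (*) (sc (of_int \<bar>nz c\<bar>)) ` Fix" by (simp only: sc_abs_image)
  also have "\<dots> = msl (nat \<bar>nz c\<bar>) r0" by (simp add: msl_def SL_def image_image twist_act_sc_commute)
  finally have 2: "msl (nat \<bar>nz c\<bar>) r0 = msl (nat (anorm p)) 1" using 1 by simp
  have "nat \<bar>nz c\<bar> \<ge> 1" "nat (anorm p) \<ge> 1" using r(1) anorm_pos[OF p0(1)] nz_eq_0_iff[of c] by linarith+
  from msl_factor_eq[OF r(2) prim_1 this 2] have nc: "nat \<bar>nz c\<bar> = nat (anorm p)" .
  have "(of_nat (nat (anorm p)) :: zt) \<noteq> 0" using \<open>nat (anorm p) \<ge> 1\<close> unfolding of_nat_eq_0_iff by linarith
  then have "inj ((*) (sc (of_nat (nat (anorm p)) :: zt)))" by (intro inj_times) (simp only: sc_eq_0_iff not_False_eq_True)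
  then have "SL r0 = Fix" using 2 nc by (simp add: msl_def inj_image_eq_iff)
  then have "nat (anorm r0) ^ 2 = 1"
    using group_index_SL[OF prim_nonzero[OF r(2)]] group_index_self[OF add_subgroup_Fix] by simp
  then have ur0: "iunit r0" by (simp add: iunit_iff_anorm)
  have "sc (nr p) * q = p * r" by (simp add: r_def mult_bar flip: mult.assoc)
  also have "\<dots> = sc c * (p * r0)" by (simp add: r(3) sc_left_commute)
  finally have "sc c * (p * r0) = sc (nr p) * q" ..
  from prim_decomposition_unique(2)[OF prim_mult_unit[OF p ur0] q r(1) this]
  have "rid (p * r0) = rid q" .
  moreover have "rid (p * r0) = rid p"
    using ur0 p0 by (intro rid_eqI) (auto simp: iunit_def assoc_mult_unit)
  ultimately show ?thesis using mk by simp
qed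

lemma group_index_msl:
  assumes "p \<noteq> 0" "m \<ge> 1"
  shows "group_index Fix (msl m p) = m ^ 4 * nat (anorm p) ^ 2"
proof -
  have "msl m p = twist_act p ` (*) (sc (of_int (int m))) ` Fix"
    by (simp add: msl_def SL_def image_image twist_act_sc_commute)
  then have sub: "msl m p \<subseteq> SL p" and i: "group_index (SL p) (msl m p) = group_index Fix ((*) (sc (of_int (int m))) ` Fix)"
  proof -
    assume *: "msl m p = twist_act p ` (*) (sc (of_int (int m))) ` Fix"
    have "(*) (sc (of_int (int m))) ` Fix \<subseteq> Fix" by (auto simp: Fix_def sc_commute)
    then show "msl m p \<subseteq> SL p" unfolding * SL_def by blast
    show "group_index (SL p) (msl m p) = group_index Fix ((*) (sc (of_int (int m))) ` Fix)"
      unfolding * SL_def by (rule group_index_inj_image) (simp_all add: inj_twist_act assms(1))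
  qed
  have "add_subgroup (msl m p)"
    unfolding msl_def by (intro add_subgroup_image add_subgroup_SL right_diff_distrib)
  then have "group_index Fix (msl m p) = group_index Fix (SL p) * group_index (SL p) (msl m p)"
    by (intro group_index_tower add_subgroup_Fix add_subgroup_SL SL_subset sub)
  moreover have "group_index Fix ((*) (sc (of_int (int m))) ` Fix) = nat (int m) ^ 4"
    using assms(2) by (intro group_index_Fix_multiple) simp
  ultimately show ?thesis using i group_index_SL[OF assms(1)] by (simp add: mult.commute)
qed

lemma msl_subset: "msl m p \<subseteq> Fix"
  using SL_subset[of p] by (auto simp: msl_def Fix_def sc_commute)

lemma msl_cong: "rid p = rid q \<Longrightarrow> p \<noteq> 0 \<Longrightarrow> msl m p = msl m q"
  by (simp add: msl_def SL_cong)

section \<open>Similarities of Euclidean four-space\<close>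

lemma qmult_bilinear:
  "(u + v) \<star> w = u \<star> w + v \<star> w" "w \<star> (u + v) = w \<star> u + w \<star> v"
  "(u - v) \<star> w = u \<star> w - v \<star> w" "w \<star> (u - v) = w \<star> u - w \<star> v"
  "(- u) \<star> w = - (u \<star> w)" "w \<star> (- u) = - (w \<star> u)"
  "(c *\<^sub>R u) \<star> w = c *\<^sub>R (u \<star> w)" "w \<star> (c *\<^sub>R u) = c *\<^sub>R (w \<star> u)"
  "0 \<star> w = 0" "w \<star> 0 = 0"
  by (simp_all add: qmult_def vec_eq_iff forall_4 algebra_simps)

lemma qconj_linear:
  "qconj (u + v) = qconj u + qconj v" "qconj (c *\<^sub>R u) = c *\<^sub>R qconj u" "qconj (- u) = - qconj u"
  "qconj (qconj u) = u" "qconj u \<bullet> qconj v = u \<bullet> v"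
  by (simp_all add: qconj_def vec_eq_iff forall_4 inner_vec_def sum_4)

lemma inner_qmult:
  "(p \<star> u) \<bullet> (p \<star> v) = (p \<bullet> p) * (u \<bullet> v)" "(u \<star> p) \<bullet> (v \<star> p) = (p \<bullet> p) * (u \<bullet> v)"
  by (simp_all add: qmult_def inner_vec_def sum_4 algebra_simps)

definition e0 :: "real ^ 4" where "e0 = vector [1, 0, 0, 0]"
definition qi :: "real ^ 4" where "qi = vector [0, 1, 0, 0]"
definition qj :: "real ^ 4" where "qj = vector [0, 0, 1, 0]"
definition qk :: "real ^ 4" where "qk = vector [0, 0, 0, 1]"

lemmas q_defs = e0_def qi_def qj_def qk_def

lemma q_table:
  "e0 \<star> v = v" "v \<star> e0 = v"
  "qi \<star> qi = - e0" "qj \<star> qj = - e0" "qk \<star> qk = - e0"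
  "qi \<star> qj = qk" "qj \<star> qi = - qk" "qj \<star> qk = qi" "qk \<star> qj = - qi" "qk \<star> qi = qj" "qi \<star> qk = - qj"
  by (simp_all add: q_defs qmult_def vec_eq_iff forall_4)

lemma q_conj: "qconj e0 = e0" "qconj qi = - qi" "qconj qj = - qj" "qconj qk = - qk"
  by (simp_all add: q_defs qconj_def vec_eq_iff forall_4)

lemma q_inner: "e0 \<bullet> e0 = 1" "qi \<bullet> qi = 1" "qj \<bullet> qj = 1" "qk \<bullet> qk = 1"
  "e0 \<bullet> qi = 0" "e0 \<bullet> qj = 0" "e0 \<bullet> qk = 0" "qi \<bullet> qj = 0" "qi \<bullet> qk = 0" "qj \<bullet> qk = 0"
  "qi \<bullet> e0 = 0" "qj \<bullet> e0 = 0" "qk \<bullet> e0 = 0" "qj \<bullet> qi = 0" "qk \<bullet> qi = 0" "qk \<bullet> qj = 0"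
  by (simp_all add: q_defs inner_vec_def sum_4)

lemma q_expand: "v = (v $ 1) *\<^sub>R e0 + (v $ 2) *\<^sub>R qi + (v $ 3) *\<^sub>R qj + (v $ 4) *\<^sub>R qk"
  by (simp add: q_defs vec_eq_iff forall_4)

lemma inner_e0: "v \<bullet> e0 = v $ 1"
  by (simp add: q_defs inner_vec_def sum_4)

lemma pure_mult:
  assumes "u $ 1 = 0" "v $ 1 = 0"
  shows "u \<star> v + v \<star> u = - (2 * (u \<bullet> v)) *\<^sub>R e0"
  using assms by (simp add: q_defs qmult_def vec_eq_iff forall_4 inner_vec_def sum_4 algebra_simps)

lemma pure_square: "u $ 1 = 0 \<Longrightarrow> u \<star> u = - ((u \<bullet> u) *\<^sub>R e0)"
  by (simp add: q_defs qmult_def vec_eq_iff forall_4 inner_vec_def sum_4 algebra_simps)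

lemma emb_sc_qmult [simp]: "emb (sc c) \<star> v = rz c *\<^sub>R v"
  by (simp add: emb_def qmult_def vec_eq_iff forall_4)

text \<open>A similarity that maps \<open>1\<close> to a positive multiple of itself preserves the space of pure quaternions.
  The product of the images of \<open>i\<close> and \<open>j\<close> is orthogonal to \<open>1\<close> and to both of them, so up to its sign it is
  a multiple of the image of \<open>k\<close>.\<close>

lemma similarity_orientation:
  fixes S :: "real ^ 4 \<Rightarrow> real ^ 4"
  assumes lin: "linear S" and c: "c > 0" and inner: "\<And>u v. S u \<bullet> S v = c\<^sup>2 * (u \<bullet> v)" and one: "S e0 = c *\<^sub>R e0"
  shows "S qi \<star> S qj = c *\<^sub>R S qk \<or> S qi \<star> S qj = - (c *\<^sub>R S qk)"
proof -
  interpret linear S by fact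
  have pure: "S u $ 1 = 0" if "u \<bullet> e0 = 0" for u
  proof -
    have "c * (S u \<bullet> e0) = S u \<bullet> S e0" by (simp add: one)
    also have "\<dots> = 0" using that inner by simp
    finally show ?thesis using c by (simp add: inner_e0)
  qed
  have "inj S"
  proof (rule injI)
    fix x y assume "S x = S y"
    then have "S (x - y) \<bullet> S (x - y) = 0" by (simp add: diff)
    then show "x = y" using inner c by simp
  qed
  then have "surj S" using lin by (simp add: linear_injective_imp_surjective)
  define w where "w = S qi \<star> S qj"
  obtain v where v: "S v = w" using \<open>surj S\<close> by (metis surjD)
  have "w \<bullet> S qi = (S qi \<bullet> S qi) * (S qj \<bullet> e0)"
    unfolding w_def by (metis inner_qmult(1) q_table(2))
  then have "w \<bullet> S qi = 0" using pure[OF q_inner(12)] by (simp add: inner_e0 q_inner)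
  then have 1: "v \<bullet> qi = 0" using inner[of v qi] v c by simp
  have "w \<bullet> S qj = (S qj \<bullet> S qj) * (S qi \<bullet> e0)"
    unfolding w_def by (metis inner_qmult(2) q_table(1))
  then have "w \<bullet> S qj = 0" using pure[OF q_inner(11)] by (simp add: inner_e0 q_inner)
  then have 2: "v \<bullet> qj = 0" using inner[of v qj] v c by simp
  have "w \<bullet> e0 = - (S qi \<bullet> S qj)"
    using pure[OF q_inner(11)] pure[OF q_inner(12)]
    by (simp add: w_def inner_e0 q_inner) (simp add: qmult_def inner_vec_def sum_4)
  then have "w \<bullet> S e0 = 0" using inner[of qi qj] by (simp add: one q_inner)
  then have 3: "v \<bullet> e0 = 0" using inner[of v e0] v c by simp
  have vk: "v = (v $ 4) *\<^sub>R qk"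
    using 1 2 3 by (subst q_expand) (simp add: q_defs inner_vec_def sum_4)
  have "w \<bullet> w = c\<^sup>2 * c\<^sup>2"
    unfolding w_def by (simp add: inner_qmult inner q_inner)
  then have "c\<^sup>2 * (v \<bullet> v) = c\<^sup>2 * c\<^sup>2" using inner[of v v] v by metis
  then have "v \<bullet> v = c\<^sup>2" using c mult_left_cancel[of "c\<^sup>2" "v \<bullet> v" "c\<^sup>2"] by simp
  then have "(v $ 4)\<^sup>2 = c\<^sup>2" using arg_cong[OF vk, of "\<lambda>x. x \<bullet> x"] by (simp add: q_inner power2_eq_square)
  then have "v $ 4 = c \<or> v $ 4 = - c" by (simp add: power2_eq_iff)
  moreover have "w = (v $ 4) *\<^sub>R S qk" using v vk scale by metis
  ultimately show ?thesis unfolding w_def by auto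
qed

text \<open>An explicit form of the theorem of Skolem and Noether: averaging \<open>y\<close> over the quaternion units
  yields a conjugating element, and for one of the units \<open>y\<close> this average does not vanish.\<close>

lemma rotation_is_conjugation:
  fixes S :: "real ^ 4 \<Rightarrow> real ^ 4"
  assumes lin: "linear S" and c: "c > 0" and inner: "\<And>u v. S u \<bullet> S v = c\<^sup>2 * (u \<bullet> v)" and one: "S e0 = c *\<^sub>R e0"
    and orient: "S qi \<star> S qj = c *\<^sub>R S qk"
  shows "\<exists>y\<in>{e0, qi, qj, qk}. \<exists>r. r \<noteq> 0 \<and> (\<forall>u. S u \<star> r = c *\<^sub>R (r \<star> u)) \<and>
    r = S e0 \<star> y \<star> qconj e0 + S qi \<star> y \<star> qconj qi + S qj \<star> y \<star> qconj qj + S qk \<star> y \<star> qconj qk"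
proof -
  interpret linear S by fact
  define X Y Z where "X = S qi" and "Y = S qj" and "Z = S qk"
  have pure: "S u $ 1 = 0" if "u \<bullet> e0 = 0" for u
  proof -
    have "c * (S u \<bullet> e0) = S u \<bullet> S e0" by (simp add: one)
    also have "\<dots> = 0" using that inner by simp
    finally show ?thesis using c by (simp add: inner_e0)
  qed
  have sq: "S u \<star> S u = - (c\<^sup>2 *\<^sub>R e0)" if "u \<bullet> e0 = 0" "u \<bullet> u = 1" for u
  proof -
    show ?thesis using pure_square[OF pure[OF that(1)]] inner[of u u] that(2) by simp
  qed
  have XX: "X \<star> X = - (c\<^sup>2 *\<^sub>R e0)" and YY: "Y \<star> Y = - (c\<^sup>2 *\<^sub>R e0)" and ZZ: "Z \<star> Z = - (c\<^sup>2 *\<^sub>R e0)"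
    unfolding X_def Y_def Z_def by (simp_all add: sq q_inner)
  have XY: "X \<star> Y = c *\<^sub>R Z" using orient by (simp add: X_def Y_def Z_def)
  have "X \<star> Y + Y \<star> X = 0"
    unfolding X_def Y_def using pure_mult[OF pure[OF q_inner(11)] pure[OF q_inner(12)]] inner[of qi qj] by (simp add: q_inner)
  then have YX: "Y \<star> X = - (c *\<^sub>R Z)" using XY by (simp add: add_eq_0_iff)
  have "c *\<^sub>R (Z \<star> Y) = X \<star> (Y \<star> Y)" by (simp add: XY[symmetric] qmult_bilinear[symmetric] qmult_assoc)
  then have "c *\<^sub>R (Z \<star> Y) = c *\<^sub>R (- (c *\<^sub>R X))" by (simp add: YY qmult_bilinear q_table power2_eq_square)
  then have ZY: "Z \<star> Y = - (c *\<^sub>R X)" using c by (simp only: scaleR_cancel_left) simp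
  have "c *\<^sub>R (X \<star> Z) = X \<star> (X \<star> Y)" by (simp add: XY qmult_bilinear)
  also have "\<dots> = c *\<^sub>R (- (c *\<^sub>R Y))"
    by (simp add: qmult_assoc[symmetric] XX qmult_bilinear q_table power2_eq_square)
  finally have XZ: "X \<star> Z = - (c *\<^sub>R Y)" using c by (simp only: scaleR_cancel_left) simp
  have "Y \<star> Z + Z \<star> Y = 0" "Z \<star> X + X \<star> Z = 0"
    unfolding X_def Y_def Z_def using pure_mult[OF pure[OF q_inner(12)] pure[OF q_inner(13)]] pure_mult[OF pure[OF q_inner(13)] pure[OF q_inner(11)]]
      inner[of qj qk] inner[of qk qi] by (simp_all add: q_inner)
  then have YZ: "Y \<star> Z = c *\<^sub>R X" and ZX: "Z \<star> X = c *\<^sub>R Y" using ZY XZ by (simp_all add: add_eq_0_iff)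
  note table = XX YY ZZ XY YX YZ ZY ZX XZ
  have table': "X \<star> (X \<star> v) = - (c\<^sup>2 *\<^sub>R v)" "Y \<star> (Y \<star> v) = - (c\<^sup>2 *\<^sub>R v)" "Z \<star> (Z \<star> v) = - (c\<^sup>2 *\<^sub>R v)"
    "X \<star> (Y \<star> v) = c *\<^sub>R (Z \<star> v)" "Y \<star> (X \<star> v) = - (c *\<^sub>R (Z \<star> v))"
    "Y \<star> (Z \<star> v) = c *\<^sub>R (X \<star> v)" "Z \<star> (Y \<star> v) = - (c *\<^sub>R (X \<star> v))"
    "Z \<star> (X \<star> v) = c *\<^sub>R (Y \<star> v)" "X \<star> (Z \<star> v) = - (c *\<^sub>R (Y \<star> v))" for v
    by (simp_all add: qmult_assoc[symmetric] table qmult_bilinear q_table)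
  define r where "r y = c *\<^sub>R y - X \<star> (y \<star> qi) - Y \<star> (y \<star> qj) - Z \<star> (y \<star> qk)" for y
  have Se: "r y = S e0 \<star> y \<star> qconj e0 + S qi \<star> y \<star> qconj qi + S qj \<star> y \<star> qconj qj + S qk \<star> y \<star> qconj qk" for y
    by (simp add: r_def one q_conj qmult_bilinear q_table qmult_assoc X_def Y_def Z_def)
  have ri: "X \<star> r y = c *\<^sub>R (r y \<star> qi)" and rj: "Y \<star> r y = c *\<^sub>R (r y \<star> qj)" and rk: "Z \<star> r y = c *\<^sub>R (r y \<star> qk)" for y
    unfolding r_def
    by (simp_all add: qmult_bilinear table' qmult_assoc q_table scaleR_diff_right scaleR_add_right power2_eq_square)
  have all: "S u \<star> r y = c *\<^sub>R (r y \<star> u)" for u y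
  proof -
    have "S u = (u $ 1) *\<^sub>R (c *\<^sub>R e0) + (u $ 2) *\<^sub>R X + (u $ 3) *\<^sub>R Y + (u $ 4) *\<^sub>R Z"
      by (subst q_expand[of u]) (simp only: add scale one X_def Y_def Z_def)
    then have "S u \<star> r y = (u $ 1) *\<^sub>R (c *\<^sub>R r y) + (u $ 2) *\<^sub>R (X \<star> r y) + (u $ 3) *\<^sub>R (Y \<star> r y) + (u $ 4) *\<^sub>R (Z \<star> r y)"
      by (simp add: qmult_bilinear q_table)
    also have "\<dots> = c *\<^sub>R (r y \<star> ((u $ 1) *\<^sub>R e0 + (u $ 2) *\<^sub>R qi + (u $ 3) *\<^sub>R qj + (u $ 4) *\<^sub>R qk))"
      by (simp add: ri rj rk qmult_bilinear q_table scaleR_add_right mult.commute)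
    finally show ?thesis by (simp only: q_expand[symmetric])
  qed
  have "r e0 - r qi \<star> qi - r qj \<star> qj - r qk \<star> qk = (4 * c) *\<^sub>R e0"
    unfolding r_def by (simp add: qmult_bilinear q_table qmult_assoc) (simp add: vec_eq_iff algebra_simps)
  then have "\<not> (r e0 = 0 \<and> r qi = 0 \<and> r qj = 0 \<and> r qk = 0)"
    using c q_inner(1) by (auto simp: qmult_bilinear)
  then obtain y where "y \<in> {e0, qi, qj, qk}" "r y \<noteq> 0" by blast
  then show ?thesis using all Se by blast
qed

section \<open>Similar sublattices of the fixed lattice\<close>

text \<open>It suffices to commute with the second and the third basis element.\<close>

lemma icosian_center:
  assumes "\<And>x. b * x = x * b"
  shows "b = sc (cA b)"
proof -
  have i: "b * Ico 0 1 0 0 = Ico 0 1 0 0 * b" and h: "b * Ico 0 0 1 0 = Ico 0 0 1 0 * b" using assms by blast+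
  have "cC b = 0 \<and> cD b = 0"
    using i by (simp add: ico_eq_iff times_ico_def zt_eq_iff)
  moreover from this have "cB b = 0"
    using h by (simp add: ico_eq_iff times_ico_def zt_eq_iff)
  ultimately show ?thesis by (simp add: ico_eq_iff)
qed

text \<open>Vanishing on the lattice implies vanishing on \<open>\<surd>5\<close> times any
  icosian, a combination of lattice elements.\<close>

lemma linear_on_Fix_extends:
  assumes "\<And>x y. D (x + y) = D x + D y" "\<And>c x. D (sc c * x) = sc c * D x" "\<And>x. x \<in> Fix \<Longrightarrow> D x = 0"
  shows "D x = 0"
proof -
  obtain y z where yz: "y \<in> Fix" "z \<in> Fix" "sc sqrt5 * x = y + sc (tz - 1) * z"
    using sqrt5_Fix by blast
  have "sc sqrt5 * D x = D y + sc (tz - 1) * D z"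
    unfolding assms(1,2)[symmetric] yz(3) ..
  then have "sc sqrt5 * D x = 0" using assms(3) yz by simp
  moreover have "sqrt5 \<noteq> 0" by (simp add: sqrt5_def zt_eq_iff)
  ultimately show ?thesis by (simp only: sc_mult_eq_0_iff) simp
qed

text \<open>If \<open>P x Q\<close> is a multiple of an element of the lattice for all \<open>x\<close> in the lattice, then applying the
  twist to it shows that \<open>Q\<close> is proportional to the twist of \<open>P\<close>. The scalars that remain are then
  pushed into the rational integers by a second application of the twist.\<close>

lemma sandwich_on_Fix:
  assumes n: "n \<noteq> 0" and P: "P \<noteq> 0" and Q: "Q \<noteq> 0"
    and s: "\<And>x. x \<in> Fix \<Longrightarrow> s x \<in> Fix" "\<And>x. x \<in> Fix \<Longrightarrow> sc n * s x = P * x * Q"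
  shows "\<exists>p m. prim p \<and> m \<ge> 1 \<and> s ` Fix = msl m p"
proof -
  define P1 Q1 W where "P1 = sc (cj n) * P" and "Q1 = sc n * tw Q" and "W = tw P"
  have nz0: "P1 \<noteq> 0" "W \<noteq> 0" using n P by (simp_all add: P1_def W_def)
  have "P1 * x * Q - Q1 * x * W = 0" for x
  proof (rule linear_on_Fix_extends[where D = "\<lambda>x. P1 * x * Q - Q1 * x * W"])
    fix x assume x: "x \<in> Fix"
    have "tw (sc n * s x) = tw (P * x * Q)" by (simp only: s(2)[OF x])
    then have 1: "sc (cj n) * s x = tw Q * x * W"
      using x s(1)[OF x] by (simp add: Fix_iff W_def mult.assoc sc_commute)
    have "P1 * x * Q = sc (cj n) * (sc n * s x)" by (simp add: P1_def s(2)[OF x] mult.assoc)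
    also have "\<dots> = sc n * (sc (cj n) * s x)" by (simp add: ico_eq_iff)
    also have "\<dots> = Q1 * x * W" by (simp add: 1 Q1_def mult.assoc)
    finally show "P1 * x * Q - Q1 * x * W = 0" by simp
  qed (simp_all add: algebra_simps sc_left_commute)
  then have PQ: "P1 * x * Q = Q1 * x * W" for x by (metis eq_iff_diff_eq_0)
  define b where "b = bar P1 * Q1"
  have bx: "sc (nr P1) * (x * Q) = b * x * W" for x
    using arg_cong[OF PQ[of x], of "\<lambda>z. bar P1 * z"] by (simp add: b_def bar_mult_self flip: mult.assoc)
  have b1: "sc (nr P1) * Q = b * W" using bx[of 1] by simp
  have "b * x = x * b" for x
  proof -
    have "b * x * W = x * b * W" using bx[of x] b1 by (metis mult.assoc sc_left_commute)
    then show ?thesis using nz0(2) by simp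
  qed
  then obtain \<beta> where \<beta>: "b = sc \<beta>" using icosian_center by metis
  have \<beta>0: "\<beta> \<noteq> 0" using b1 Q nz0 \<beta> by auto
  obtain c p where p: "c \<noteq> 0" "prim p" "P = sc c * p" using prim_decomposition[OF P] by blast
  define l u where "l = nr P1 * n" and "u = \<beta> * of_int (nz c)"
  have l0: "l \<noteq> 0" "u \<noteq> 0" using nz0 n \<beta>0 p(1) by (simp_all add: l_def u_def)
  have eq: "sc l * s x = sc u * twist_act p x" if x: "x \<in> Fix" for x
  proof -
    have "sc l * s x = sc (nr P1) * (P * x * Q)" by (simp only: l_def sc_simps mult.assoc s(2)[OF x, unfolded mult.assoc])
    also have "\<dots> = P * x * (sc (nr P1) * Q)" by (simp add: sc_left_commute)
    also have "\<dots> = sc \<beta> * twist_act P x" by (simp add: b1 \<beta> W_def sc_left_commute twist_act_def)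
    also have "twist_act P x = sc (of_int (nz c)) * twist_act p x" by (simp add: p(3) twist_act_mult twist_act_sc)
    finally show ?thesis by (simp add: u_def mult.assoc)
  qed
  have eq': "sc (cj l) * s x = sc (cj u) * twist_act p x" if x: "x \<in> Fix" for x
  proof -
    have "tw (sc l * s x) = tw (sc u * twist_act p x)" by (simp only: eq[OF x])
    then show ?thesis using s(1)[OF x] twist_act_Fix[OF x, of p] by (simp add: Fix_iff sc_commute)
  qed
  \<comment> \<open>Comparing the two equations, the ratio of \<open>u\<close> and \<open>l\<close> is fixed by the Galois automorphism.\<close>
  define \<kappa> where "\<kappa> = cj l * u"
  have F1: "twist_act p 1 \<noteq> 0" using prim_nonzero[OF p(2)] by (simp add: twist_act_def)
  have "sc \<kappa> * twist_act p 1 = sc (cj l) * (sc l * s 1)" using eq[of 1] by (simp add: \<kappa>_def mult.assoc)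
  also have "\<dots> = sc l * (sc (cj l) * s 1)" by (simp add: ico_eq_iff)
  also have "\<dots> = sc (l * cj u) * twist_act p 1" using eq'[of 1] by (simp add: mult.assoc)
  finally have "sc (\<kappa> - l * cj u) * twist_act p 1 = 0" by (simp add: left_diff_distrib)
  then have "\<kappa> = l * cj u" using F1 by (simp only: sc_mult_eq_0_iff) simp
  then have "cj \<kappa> = \<kappa>" by (simp add: \<kappa>_def mult.commute)
  then obtain k where k: "\<kappa> = of_int k" using cj_fixed_imp by blast
  have k0: "k \<noteq> 0" using l0 k by (auto simp: \<kappa>_def)
  define N where "N = nz l"
  have N0: "N \<noteq> 0" using l0 by (simp add: N_def)
  have eqN: "sc (of_int N) * s x = sc (of_int k) * twist_act p x" if x: "x \<in> Fix" for x
    using arg_cong[OF eq[OF x], of "\<lambda>z. sc (cj l) * z"] unfolding k[symmetric] \<kappa>_def N_def nz_eq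
    by (simp add: ico_eq_iff mult_ac)
  define g N1 k1 where "g = gcd N k" and "N1 = N div g" and "k1 = k div g"
  have g: "g \<noteq> 0" "N = g * N1" "k = g * k1" using N0 by (simp_all add: g_def N1_def k1_def)
  have cop: "coprime N1 k1" using N0 by (simp add: g_def N1_def k1_def div_gcd_coprime)
  have eq1: "sc (of_int N1) * s x = sc (of_int k1) * twist_act p x" if x: "x \<in> Fix" for x
  proof -
    have "sc (of_int g) * (sc (of_int N1) * s x) = sc (of_int g) * (sc (of_int k1) * twist_act p x)"
      using eqN[OF x] by (simp add: g mult.assoc)
    then show ?thesis using g(1) by simp
  qed
  have "sdvd (of_int N1) (twist_act p x)" if x: "x \<in> Fix" for x
    by (rule int_coprime_sdvd[OF cop]) (rule sdvdI, rule eq1[OF x, symmetric])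
  from SL_primitive[OF p(2) this] have N1: "\<bar>N1\<bar> = 1" .
  then have N1sq: "N1 * N1 = 1" by (metis abs_mult_self_eq mult_1)
  have sx: "s x = sc (of_int (N1 * k1)) * twist_act p x" if x: "x \<in> Fix" for x
  proof -
    have "s x = sc (of_int (N1 * N1)) * s x" by (simp add: N1sq)
    also have "\<dots> = sc (of_int N1) * (sc (of_int N1) * s x)" by (simp add: mult.assoc)
    also have "\<dots> = sc (of_int (N1 * k1)) * twist_act p x" by (simp add: eq1[OF x] mult.assoc)
    finally show ?thesis .
  qed
  have "s ` Fix = twist_act p ` (*) (sc (of_int (N1 * k1))) ` Fix"
    unfolding image_image by (rule image_cong) (simp_all only: sx twist_act_sc_commute)
  also have "\<dots> = twist_act p ` (*) (sc (of_int \<bar>N1 * k1\<bar>)) ` Fix" by (simp only: sc_abs_image)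
  also have "\<dots> = twist_act p ` (*) (sc (of_int (int (nat \<bar>k1\<bar>)))) ` Fix" by (simp add: abs_mult N1)
  also have "\<dots> = msl (nat \<bar>k1\<bar>) p" by (simp add: msl_def SL_def image_image twist_act_sc_commute)
  finally have "s ` Fix = msl (nat \<bar>k1\<bar>) p" .
  moreover have "k1 \<noteq> 0" using g k0 by auto
  then have "nat \<bar>k1\<bar> \<ge> 1" by linarith
  ultimately show ?thesis using p(2) by blast
qed

lemma emb_units: "emb (lipschitz 1 0 0 0) = e0" "emb (lipschitz 0 1 0 0) = qi" "emb (lipschitz 0 0 1 0) = qj" "emb (lipschitz 0 0 0 1) = qk"
  by (simp_all add: emb_lipschitz q_defs)

text \<open>With \<open>a = S(1)\<close> and the conjugating element \<open>r\<close> of the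
  rotation \<open>u \<mapsto> a\<^sup>-\<^sup>1 S(u)\<close>, one has \<open>S(u) r = a r
  u\<close>. A multiple of \<open>r\<close> by \<open>\<surd>5\<close> is an icosian
  \<open>r\<^sub>0\<close>, because \<open>S\<close> maps \<open>\<surd>5\<close> times an icosian
  to an icosian. Multiplication by the conjugate of \<open>r\<^sub>0\<close> brings
  \<open>S\<close> into the form \<open>x \<mapsto> P x Q\<close>, up to a scalar.\<close>

lemma similarity_preserving_orientation:
  fixes S :: "real ^ 4 \<Rightarrow> real ^ 4"
  assumes lin: "linear S" and c: "c > 0" and inner: "\<And>u v. S u \<bullet> S v = c * (u \<bullet> v)"
    and sub: "S ` emb ` Fix \<subseteq> emb ` Fix"
    and a: "emb a = S e0"
    and orient: "(qconj (emb a) \<star> S qi) \<star> (qconj (emb a) \<star> S qj) = c *\<^sub>R (qconj (emb a) \<star> S qk)"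
  shows "\<exists>p m. prim p \<and> m \<ge> 1 \<and> S ` emb ` Fix = emb ` msl m p"
proof -
  interpret linear S by fact
  have ac: "emb a \<bullet> emb a = c" unfolding a using inner[of e0 e0] by (simp add: q_inner)
  then have a0: "a \<noteq> 0" using c by auto
  define R where "R u = qconj (emb a) \<star> S u" for u
  have R_lin: "linear R"
    unfolding R_def by (rule linearI) (simp_all add: add scale qmult_bilinear)
  have R_inner: "R u \<bullet> R v = c\<^sup>2 * (u \<bullet> v)" for u v
    by (simp add: R_def inner_qmult qconj_linear ac inner power2_eq_square)
  have R_one: "R e0 = c *\<^sub>R e0"
    by (simp add: R_def a[symmetric] qmult_qconj ac e0_def[symmetric])
  obtain y r where y: "y \<in> {e0, qi, qj, qk}" and r: "r \<noteq> 0" "\<And>u. R u \<star> r = c *\<^sub>R (r \<star> u)"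
    "r = R e0 \<star> y \<star> qconj e0 + R qi \<star> y \<star> qconj qi + R qj \<star> y \<star> qconj qj + R qk \<star> y \<star> qconj qk"
    using rotation_is_conjugation[OF R_lin c R_inner R_one] orient unfolding R_def[symmetric] by blast
  obtain s where s: "\<And>x. x \<in> Fix \<Longrightarrow> s x \<in> Fix" "\<And>x. x \<in> Fix \<Longrightarrow> S (emb x) = emb (s x)"
  proof -
    have "\<forall>x\<in>Fix. \<exists>z. z \<in> Fix \<and> S (emb x) = emb z" using sub by blast
    then show ?thesis using that by metis
  qed
  have S5: "\<exists>w. rz sqrt5 *\<^sub>R S (emb x) = emb w" for x
  proof -
    obtain u v where uv: "u \<in> Fix" "v \<in> Fix" "sc sqrt5 * x = u + sc (tz - 1) * v"
      using sqrt5_Fix by blast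
    have "rz sqrt5 *\<^sub>R S (emb x) = S (emb (sc sqrt5 * x))" by (simp only: scale emb_sc)
    also have "\<dots> = S (emb u) + rz (tz - 1) *\<^sub>R S (emb v)"
      unfolding uv(3) by (simp only: emb_linear emb_sc add scale)
    also have "\<dots> = emb (s u + sc (tz - 1) * s v)" by (simp only: s(2) uv emb_linear emb_sc)
    finally show ?thesis by blast
  qed
  obtain w1 wi wj wk where w: "rz sqrt5 *\<^sub>R S e0 = emb w1" "rz sqrt5 *\<^sub>R S qi = emb wi"
    "rz sqrt5 *\<^sub>R S qj = emb wj" "rz sqrt5 *\<^sub>R S qk = emb wk"
    using S5[of "lipschitz 1 0 0 0"] S5[of "lipschitz 0 1 0 0"] S5[of "lipschitz 0 0 1 0"] S5[of "lipschitz 0 0 0 1"]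
    unfolding emb_units by blast
  obtain y0 where y0: "y = emb y0" using y emb_units by (metis empty_iff insert_iff)
  define r0 where "r0 = bar a * w1 * y0 * bar (lipschitz 1 0 0 0) + bar a * wi * y0 * bar (lipschitz 0 1 0 0)
    + bar a * wj * y0 * bar (lipschitz 0 0 1 0) + bar a * wk * y0 * bar (lipschitz 0 0 0 1)"
  have er0: "emb r0 = rz sqrt5 *\<^sub>R r"
    unfolding r(3) r0_def R_def
    by (simp add: emb_units y0 w[symmetric] qmult_bilinear scaleR_add_right qmult_assoc)
  have "rz sqrt5 \<noteq> 0" by (simp add: sqrt5_def zt_eq_iff del: rz_simps rz_mult)
  then have "emb r0 \<noteq> emb 0" using r(1) er0 by simp
  then have r0: "r0 \<noteq> 0" by blast
  have conj_r0: "R u \<star> emb r0 = c *\<^sub>R (emb r0 \<star> u)" for u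
    unfolding er0 by (simp add: qmult_bilinear r(2))
  have main: "rz (nr r0) *\<^sub>R S u = emb (a * r0) \<star> u \<star> emb (bar r0)" for u
  proof -
    have "c *\<^sub>R (S u \<star> emb r0) = emb a \<star> (R u \<star> emb r0)"
      by (simp add: R_def qmult_assoc[symmetric] qmult_qconj qmult_bilinear ac qmult_one)
    also have "\<dots> = c *\<^sub>R (emb (a * r0) \<star> u)" by (simp add: conj_r0 qmult_bilinear qmult_assoc)
    finally have "S u \<star> emb r0 = emb (a * r0) \<star> u" using c by simp
    then have "S u \<star> (emb r0 \<star> emb (bar r0)) = emb (a * r0) \<star> u \<star> emb (bar r0)"
      by (simp add: qmult_assoc[symmetric])
    then show ?thesis by (simp add: qmult_qconj qmult_bilinear qmult_one rz_nr)
  qed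
  have "sc (nr r0) * s x = (a * r0) * x * bar r0" if x: "x \<in> Fix" for x
  proof -
    have "emb (sc (nr r0) * s x) = emb ((a * r0) * x * bar r0)"
      using main[of "emb x"] by (simp add: s(2)[OF x])
    then show ?thesis by (simp only: emb_inj)
  qed
  moreover have "bar r0 \<noteq> 0" using r0 by (metis bar_linear(1,7))
  ultimately obtain p m where "prim p" "m \<ge> 1" "s ` Fix = msl m p"
    using sandwich_on_Fix[of "nr r0" "a * r0" "bar r0" s] r0 a0 s(1) by auto
  moreover have "S ` emb ` Fix = emb ` s ` Fix" using s(2) by (auto simp: image_image)
  ultimately show ?thesis by metis
qed

lemma bar_Fix: "bar x \<in> Fix \<longleftrightarrow> x \<in> Fix"
  unfolding Fix_iff tw_bar by (metis bar_linear(7))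

theorem similarity_of_Fix:
  fixes S :: "real ^ 4 \<Rightarrow> real ^ 4"
  assumes lin: "linear S" and c: "c > 0" and inner: "\<And>u v. S u \<bullet> S v = c * (u \<bullet> v)"
    and sub: "S ` emb ` Fix \<subseteq> emb ` Fix"
  shows "\<exists>p m. prim p \<and> m \<ge> 1 \<and> S ` emb ` Fix = emb ` msl m p"
proof -
  interpret linear S by fact
  have "e0 = emb 1" by (simp add: e0_def emb_1)
  then have "S e0 \<in> emb ` Fix" using sub by auto
  then obtain a where a: "emb a = S e0" by (metis imageE)
  have ac: "emb a \<bullet> emb a = c" unfolding a using inner[of e0 e0] by (simp add: q_inner)
  define R where "R u = qconj (emb a) \<star> S u" for u
  have "linear R" unfolding R_def by (rule linearI) (simp_all add: add scale qmult_bilinear)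
  moreover have "R u \<bullet> R v = c\<^sup>2 * (u \<bullet> v)" for u v
    by (simp add: R_def inner_qmult qconj_linear ac inner power2_eq_square)
  moreover have "R e0 = c *\<^sub>R e0"
    by (simp add: R_def a[symmetric] qmult_qconj ac e0_def[symmetric])
  ultimately have "R qi \<star> R qj = c *\<^sub>R R qk \<or> R qi \<star> R qj = - (c *\<^sub>R R qk)"
    using similarity_orientation[of R c] c by blast
  then show ?thesis
  proof
    assume "R qi \<star> R qj = c *\<^sub>R R qk"
    then show ?thesis using similarity_preserving_orientation[OF lin c inner sub a] by (simp add: R_def)
  next
    \<comment> \<open>Conjugation maps the lattice to itself, and composing with it changes the orientation.\<close>
    assume neg: "R qi \<star> R qj = - (c *\<^sub>R R qk)"
    define S' where "S' u = S (qconj u)" for u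
    have "qconj ` emb ` Fix = emb ` bar ` Fix" by (simp add: image_image)
    also have "bar ` Fix = Fix" using bar_Fix by (auto simp: image_iff) (metis bar_linear(7))
    finally have im: "S' ` emb ` Fix = S ` emb ` Fix" unfolding S'_def by (simp add: image_image[symmetric])
    have "linear S'" unfolding S'_def by (rule linearI) (simp_all add: qconj_linear add scale)
    moreover have "S' u \<bullet> S' v = c * (u \<bullet> v)" for u v by (simp add: S'_def inner qconj_linear)
    moreover have "emb a = S' e0" by (simp add: S'_def q_conj a)
    moreover have "S' qi = - S qi" "S' qj = - S qj" "S' qk = - S qk"
      using scale[of "- 1"] by (simp_all add: S'_def q_conj)
    ultimately show ?thesis
      using similarity_preserving_orientation[of S' c a] c sub neg im
      by (simp add: R_def qmult_bilinear)
  qed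
qed

lemma span_Fix: "span (emb ` Fix) = UNIV"
proof -
  have emb: "emb x \<in> span (emb ` Fix)" for x
  proof -
    obtain u v where uv: "u \<in> Fix" "v \<in> Fix" "sc sqrt5 * x = u + sc (tz - 1) * v"
      using sqrt5_Fix by blast
    have "rz sqrt5 *\<^sub>R emb x = emb u + rz (tz - 1) *\<^sub>R emb v"
      using arg_cong[OF uv(3), of emb] by (simp only: emb_linear emb_sc)
    then have 1: "rz sqrt5 *\<^sub>R emb x \<in> span (emb ` Fix)"
      using uv by (simp only:) (intro span_add span_scale span_base imageI)
    have "rz sqrt5 \<noteq> 0" by (simp add: sqrt5_def zt_eq_iff del: rz_simps rz_mult)
    then have "emb x = (1 / rz sqrt5) *\<^sub>R (rz sqrt5 *\<^sub>R emb x)" by simp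
    then show ?thesis using span_scale[OF 1] by metis
  qed
  have "v \<in> span (emb ` Fix)" for v
    by (subst q_expand) (use emb emb_units in \<open>metis span_add span_scale\<close>)
  then show ?thesis by auto
qed

lemma ssl_L_iff: "ssl L_lattice \<Lambda> \<longleftrightarrow> (\<exists>p m. prim p \<and> m \<ge> 1 \<and> \<Lambda> = emb ` msl m p)"
proof
  assume "ssl L_lattice \<Lambda>"
  then show "\<exists>p m. prim p \<and> m \<ge> 1 \<and> \<Lambda> = emb ` msl m p"
    unfolding ssl_def similarity_on_def L_lattice_eq span_Fix using similarity_of_Fix by fastforce
next
  assume "\<exists>p m. prim p \<and> m \<ge> 1 \<and> \<Lambda> = emb ` msl m p"
  then obtain p m where p: "prim p" "m \<ge> 1" "\<Lambda> = emb ` msl m p" by blast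
  define S where "S v = real m *\<^sub>R (emb p \<star> v \<star> emb (tw p))" for v
  have lin: "linear S" unfolding S_def by (rule linearI) (simp_all add: qmult_bilinear algebra_simps)
  have "emb p \<bullet> emb p \<noteq> 0" "emb (tw p) \<bullet> emb (tw p) \<noteq> 0"
    using prim_nonzero[OF p(1)] emb_inj[of _ 0] by auto
  then have "0 < emb p \<bullet> emb p" "0 < emb (tw p) \<bullet> emb (tw p)" by simp_all
  then have pos: "real m * (real m * ((emb (tw p) \<bullet> emb (tw p)) * (emb p \<bullet> emb p))) > 0" using p(2) by simp
  have inner: "S u \<bullet> S v = real m * (real m * ((emb (tw p) \<bullet> emb (tw p)) * (emb p \<bullet> emb p))) * (u \<bullet> v)" for u v
    by (simp add: S_def inner_qmult)
  have "S ` emb ` Fix = emb ` msl m p"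
    by (simp add: S_def msl_def SL_def image_image twist_act_def)
  moreover have "emb ` msl m p \<subseteq> emb ` Fix" using msl_subset by blast
  moreover have "similarity_on (span (emb ` Fix)) S"
    unfolding similarity_on_def using lin
    by (intro conjI exI[of _ "real m * (real m * ((emb (tw p) \<bullet> emb (tw p)) * (emb p \<bullet> emb p)))"])
      (simp_all only: pos inner span_Fix subset_UNIV ball_simps simp_thms)
  ultimately show "ssl L_lattice \<Lambda>" unfolding ssl_def L_lattice_eq p(3) by metis
qed

section \<open>The root lattice\<close>

lemma forall_5: "(\<forall>i::5. P i) \<longleftrightarrow> P 1 \<and> P 2 \<and> P 3 \<and> P 4 \<and> P 5"
proof -
  have "i = 1 \<or> i = 2 \<or> i = 3 \<or> i = 4 \<or> i = 5" for i :: 5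
  proof (induct i)
    case (of_int z)
    then have "0 \<le> z" and "z < 5" by simp_all
    then have "z = 0 \<or> z = 1 \<or> z = 2 \<or> z = 3 \<or> z = 4" by arith
    then show ?case by auto
  qed
  then show ?thesis by metis
qed

lemma UNIV_5: "UNIV = {1, 2, 3, 4, 5 :: 5}"
  using forall_5[of "\<lambda>i. i \<in> {1, 2, 3, 4, 5}"] by auto

lemma sum_5: "sum f (UNIV :: 5 set) = f 1 + f 2 + f 3 + f 4 + f 5"
  unfolding UNIV_5 by (simp add: ac_simps)

lemma vec5_nth:
  "(vector [a, b, c, d, e] :: real ^ 5) $ 1 = a"
  "(vector [a, b, c, d, e] :: real ^ 5) $ 2 = b"
  "(vector [a, b, c, d, e] :: real ^ 5) $ 3 = c"
  "(vector [a, b, c, d, e] :: real ^ 5) $ 4 = d"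
  "(vector [a, b, c, d, e] :: real ^ 5) $ 5 = e"
  by (simp_all add: vector_def)

text \<open>The linear map that sends the basis by which \<open>L\<close> is defined to the simple roots of \<open>A\<^sub>4\<close>.\<close>

definition root_map :: "real ^ 4 \<Rightarrow> real ^ 5" where
  "root_map x = vector
    [x $ 1 + (x $ 3) * (tau + 2) / 5 + (x $ 4) * (3 - tau) / 5,
     - (x $ 1) + (x $ 3) * (tau + 2) / 5 + (x $ 4) * (3 - tau) / 5,
     - (x $ 2) + (x $ 3) * (tau - 3) / 5 - (x $ 4) * (tau + 2) / 5,
     x $ 2 + (x $ 3) * (tau - 3) / 5 - (x $ 4) * (tau + 2) / 5,
     (x $ 4 - x $ 3) * (4 * tau - 2) / 5]"

text \<open>Half of the adjoint of \<open>root_map\<close>, which is a left inverse as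
  \<open>root_map\<close> doubles inner products.\<close>

definition root_map_inv :: "real ^ 5 \<Rightarrow> real ^ 4" where
  "root_map_inv w = (1/2) *\<^sub>R vector
    [w $ 1 - w $ 2, w $ 4 - w $ 3,
     (w $ 1 + w $ 2) * (tau + 2) / 5 + (w $ 3 + w $ 4) * (tau - 3) / 5 - w $ 5 * (4 * tau - 2) / 5,
     (w $ 1 + w $ 2) * (3 - tau) / 5 - (w $ 3 + w $ 4) * (tau + 2) / 5 + w $ 5 * (4 * tau - 2) / 5]"

lemma linear_root_map: "linear root_map"
  by (rule linearI) (simp_all add: root_map_def vec_eq_iff forall_5 vec5_nth algebra_simps add_divide_distrib diff_divide_distrib)

lemma linear_root_map_inv: "linear root_map_inv"
  by (rule linearI) (simp_all add: root_map_inv_def vec_eq_iff forall_4 algebra_simps add_divide_distrib diff_divide_distrib)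

lemma root_map_inv_root_map: "root_map_inv (root_map x) = x"
  by (simp add: root_map_inv_def root_map_def vec_eq_iff forall_4 vec5_nth field_simps tau_square tau_mult)

lemma root_map_inner: "root_map x \<bullet> root_map y = 2 * (x \<bullet> y)"
  by (simp add: root_map_def inner_vec_def sum_4 sum_5 vec5_nth field_simps tau_square tau_mult)

lemma root_map_L: "root_map ` L_lattice = A4"
proof -
  have e: "root_map (emb (Ico (of_int a) (of_int b) (ZT e d) (ZT d (- 2 * d)))) =
      vector [of_int (a + e + 2 * d), of_int (- a - d), of_int (d - b - e), of_int (b - d), of_int (- d)]" for a b e d
    by (simp add: root_map_def emb_def vec_eq_iff forall_5 vec5_nth rz_def field_simps tau_square tau_mult)
  show ?thesis
  proof (intro equalityI subsetI)
    fix x assume "x \<in> root_map ` L_lattice"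
    then obtain a b e' d where "x = root_map (emb (Ico (of_int a) (of_int b) (ZT e' d) (ZT d (- 2 * d))))"
      unfolding L_lattice_eq by (auto simp: Fix_coordinates)
    then show "x \<in> A4" unfolding e by (simp add: A4_def forall_5 sum_5 vec5_nth)
  next
    fix x assume x: "x \<in> A4"
    then obtain x1 x2 x3 x4 x5 where i: "x $ 1 = of_int x1" "x $ 2 = of_int x2" "x $ 3 = of_int x3"
      "x $ 4 = of_int x4" "x $ 5 = of_int x5" unfolding A4_def Ints_def by (auto simp: forall_5)
    have "real_of_int (x1 + x2 + x3 + x4 + x5) = 0" using x i by (simp add: A4_def sum_5)
    then have s: "x1 + x2 + x3 + x4 + x5 = 0" by (simp only: of_int_eq_0_iff)
    define d b a e' where "d = - x5" and "b = x4 + d" and "a = - x2 - d" and "e' = d - b - x3"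
    have "x1 = a + e' + 2 * d" "x2 = - a - d" "x3 = d - b - e'" "x4 = b - d" "x5 = - d"
      using s by (simp_all add: d_def b_def a_def e'_def)
    then have "x = root_map (emb (Ico (of_int a) (of_int b) (ZT e' d) (ZT d (- 2 * d))))"
      unfolding e using i by (simp add: vec_eq_iff forall_5 vec5_nth)
    then show "x \<in> root_map ` L_lattice" unfolding L_lattice_eq using Fix_coordinatesI by blast
  qed
qed

lemma span_A4: "span A4 = range root_map"
  unfolding root_map_L[symmetric] L_lattice_eq linear_span_image[OF linear_root_map] span_Fix ..

text \<open>A similarity of the hyperplane spanned by \<open>A\<^sub>4\<close> is transported to
  the four-dimensional space and back by composition with the two maps above.\<close>

lemma ssl_A4_iff: "ssl A4 \<Lambda> \<longleftrightarrow> (\<exists>\<Lambda>'. ssl L_lattice \<Lambda>' \<and> \<Lambda> = root_map ` \<Lambda>')"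
proof
  assume "ssl A4 \<Lambda>"
  then obtain S c where S: "linear S" "S ` range root_map \<subseteq> range root_map" "c > 0"
    "\<And>u v. u \<in> range root_map \<Longrightarrow> v \<in> range root_map \<Longrightarrow> S u \<bullet> S v = c * (u \<bullet> v)" and \<Lambda>: "\<Lambda> = S ` A4" "\<Lambda> \<subseteq> A4"
    unfolding ssl_def similarity_on_def span_A4 by blast
  define S' where "S' = root_map_inv \<circ> S \<circ> root_map"
  have hS: "root_map (S' u) = S (root_map u)" for u
  proof -
    obtain w where "S (root_map u) = root_map w" using S(2) by blast
    then show ?thesis by (simp add: S'_def root_map_inv_root_map)
  qed
  have "linear S'" unfolding S'_def by (intro linear_compose linear_root_map linear_root_map_inv S)
  moreover have "S' u \<bullet> S' v = c * (u \<bullet> v)" for u v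
    using root_map_inner[of "S' u" "S' v"] S(4)[of "root_map u" "root_map v"] by (simp add: hS root_map_inner)
  ultimately have sim: "similarity_on (span L_lattice) S'"
    unfolding similarity_on_def L_lattice_eq span_Fix using S(3) by auto
  have im: "root_map ` (S' ` L_lattice) = \<Lambda>" unfolding \<Lambda>(1) root_map_L[symmetric] image_image hS ..
  moreover have "S' ` L_lattice \<subseteq> L_lattice"
  proof -
    have "root_map_inv ` root_map ` S' ` L_lattice \<subseteq> root_map_inv ` root_map ` L_lattice" unfolding im root_map_L using \<Lambda>(2) by (rule image_mono)
    then show ?thesis by (simp add: image_image root_map_inv_root_map)
  qed
  ultimately show "\<exists>\<Lambda>'. ssl L_lattice \<Lambda>' \<and> \<Lambda> = root_map ` \<Lambda>'"
    using sim unfolding ssl_def by (intro exI[of _ "S' ` L_lattice"]) auto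
next
  assume "\<exists>\<Lambda>'. ssl L_lattice \<Lambda>' \<and> \<Lambda> = root_map ` \<Lambda>'"
  then obtain S c where S: "linear S" "c > 0" "\<And>u v. S u \<bullet> S v = c * (u \<bullet> v)"
    and \<Lambda>: "\<Lambda> = root_map ` S ` L_lattice" "S ` L_lattice \<subseteq> L_lattice"
    unfolding ssl_def similarity_on_def by (auto simp: L_lattice_eq span_Fix)
  define S' where "S' = root_map \<circ> S \<circ> root_map_inv"
  have hS: "S' (root_map u) = root_map (S u)" for u by (simp add: S'_def root_map_inv_root_map)
  have "linear S'" unfolding S'_def by (intro linear_compose linear_root_map linear_root_map_inv S)
  moreover have "S' u \<bullet> S' v = c * (u \<bullet> v)" if "u \<in> range root_map" "v \<in> range root_map" for u v
    using that S(3) by (auto simp: hS root_map_inner)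
  ultimately have "similarity_on (span A4) S'"
    unfolding similarity_on_def span_A4 using S(2) by (auto simp: hS)
  moreover have "\<Lambda> = S' ` A4" unfolding \<Lambda>(1) root_map_L[symmetric] image_image hS ..
  moreover have "\<Lambda> \<subseteq> A4" unfolding \<Lambda>(1) root_map_L[symmetric] using \<Lambda>(2) by (rule image_mono)
  ultimately show "ssl A4 \<Lambda>" unfolding ssl_def by blast
qed

section \<open>Counting ideals of the quadratic field by their norm\<close>

definition reps_of_norm :: "nat \<Rightarrow> zt set" where "reps_of_norm m = {c \<in> reps. nat \<bar>nz c\<bar> = m}"

definition chi_int :: "nat \<Rightarrow> int" where
  "chi_int n = (if n mod 5 = 0 then 0 else if n mod 5 \<in> {1, 4} then 1 else -1)"

definition chi_sum :: "nat \<Rightarrow> int" where "chi_sum m = (\<Sum>d | d dvd m. chi_int d)"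

lemma chi_int_mult: "chi_int (m * n) = chi_int m * chi_int n"
proof -
  define f :: "nat \<Rightarrow> int" where "f k = (if k = 0 then 0 else if k \<in> {1, 4} then 1 else -1)" for k
  have f: "chi_int k = f (k mod 5)" for k by (simp add: chi_int_def f_def)
  have mult: "f (a * b mod 5) = f a * f b" if "a \<in> {0, 1, 2, 3, 4}" "b \<in> {0, 1, 2, 3, 4}" for a b
    using that by (auto simp: f_def)
  have "m mod 5 \<in> {0, 1, 2, 3, 4}" "n mod 5 \<in> {0, 1, 2, 3, 4}" by auto
  from mult[OF this] show ?thesis by (simp add: f mod_mult_eq)
qed

lemma chi_sum_1: "chi_sum 1 = 1"
  by (simp add: chi_sum_def chi_int_def)

text \<open>A divisor of \<open>p m\<close> that does not divide \<open>m\<close> is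
  \<open>p\<close> times a divisor of \<open>m\<close>.\<close>

lemma chi_sum_prime_mult:
  assumes p: "prime p" and m: "m > 0"
  shows "chi_sum (p * m) = chi_sum m + chi_int p * (chi_sum m - (if p dvd m then chi_sum (m div p) else 0))"
proof -
  have p0: "p > 0" using p by (rule prime_gt_0_nat)
  define E where "E = {d. d dvd m \<and> \<not> p * d dvd m}"
  have fin: "finite {d. d dvd m}" using m by simp
  then have finE: "finite E" unfolding E_def by (rule finite_subset[rotated]) auto
  have "{d. d dvd p * m} = {d. d dvd m} \<union> (*) p ` E"
  proof (intro equalityI subsetI)
    fix d assume d: "d \<in> {d. d dvd p * m}"
    show "d \<in> {d. d dvd m} \<union> (*) p ` E"
    proof (cases "d dvd m")
      case False
      have "p dvd d"
      proof (rule ccontr)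
        assume "\<not> p dvd d"
        then have "coprime d p" using p by (metis coprime_commute prime_imp_coprime_nat)
        then show False using d False by (simp add: coprime_dvd_mult_right_iff)
      qed
      then obtain k where k: "d = p * k" by (rule dvdE)
      then have "k \<in> E" using d False p0 by (simp add: E_def)
      then show ?thesis using k by blast
    qed (use d in simp)
  qed (auto simp: E_def)
  moreover have "{d. d dvd m} \<inter> (*) p ` E = {}" by (auto simp: E_def)
  moreover have "inj_on ((*) p) E" using p0 by (simp add: inj_on_def)
  ultimately have 1: "chi_sum (p * m) = chi_sum m + chi_int p * (\<Sum>d\<in>E. chi_int d)"
    using fin finE by (simp add: chi_sum_def sum.union_disjoint sum.reindex chi_int_mult sum_distrib_left)
  have "chi_sum m = (\<Sum>d\<in>{d. p * d dvd m} \<union> E. chi_int d)"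
    unfolding chi_sum_def by (rule sum.cong) (auto simp: E_def dest: dvd_mult_right)
  also have "\<dots> = (\<Sum>d | p * d dvd m. chi_int d) + (\<Sum>d\<in>E. chi_int d)"
  proof (rule sum.union_disjoint)
    show "finite {d. p * d dvd m}" using fin by (rule finite_subset[rotated]) (auto dest: dvd_mult_right)
  qed (use finE in \<open>auto simp: E_def\<close>)
  also have "(\<Sum>d | p * d dvd m. chi_int d) = (if p dvd m then chi_sum (m div p) else 0)"
  proof (cases "p dvd m")
    case True
    then have "{d. p * d dvd m} = {d. d dvd m div p}" using p0 by (auto elim!: dvdE)
    then show ?thesis using True by (simp add: chi_sum_def)
  next
    case False
    then have "{d. p * d dvd m} = {}" by (auto dest: dvd_mult_left)
    then show ?thesis using False by simp
  qed
  finally show ?thesis unfolding 1 by simp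
qed

lemma reps_of_norm_nz: "c \<in> reps_of_norm m \<Longrightarrow> c \<noteq> 0" by (auto simp: reps_of_norm_def reps_iff)

lemma reps_of_norm_dvd: "c \<in> reps_of_norm m \<Longrightarrow> c dvd of_nat m"
proof -
  assume "c \<in> reps_of_norm m"
  then have "int m = \<bar>nz c\<bar>" by (auto simp: reps_of_norm_def)
  then have "(of_nat m :: zt) = of_int \<bar>nz c\<bar>" by (metis of_int_of_nat_eq)
  moreover have "c dvd of_int (nz c)" by (simp add: nz_eq)
  then have "c dvd of_int \<bar>nz c\<bar>" by (simp add: abs_if)
  ultimately show ?thesis by simp
qed

lemma finite_reps_of_norm: "finite (reps_of_norm m)"
proof (cases "m = 0")
  case True
  then have "reps_of_norm m = {}" by (auto simp: reps_of_norm_def reps_iff)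
  then show ?thesis by simp
next
  case False
  then have "finite (divs (of_nat m))" by (intro finite_divs) simp
  moreover have "reps_of_norm m \<subseteq> divs (of_nat m)" using reps_of_norm_dvd by (auto simp: divs_def) (auto simp: reps_of_norm_def)
  ultimately show ?thesis by (rule finite_subset[rotated])
qed

lemma card_reps_of_norm_1: "card (reps_of_norm 1) = 1"
proof -
  have "reps_of_norm 1 = {rep 1}"
  proof (intro equalityI subsetI)
    fix c assume c: "c \<in> reps_of_norm 1"
    then have "\<bar>nz c\<bar> = 1" by (auto simp: reps_of_norm_def)
    then have "c \<sim> 1" by (simp add: zt_unit_iff)
    then show "c \<in> {rep 1}" using c by (metis (no_types, lifting) reps_of_norm_def reps_iff mem_Collect_eq rep_eq_iff singletonI)
  next
    fix c assume "c \<in> {rep 1}"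
    then show "c \<in> reps_of_norm 1" using assoc_abs_nz[OF rep_assoc[of 1]] by (simp add: reps_of_norm_def rep_in_reps)
  qed
  then show ?thesis by simp
qed

lemma abs_nz_rep [simp]: "\<bar>nz (rep x)\<bar> = \<bar>nz x\<bar>" by (rule assoc_abs_nz[OF rep_assoc])

lemma dvd_rep_iff [simp]: "x dvd rep y \<longleftrightarrow> x dvd y"
  using rep_assoc[of y] unfolding assoc_def by (metis dvd_trans)

lemma card_reps_of_norm_multiples:
  assumes x: "x \<noteq> 0"
  shows "card {c \<in> reps_of_norm (nat \<bar>nz x\<bar> * m). x dvd c} = card (reps_of_norm m)"
proof -
  have "bij_betw (\<lambda>c. rep (x * c)) (reps_of_norm m) {c \<in> reps_of_norm (nat \<bar>nz x\<bar> * m). x dvd c}"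
    unfolding bij_betw_def
  proof
    show "inj_on (\<lambda>c. rep (x * c)) (reps_of_norm m)"
      by (rule inj_onI) (use x in \<open>auto simp: rep_eq_iff assoc_mult_cancel reps_of_norm_def intro: reps_eqI\<close>)
    show "(\<lambda>c. rep (x * c)) ` reps_of_norm m = {c \<in> reps_of_norm (nat \<bar>nz x\<bar> * m). x dvd c}"
    proof (intro equalityI subsetI)
      fix c assume "c \<in> (\<lambda>c. rep (x * c)) ` reps_of_norm m"
      then obtain d where d: "d \<in> reps_of_norm m" "c = rep (x * d)" by blast
      then show "c \<in> {c \<in> reps_of_norm (nat \<bar>nz x\<bar> * m). x dvd c}"
        using x reps_of_norm_nz[OF d(1)] by (auto simp: reps_of_norm_def rep_in_reps nz_mult abs_mult nat_mult_distrib)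
    next
      fix c assume c: "c \<in> {c \<in> reps_of_norm (nat \<bar>nz x\<bar> * m). x dvd c}"
      then obtain d where d: "c = x * d" by (auto elim: dvdE)
      have "c \<noteq> 0" using c reps_of_norm_nz by blast
      then have d0: "d \<noteq> 0" using d by auto
      have "nat \<bar>nz x\<bar> * nat \<bar>nz d\<bar> = nat \<bar>nz x\<bar> * m"
        using c by (simp add: reps_of_norm_def d nz_mult abs_mult nat_mult_distrib)
      then have "nat \<bar>nz d\<bar> = m" using x by simp
      then have "rep d \<in> reps_of_norm m" using d0 by (simp add: reps_of_norm_def rep_in_reps)
      moreover have "x * rep d \<sim> c" unfolding d by (intro assoc_mult) auto
      then have "c = rep (x * rep d)" using c by (metis (no_types, lifting) reps_of_norm_def reps_iff mem_Collect_eq rep_eq_iff)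
      ultimately show "c \<in> (\<lambda>c. rep (x * c)) ` reps_of_norm m" by blast
    qed
  qed
  then show ?thesis by (rule bij_betw_same_card[symmetric])
qed

lemma card_reps_of_norm_nat_multiples:
  assumes p: "prime p" and m: "m > 0"
  shows "card {c \<in> reps_of_norm (p * m). of_nat p dvd c} = (if p dvd m then card (reps_of_norm (m div p)) else 0)"
proof -
  have p0: "p > 0" using p by (rule prime_gt_0_nat)
  have np: "nat \<bar>nz (of_nat p)\<bar> = p * p"
    using nz_simps(3)[of "int p"] by (simp add: power2_eq_square nat_mult_distrib)
  show ?thesis
  proof (cases "p dvd m")
    case True
    then have "p * m = nat \<bar>nz (of_nat p)\<bar> * (m div p)" unfolding np by auto
    then show ?thesis using True card_reps_of_norm_multiples[of "of_nat p" "m div p"] p0 by simp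
  next
    case False
    have "\<not> (of_nat p :: zt) dvd c" if c: "c \<in> reps_of_norm (p * m)" for c
    proof
      assume "(of_nat p :: zt) dvd c"
      then obtain d where "c = of_nat p * d" by (rule dvdE)
      then have "p * m = p * p * nat \<bar>nz d\<bar>"
        using c np unfolding reps_of_norm_def by (simp only: nz_mult abs_mult nat_mult_distrib abs_ge_zero mem_Collect_eq)
      then have "m = p * nat \<bar>nz d\<bar>" using p0 by (simp only: mult.assoc) simp
      then show False using False by simp
    qed
    then have none: "{c \<in> reps_of_norm (p * m). of_nat p dvd c} = {}" by blast
    show ?thesis unfolding none using False by simp
  qed
qed

text \<open>A prime element \<open>x\<close> above \<open>p\<close> divides the norm of
  \<open>c\<close>, hence \<open>c\<close> or its Galois conjugate.\<close>

lemma reps_of_norm_prime_dvd: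
  assumes "c \<in> reps_of_norm (p * m)" "x dvd of_nat p" "prime_elem x"
  shows "x dvd c \<or> cj x dvd c"
proof -
  have "int (p * m) = \<bar>nz c\<bar>" using assms(1) 
  proof -
    have "nat \<bar>nz c\<bar> = p * m" using assms(1) by (simp add: reps_of_norm_def)
    then have "int (nat \<bar>nz c\<bar>) = int (p * m)" by (rule arg_cong)
    then show ?thesis by simp
  qed
  then have "of_int \<bar>nz c\<bar> = (of_nat (p * m) :: zt)" by (metis of_int_of_nat_eq)
  then have "x dvd of_int \<bar>nz c\<bar>" using assms(2) by simp
  then have "x dvd c * cj c" by (simp add: nz_eq[symmetric] abs_if split: if_splits)
  then have "x dvd c \<or> x dvd cj c" using prime_elem_dvd_multD[OF assms(3)] by blast
  moreover have "cj x dvd c" if d: "x dvd cj c"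
  proof -
    obtain k where "cj c = x * k" using d by (rule dvdE)
    then have "c = cj x * cj k" by (metis cj_simps(6,10))
    then show ?thesis by simp
  qed
  ultimately show ?thesis by blast
qed

lemma prime_elem_of_prime_norm:
  assumes "prime p" "nat \<bar>nz x\<bar> = p"
  shows "prime_elem x"
proof (rule zt_irreducible_imp_prime, rule irreducibleI)
  show "x \<noteq> 0" using assms by auto
  show "\<not> x dvd 1" using assms prime_gt_1_nat[OF assms(1)] by (auto simp: zt_unit_iff)
  fix a b assume "x = a * b"
  then have "p = nat \<bar>nz a\<bar> * nat \<bar>nz b\<bar>" using assms(2) by (simp add: nz_mult abs_mult nat_mult_distrib)
  then have "nat \<bar>nz a\<bar> = 1 \<or> nat \<bar>nz b\<bar> = 1" using assms(1) by (metis prime_product)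
  then have "\<bar>nz a\<bar> = 1 \<or> \<bar>nz b\<bar> = 1" by linarith
  then show "a dvd 1 \<or> b dvd 1" by (simp add: zt_unit_iff)
qed

subsection \<open>Decomposition of rational primes\<close>

lemma prime_square_factor_nat:
  assumes "prime (p::nat)" "p * p = a * b" "a \<noteq> 1" "b \<noteq> 1"
  shows "a = p"
proof -
  have "a dvd p ^ 2" using assms(2) by (simp add: power2_eq_square)
  then obtain i where i: "i \<le> 2" "a = p ^ i" using divides_primepow_nat[OF assms(1)] by blast
  have "i \<noteq> 0" using i assms(3) by auto
  moreover have "i \<noteq> 2"
  proof
    assume "i = 2"
    then have "p * p = (p * p) * b" using assms(2) i by (simp add: power2_eq_square)
    then show False using assms(4) prime_gt_0_nat[OF assms(1)] by simp
  qed
  ultimately show ?thesis using i by (cases "i = 1") auto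
qed

text \<open>Modulo \<open>5\<close> the form \<open>a\<^sup>2 + a b - b\<^sup>2\<close> is the
  square of \<open>a + 3 b\<close>, and so \<open>\<plusminus> 2\<close> is not a norm modulo
  \<open>5\<close>.\<close>

lemma nz_mod_5: "nz x mod 5 \<in> {0, 1, 4}"
proof -
  define a where "a = rat_part x + 3 * tau_part x"
  have "nz x = a * a + 5 * (- rat_part x * tau_part x - 2 * tau_part x * tau_part x)"
    by (simp add: nz_def a_def power2_eq_square algebra_simps)
  then have "nz x mod 5 = (a * a) mod 5" by (metis mod_mult_self2)
  then have "nz x mod 5 = (a mod 5) * (a mod 5) mod 5" by (simp add: mod_mult_eq)
  moreover have "a mod 5 \<in> {0, 1, 2, 3, 4}" by auto
  ultimately show ?thesis by auto
qed

lemma inert_prime: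
  assumes p: "prime p" and "p mod 5 = 2 \<or> p mod 5 = 3"
  shows "prime_elem (of_nat p :: zt)"
proof (rule zt_irreducible_imp_prime, rule irreducibleI)
  have np: "\<bar>nz (of_nat p)\<bar> = int p * int p"
    using nz_simps(3)[of "int p"] by (simp add: power2_eq_square)
  show "(of_nat p :: zt) \<noteq> 0" using p by auto
  show "\<not> (of_nat p :: zt) dvd 1" using prime_gt_1_nat[OF p] by (simp add: zt_unit_iff np) (simp flip: of_nat_mult)
  fix a b :: zt assume ab: "of_nat p = a * b"
  show "a dvd 1 \<or> b dvd 1"
  proof (rule ccontr)
    assume n: "\<not> (a dvd 1 \<or> b dvd 1)"
    have "int p * int p = \<bar>nz a\<bar> * \<bar>nz b\<bar>" unfolding np[symmetric] ab nz_mult abs_mult ..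
    then have "p * p = nat \<bar>nz a\<bar> * nat \<bar>nz b\<bar>" by (metis nat_abs_mult_distrib nat_int abs_abs abs_mult of_nat_mult)
    moreover have "nat \<bar>nz a\<bar> \<noteq> 1" "nat \<bar>nz b\<bar> \<noteq> 1" using n by (auto simp: zt_unit_iff)
    ultimately have "nat \<bar>nz a\<bar> = p"
      by (rule prime_square_factor_nat[OF p])
    then have "nz a = int p \<or> nz a = - int p" by linarith
    moreover have "int p mod 5 = 2 \<or> int p mod 5 = 3" using assms(2) by (metis of_nat_mod of_nat_numeral)
    then have "(- int p) mod 5 = 3 \<or> (- int p) mod 5 = 2" by presburger
    ultimately show False using nz_mod_5[of a] \<open>int p mod 5 = 2 \<or> int p mod 5 = 3\<close> by auto
  qed
qed

text \<open>By quadratic reciprocity, as \<open>p\<close> is a square modulo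
  \<open>5\<close>.\<close>

lemma five_is_square_mod:
  assumes p: "prime p" and "p mod 5 = 1 \<or> p mod 5 = 4"
  shows "\<exists>x::int. int p dvd x\<^sup>2 - 5"
proof -
  have "p \<noteq> 2" "p \<noteq> 5" using assms(2) by auto
  then have p2: "2 < p" "p \<noteq> 5" using prime_gt_1_nat[OF p] by linarith+
  have "Legendre (int p) 5 * Legendre 5 (int p) = (-1) ^ ((p - 1) div 2 * ((5 - 1) div 2))"
    using Quadratic_Reciprocity[of p 5] p p2 by simp
  also have "(5 - 1) div 2 = (2::nat)" by simp
  finally have LL: "Legendre (int p) 5 * Legendre 5 (int p) = 1" by simp
  have "QuadRes 5 (int p)"
  proof -
    have "int p mod 5 = 1 \<or> int p mod 5 = 4" using assms(2) by (metis of_nat_mod of_nat_numeral of_nat_1)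
    then have "[1\<^sup>2 = int p] (mod 5) \<or> [2\<^sup>2 = int p] (mod 5)" by (auto simp: cong_def)
    then show ?thesis unfolding QuadRes_def by blast
  qed
  then have "Legendre (int p) 5 \<in> {0, 1}" by (simp add: Legendre_def)
  then have "Legendre 5 (int p) = 1" using LL by auto
  then have "QuadRes (int p) 5" by (auto simp: Legendre_def split: if_splits)
  then obtain x where "[x\<^sup>2 = 5] (mod int p)" by (auto simp: QuadRes_def)
  then show ?thesis by (auto simp: cong_iff_dvd_diff)
qed

text \<open>As \<open>p\<close> divides \<open>y\<^sup>2 - 5 = (y + \<surd>5) (y -
  \<surd>5)\<close> but neither factor, it is not prime in \<open>\<int>[\<tau>]\<close>, and any
  proper factor of it has norm \<open>\<plusminus> p\<close>.\<close>

lemma split_prime: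
  assumes p: "prime p" and m5: "p mod 5 = 1 \<or> p mod 5 = 4"
  shows "\<exists>x. nat \<bar>nz x\<bar> = p \<and> \<not> x dvd cj x"
proof -
  have "p \<noteq> 2" "p \<noteq> 5" using m5 by auto
  then have p2: "2 < p" "p \<noteq> 5" using prime_gt_1_nat[OF p] by linarith+
  obtain y :: int where y: "int p dvd y\<^sup>2 - 5" using five_is_square_mod[OF assms] by blast
  have np: "\<bar>nz (of_nat p)\<bar> = int p * int p"
    using nz_simps(3)[of "int p"] by (simp add: power2_eq_square)
  have dv: "(of_nat p :: zt) dvd z \<longleftrightarrow> int p dvd rat_part z \<and> int p dvd tau_part z" for z
  proof
    assume "int p dvd rat_part z \<and> int p dvd tau_part z"
    then obtain k l where "rat_part z = int p * k" "tau_part z = int p * l" by (auto elim!: dvdE)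
    then have "z = of_nat p * ZT k l" by (simp add: zt_eq_iff)
    then show "(of_nat p :: zt) dvd z" by simp
  qed (auto elim!: dvdE)
  have "\<not> prime_elem (of_nat p :: zt)"
  proof
    assume pe: "prime_elem (of_nat p :: zt)"
    have "(ZT (y + 1) (- 2)) * (ZT (y - 1) 2) = of_int (y\<^sup>2 - 5)"
      by (simp add: zt_eq_iff power2_eq_square algebra_simps)
    moreover have "(of_nat p :: zt) dvd of_int (y\<^sup>2 - 5)" using y unfolding dv zt_of_int by simp
    ultimately have "(of_nat p :: zt) dvd ZT (y + 1) (- 2) \<or> (of_nat p :: zt) dvd ZT (y - 1) 2"
      using prime_elem_dvd_multD[OF pe] by metis
    then have "int p dvd 2" by (auto simp: dv)
    then show False using p2 zdvd_imp_le[of "int p" 2] by simp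
  qed
  then have "\<not> irreducible (of_nat p :: zt)" using zt_irreducible_imp_prime by blast
  moreover have "(of_nat p :: zt) \<noteq> 0" using p by auto
  moreover have "\<not> (of_nat p :: zt) dvd 1"
    using prime_gt_1_nat[OF p] by (simp add: zt_unit_iff np) (simp flip: of_nat_mult)
  ultimately obtain a b :: zt where ab: "of_nat p = a * b" "\<not> a dvd 1" "\<not> b dvd 1"
    unfolding irreducible_def by blast
  have "int p * int p = \<bar>nz a\<bar> * \<bar>nz b\<bar>" unfolding np[symmetric] ab nz_mult abs_mult ..
  then have "p * p = nat \<bar>nz a\<bar> * nat \<bar>nz b\<bar>" by (metis nat_abs_mult_distrib nat_int abs_abs abs_mult of_nat_mult)
  moreover have "nat \<bar>nz a\<bar> \<noteq> 1" "nat \<bar>nz b\<bar> \<noteq> 1" using ab by (auto simp: zt_unit_iff)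
  ultimately have na: "nat \<bar>nz a\<bar> = p" by (rule prime_square_factor_nat[OF p])
  have "\<not> a dvd cj a"
  proof
    \<comment> \<open>A common divisor of \<open>a\<close> and its conjugate divides the multiple \<open>a - a' = tau_part a * sqrt5\<close>.\<close>
    assume "a dvd cj a"
    then have "a dvd a - cj a" by simp
    also have "a - cj a = of_int (tau_part a) * sqrt5" by (simp add: zt_eq_iff sqrt5_def)
    finally have "nz a dvd nz (of_int (tau_part a) * sqrt5)" by (metis dvd_def nz_mult)
    then have "nz a dvd (tau_part a)\<^sup>2 * (- 5)" by (simp add: nz_mult) (simp add: nz_def sqrt5_def)
    moreover have "int p dvd nz a" using na by (metis abs_dvd_iff dvd_refl nat_0_le abs_ge_zero)
    ultimately have "int p dvd (tau_part a)\<^sup>2 * (- 5)" using dvd_trans by blast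
    moreover have pr: "prime (int p)" using p by simp
    moreover have "\<not> int p dvd - 5"
    proof
      assume "int p dvd - 5"
      then have "p dvd 5" by (metis dvd_minus_iff int_dvd_int_iff of_nat_numeral)
      moreover have "prime (5::nat)" by simp
      ultimately show False using p p2(2) primes_dvd_imp_eq by blast
    qed
    ultimately have "int p dvd (tau_part a)\<^sup>2" by (metis prime_dvd_multD)
    then have t: "int p dvd tau_part a" using pr prime_dvd_power by blast
    have "int p dvd nz a - rat_part a * tau_part a + (tau_part a)\<^sup>2"
      using \<open>int p dvd nz a\<close> t by (simp add: power2_eq_square)
    then have "int p dvd (rat_part a)\<^sup>2" by (simp add: nz_def)
    then have "int p dvd rat_part a" using pr prime_dvd_power by blast
    then have "(of_nat p :: zt) dvd a" using t by (simp add: dv)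
    then have "nz (of_nat p) dvd nz a" by (metis dvd_def nz_mult)
    then have "\<bar>nz (of_nat p)\<bar> \<le> \<bar>nz a\<bar>" using na p2 by (intro dvd_imp_le_int) auto
    then have "int p * int p \<le> int p * 1" unfolding np using na by simp
    then show False using p2 by (simp only: mult_le_cancel_left) simp
  qed
  then show ?thesis using na by blast
qed

text \<open>The ideals of norm \<open>p m\<close> are divisible by a prime ideal above
  \<open>p\<close>. If \<open>p\<close> is ramified or inert, there is only one such prime ideal,
  and dividing by it is a bijection. If \<open>p\<close> splits, inclusion and exclusion over the
  two primes above \<open>p\<close> applies, whose intersection consists of the ideals divisible
  by \<open>p\<close>. The character \<open>\<chi>\<close> unifies the three cases into the
  recursion that the sum of \<open>\<chi>\<close> over the divisors satisfies as well.\<close>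

lemma card_reps_of_norm_prime_mult:
  assumes p: "prime p" and m: "m > 0"
  shows "int (card (reps_of_norm (p * m))) = int (card (reps_of_norm m)) +
    chi_int p * (int (card (reps_of_norm m)) - (if p dvd m then int (card (reps_of_norm (m div p))) else 0))"
proof -
  have p0: "p > 0" using p by (rule prime_gt_0_nat)
  have "p mod 5 < 5" by simp
  then consider "p mod 5 = 0" | "p mod 5 = 2 \<or> p mod 5 = 3" | "p mod 5 = 1 \<or> p mod 5 = 4" by linarith
  then show ?thesis
  proof cases
    case 1
    then have "5 dvd p" by auto
    moreover have "prime (5::nat)" by simp
    ultimately have p5: "p = 5" using p primes_dvd_imp_eq by blast
    have n5: "nat \<bar>nz sqrt5\<bar> = 5" by (simp add: nz_def sqrt5_def)
    have pe: "prime_elem sqrt5" by (rule prime_elem_of_prime_norm[OF _ n5]) simp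
    have "(of_nat 5 :: zt) = sqrt5 * sqrt5" by (simp add: sqrt5_def zt_eq_iff)
    then have dv: "sqrt5 dvd of_nat 5" by (rule dvdI)
    have "cj sqrt5 = - sqrt5" by (simp add: sqrt5_def zt_eq_iff)
    then have "sqrt5 dvd c" if "c \<in> reps_of_norm (5 * m)" for c
      using reps_of_norm_prime_dvd[OF that dv pe] by auto
    then have "{c \<in> reps_of_norm (5 * m). sqrt5 dvd c} = reps_of_norm (5 * m)" by blast
    then have "card (reps_of_norm (5 * m)) = card (reps_of_norm m)"
      using card_reps_of_norm_multiples[of sqrt5 m] n5 pe by (auto simp: prime_elem_def)
    then show ?thesis by (simp add: p5 chi_int_def)
  next
    case 2
    then have pe: "prime_elem (of_nat p :: zt)" using inert_prime p by blast
    have "(of_nat p :: zt) dvd c" if "c \<in> reps_of_norm (p * m)" for c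
      using reps_of_norm_prime_dvd[OF that dvd_refl pe] by simp
    then have "{c \<in> reps_of_norm (p * m). of_nat p dvd c} = reps_of_norm (p * m)" by blast
    then have "card (reps_of_norm (p * m)) = (if p dvd m then card (reps_of_norm (m div p)) else 0)"
      using card_reps_of_norm_nat_multiples[OF p m] by simp
    moreover have "chi_int p = -1" using 2 by (auto simp: chi_int_def)
    ultimately show ?thesis by simp
  next
    case 3
    then obtain x where x: "nat \<bar>nz x\<bar> = p" "\<not> x dvd cj x" using split_prime p by blast
    have x': "nat \<bar>nz (cj x)\<bar> = p" using x by simp
    have pe: "prime_elem x" "prime_elem (cj x)"
      using prime_elem_of_prime_norm p x(1) x' by blast+
    have px: "(of_nat p :: zt) \<sim> x * cj x"
    proof -
      have "int p = \<bar>nz x\<bar>" using x(1) by auto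
      then have "of_nat p = (of_int \<bar>nz x\<bar> :: zt)" by (metis of_int_of_nat_eq)
      then show ?thesis by (simp add: nz_eq[symmetric] assoc_def abs_if)
    qed
    define A B where "A = {c \<in> reps_of_norm (p * m). x dvd c}" and "B = {c \<in> reps_of_norm (p * m). cj x dvd c}"
    have "x dvd of_nat p" using px by (auto simp: assoc_def intro: dvd_trans)
    then have "reps_of_norm (p * m) = A \<union> B"
      using reps_of_norm_prime_dvd[OF _ _ pe(1)] by (auto simp: A_def B_def)
    moreover have "A \<inter> B = {c \<in> reps_of_norm (p * m). of_nat p dvd c}"
    proof -
      have "x dvd c \<and> cj x dvd c \<longleftrightarrow> of_nat p dvd c" for c
      proof
        assume c: "x dvd c \<and> cj x dvd c"
        then obtain k where k: "c = cj x * k" by (auto elim: dvdE)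
        then have "x dvd k" using c prime_elem_dvd_multD[OF pe(1)] x(2) by blast
        then have "x * cj x dvd c" unfolding k by (metis mult.commute mult_dvd_mono dvd_refl)
        then show "of_nat p dvd c" using px by (auto simp: assoc_def intro: dvd_trans)
      next
        assume "of_nat p dvd c"
        then have "x * cj x dvd c" using px by (auto simp: assoc_def intro: dvd_trans)
        then show "x dvd c \<and> cj x dvd c" by (metis dvd_mult_left dvd_mult_right)
      qed
      then show ?thesis by (auto simp: A_def B_def)
    qed
    moreover have "card A = card (reps_of_norm m)" "card B = card (reps_of_norm m)"
      using card_reps_of_norm_multiples[of x m] card_reps_of_norm_multiples[of "cj x" m] pe x(1) x'
      by (auto simp: A_def B_def prime_elem_def)
    moreover have "finite A" "finite B" using finite_reps_of_norm by (simp_all add: A_def B_def)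
    ultimately have "card (reps_of_norm (p * m)) + (if p dvd m then card (reps_of_norm (m div p)) else 0) = card (reps_of_norm m) + card (reps_of_norm m)"
      using card_Un_Int[of A B] card_reps_of_norm_nat_multiples[OF p m] by simp
    then have "int (card (reps_of_norm (p * m))) + (if p dvd m then int (card (reps_of_norm (m div p))) else 0) = 2 * int (card (reps_of_norm m))"
      by (auto split: if_splits)
    moreover have "chi_int p = 1" using 3 by (auto simp: chi_int_def)
    ultimately show ?thesis by auto
  qed
qed

theorem card_reps_of_norm: "m > 0 \<Longrightarrow> int (card (reps_of_norm m)) = chi_sum m"
proof (induction m rule: less_induct)
  case (less m)
  show ?case
  proof (cases "m = 1")
    case False
    then obtain p where p: "prime p" "p dvd m" using prime_factor_nat by blast
    then obtain k where k: "m = p * k" by (auto elim: dvdE)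
    have k0: "k > 0" "k < m" using less.prems prime_gt_1_nat[OF p(1)] by (auto simp: k)
    have "int (card (reps_of_norm (k div p))) = chi_sum (k div p)" if "p dvd k"
    proof (rule less.IH)
      have "k div p \<le> k" by simp
      then show "k div p < m" using k0(2) by linarith
      show "k div p > 0" using that k0(1) prime_gt_0_nat[OF p(1)] by (simp add: div_greater_zero_iff dvd_imp_le)
    qed
    moreover have "int (card (reps_of_norm k)) = chi_sum k" using less.IH k0 by simp
    ultimately show ?thesis
      unfolding k by (simp add: card_reps_of_norm_prime_mult[OF p(1) k0(1)] chi_sum_prime_mult[OF p(1) k0(1)])
  qed (use card_reps_of_norm_1 chi_sum_1 in simp)
qed

section \<open>Absolutely convergent sums\<close>

lemma infsum_times:
  fixes f :: "'a \<Rightarrow> complex" and g :: "'b \<Rightarrow> complex"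
  assumes f: "f summable_on A" and g: "g summable_on B"
  shows "(\<lambda>(a, b). f a * g b) summable_on (A \<times> B)"
    and "infsum (\<lambda>(a, b). f a * g b) (A \<times> B) = infsum f A * infsum g B"
proof -
  have fa: "Infinite_Sum.abs_summable_on f A" and ga: "Infinite_Sum.abs_summable_on g B"
    using f g summable_on_iff_abs_summable_on_complex by blast+
  have "Infinite_Sum.abs_summable_on (\<lambda>(a, b). f a * g b) (A \<times> B)"
    unfolding Infinite_Sum.abs_summable_on_Sigma_iff
  proof (intro conjI ballI)
    fix a
    show "Infinite_Sum.abs_summable_on (\<lambda>b. (\<lambda>(a, b). f a * g b) (a, b)) B"
      using ga by (simp add: norm_mult summable_on_cmult_right)
    have "(\<lambda>a. norm (f a) * infsum (\<lambda>b. norm (g b)) B) summable_on A"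
      using fa by (rule summable_on_cmult_left)
    then show "Infinite_Sum.abs_summable_on (\<lambda>a. infsum (\<lambda>b. norm ((\<lambda>(a, b). f a * g b) (a, b))) B) A"
      by (simp add: norm_mult infsum_cmult_right' abs_mult infsum_nonneg)
  qed
  then show s: "(\<lambda>(a, b). f a * g b) summable_on (A \<times> B)"
    using summable_on_iff_abs_summable_on_complex by blast
  show "infsum (\<lambda>(a, b). f a * g b) (A \<times> B) = infsum f A * infsum g B"
    using infsum_Sigma_banach[OF s] by (simp add: infsum_cmult_right' infsum_cmult_left')
qed

text \<open>Absolute convergence, which is the same as summability for complex numbers, can be
  tested on the sums of the absolute values over the fibres.\<close>

lemma infsum_fibres:
  fixes F :: "'a \<Rightarrow> complex" and h :: "'a \<Rightarrow> 'b"
  assumes im: "\<And>x. x \<in> X \<Longrightarrow> h x \<in> C" and fin: "\<And>c. c \<in> C \<Longrightarrow> finite {x \<in> X. h x = c}"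
  shows "F summable_on X \<longleftrightarrow> (\<lambda>c. \<Sum>x | x \<in> X \<and> h x = c. norm (F x)) summable_on C"
    and "F summable_on X \<Longrightarrow> (\<lambda>c. \<Sum>x | x \<in> X \<and> h x = c. F x) summable_on C"
    and "F summable_on X \<Longrightarrow> infsum F X = infsum (\<lambda>c. \<Sum>x | x \<in> X \<and> h x = c. F x) C"
proof -
  let ?B = "\<lambda>c. {x. x \<in> X \<and> h x = c}"
  have bij: "bij_betw snd (Sigma C ?B) X"
    unfolding bij_betw_def inj_on_def using im by (auto simp: image_iff)
  have sumF: "F summable_on X \<longleftrightarrow> (\<lambda>p. F (snd p)) summable_on Sigma C ?B"
    using summable_on_reindex_bij_betw[OF bij, of F] by simp
  also have "\<dots> \<longleftrightarrow> Infinite_Sum.abs_summable_on (\<lambda>p. F (snd p)) (Sigma C ?B)"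
    by (rule summable_on_iff_abs_summable_on_complex)
  also have "\<dots> \<longleftrightarrow> Infinite_Sum.abs_summable_on (\<lambda>c. infsum (\<lambda>x. norm (F x)) (?B c)) C"
    unfolding Infinite_Sum.abs_summable_on_Sigma_iff using fin by auto
  also have "\<dots> \<longleftrightarrow> (\<lambda>c. \<Sum>x | x \<in> X \<and> h x = c. norm (F x)) summable_on C"
    by (rule summable_on_cong) (use fin in \<open>simp add: sum_nonneg\<close>)
  finally show eq: "F summable_on X \<longleftrightarrow> (\<lambda>c. \<Sum>x | x \<in> X \<and> h x = c. norm (F x)) summable_on C" .
  assume F: "F summable_on X"
  then have "(\<lambda>p. F (snd p)) summable_on Sigma C ?B" using sumF by simp
  from infsum_Sigma_banach[OF this]
  have "infsum F X = infsum (\<lambda>c. infsum F (?B c)) C"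
    using infsum_reindex_bij_betw[OF bij, of F] by simp
  also have "\<dots> = infsum (\<lambda>c. \<Sum>x | x \<in> X \<and> h x = c. F x) C"
    by (rule infsum_cong) (use fin in simp)
  finally show "infsum F X = infsum (\<lambda>c. \<Sum>x | x \<in> X \<and> h x = c. F x) C" .
  have "Infinite_Sum.abs_summable_on (\<lambda>c. \<Sum>x | x \<in> X \<and> h x = c. F x) C"
  proof (rule Infinite_Sum.abs_summable_on_comparison_test)
    show "Infinite_Sum.abs_summable_on (\<lambda>c. \<Sum>x | x \<in> X \<and> h x = c. norm (F x)) C"
      using eq F by (simp add: sum_nonneg)
    fix c show "norm (\<Sum>x | x \<in> X \<and> h x = c. F x) \<le> norm (\<Sum>x | x \<in> X \<and> h x = c. norm (F x))"
      using norm_sum[of F "{x. x \<in> X \<and> h x = c}"] by (simp add: sum_nonneg)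
  qed
  then show "(\<lambda>c. \<Sum>x | x \<in> X \<and> h x = c. F x) summable_on C"
    using summable_on_iff_abs_summable_on_complex by blast
qed

text \<open>The case in which the summand depends on the fibre only.\<close>

lemma infsum_constant_on_fibres:
  fixes g :: "'b \<Rightarrow> complex" and h :: "'a \<Rightarrow> 'b"
  assumes im: "\<And>x. x \<in> X \<Longrightarrow> h x \<in> C" and fin: "\<And>c. c \<in> C \<Longrightarrow> finite {x \<in> X. h x = c}"
  shows "(\<lambda>x. g (h x)) summable_on X \<longleftrightarrow> (\<lambda>c. of_nat (card {x \<in> X. h x = c}) * g c) summable_on C"
    and "infsum (\<lambda>x. g (h x)) X = infsum (\<lambda>c. of_nat (card {x \<in> X. h x = c}) * g c) C"
proof -
  have "(\<lambda>x. g (h x)) summable_on X \<longleftrightarrow> (\<lambda>c. \<Sum>x | x \<in> X \<and> h x = c. norm (g (h x))) summable_on C"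
    by (rule infsum_fibres(1)[OF im fin])
  also have "\<dots> \<longleftrightarrow> (\<lambda>c. norm (of_nat (card {x \<in> X. h x = c}) * g c)) summable_on C"
    by (rule summable_on_cong) (simp add: norm_mult)
  also have "\<dots> \<longleftrightarrow> (\<lambda>c. of_nat (card {x \<in> X. h x = c}) * g c) summable_on C"
    by (rule summable_on_iff_abs_summable_on_complex[symmetric])
  finally show eq: "(\<lambda>x. g (h x)) summable_on X \<longleftrightarrow>
    (\<lambda>c. of_nat (card {x \<in> X. h x = c}) * g c) summable_on C" .
  show "infsum (\<lambda>x. g (h x)) X = infsum (\<lambda>c. of_nat (card {x \<in> X. h x = c}) * g c) C"
  proof (cases "(\<lambda>x. g (h x)) summable_on X")
    case True
    have "infsum (\<lambda>x. g (h x)) X = infsum (\<lambda>c. \<Sum>x | x \<in> X \<and> h x = c. g (h x)) C"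
      by (rule infsum_fibres(3)[OF im fin True])
    also have "\<dots> = infsum (\<lambda>c. of_nat (card {x \<in> X. h x = c}) * g c) C"
      by (rule infsum_cong) simp
    finally show ?thesis .
  next
    case False
    with eq have "\<not> (\<lambda>c. of_nat (card {x \<in> X. h x = c}) * g c) summable_on C" by blast
    from infsum_not_exists[OF False] infsum_not_exists[OF this] show ?thesis by simp
  qed
qed

section \<open>Dirichlet series\<close>

definition dterm :: "complex \<Rightarrow> nat \<Rightarrow> complex" where "dterm s n = 1 / of_nat n powr s"

lemma dterm_mult: "dterm s (m * n) = dterm s m * dterm s n"
  by (simp add: dterm_def powr_times_real)

lemma dterm_power: "k > 0 \<Longrightarrow> dterm s (n ^ k) = dterm (of_nat k * s) n"
proof (induction k rule: nat_induct_non_zero)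
  case (Suc k)
  then show ?case by (simp add: dterm_mult) (simp add: dterm_def distrib_right powr_add)
qed simp

lemma dterm_shift: "n > 0 \<Longrightarrow> dterm (s - 1) n = of_nat n * dterm s n"
  by (simp add: dterm_def powr_diff)

lemma norm_dterm: "n > 0 \<Longrightarrow> norm (dterm s n) = real n powr (- Re s)"
  by (simp add: dterm_def norm_divide norm_powr_real_powr powr_minus_divide)

lemma dterm_bounded_summable:
  assumes "Re s > 1" "\<And>n. norm (a n) \<le> 1"
  shows "(\<lambda>n. a n * dterm s n) summable_on {1..}"
proof -
  have "(\<lambda>n. real n powr (- Re s)) summable_on UNIV"
    using assms(1) by (intro summable_nonneg_imp_summable_on) (auto simp: summable_real_powr_iff)
  then have "(\<lambda>n. real n powr (- Re s)) summable_on {1..}" by (rule summable_on_subset_banach) simp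
  moreover have "norm (real n powr (- Re s)) = real n powr (- Re s)" for n by simp
  ultimately have 1: "Infinite_Sum.abs_summable_on (\<lambda>n. real n powr (- Re s)) {1..}" by (simp only:)
  have "Infinite_Sum.abs_summable_on (\<lambda>n. a n * dterm s n) {1..}"
  proof (rule Infinite_Sum.abs_summable_on_comparison_test[OF 1])
    fix n :: nat assume "n \<in> {1..}"
    then have "norm (a n * dterm s n) = norm (a n) * real n powr (- Re s)" by (simp add: norm_mult norm_dterm)
    also have "\<dots> \<le> 1 * real n powr (- Re s)" using assms(2) by (intro mult_right_mono) auto
    finally show "norm (a n * dterm s n) \<le> norm (real n powr (- Re s))" by simp
  qed
  then show ?thesis using summable_on_iff_abs_summable_on_complex by blast
qed

lemma zeta_eq: "zeta s = infsum (dterm s) {1..}"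
  unfolding zeta_def dterm_def ..

lemma L_chi5_eq: "L_chi5 s = infsum (\<lambda>n. chi5 n * dterm s n) {1..}"
  by (simp add: L_chi5_def dterm_def)

lemma norm_chi5: "norm (chi5 n) \<le> 1"
  by (simp add: chi5_def)

lemma chi5_eq: "chi5 n = of_int (chi_int n)"
  by (simp add: chi5_def chi_int_def)

lemma dterm_summable: "Re s > 1 \<Longrightarrow> dterm s summable_on {1..}"
  using dterm_bounded_summable[of s "\<lambda>_. 1"] by simp

text \<open>The first term dominates: since \<open>n\<^sup>-\<^sup>4 \<le> n\<^sup>-\<^sup>2 /
  4\<close> for \<open>n \<ge> 2\<close>, the others add up to at most \<open>(\<pi>\<^sup>2 / 6 -
  1) / 4 < 1\<close>.\<close>

lemma Dirichlet_series_nonzero: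
  assumes s: "Re s > 4" and a: "\<And>n. norm (a n) \<le> 1" "a 1 = 1"
  shows "infsum (\<lambda>n. a n * dterm s n) {1..} \<noteq> 0"
proof -
  have "{1::nat..} = {1} \<union> {2..}" by auto
  moreover have sum: "(\<lambda>n. a n * dterm s n) summable_on {1..}" using s a by (intro dterm_bounded_summable) auto
  then have sum2: "(\<lambda>n. a n * dterm s n) summable_on {2..}" by (rule summable_on_subset_banach) auto
  ultimately have eq: "infsum (\<lambda>n. a n * dterm s n) {1..} = 1 + infsum (\<lambda>n. a n * dterm s n) {2..}"
    using infsum_Un_disjoint[of "\<lambda>n. a n * dterm s n" "{1}" "{2..}"] a(2) by (simp add: dterm_def)
  have sq: "((\<lambda>n. 1 / (real n)\<^sup>2) has_sum (pi\<^sup>2 / 6)) {1..}"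
  proof -
    have "((\<lambda>n. 1 / (real n + 1)\<^sup>2) has_sum (pi\<^sup>2 / 6)) UNIV"
      using inverse_squares_sums by (intro sums_nonneg_imp_has_sum) (simp_all add: add.commute)
    moreover have "bij_betw Suc UNIV {1..}"
      unfolding bij_betw_def by (auto simp: image_iff Suc_le_eq gr0_conv_Suc)
    ultimately show ?thesis
      using has_sum_reindex_bij_betw[of Suc UNIV "{1..}" "\<lambda>n. 1 / (real n)\<^sup>2" "pi\<^sup>2 / 6"] by (simp add: add.commute)
  qed
  have "(\<lambda>n. 1 / (real n)\<^sup>2) summable_on {1..}" using sq by (auto simp: summable_on_def)
  then have sq2: "(\<lambda>n. 1 / (real n)\<^sup>2) summable_on {2..}" by (rule summable_on_subset_banach) auto
  have "infsum (\<lambda>n. 1 / (real n)\<^sup>2) ({1} \<union> {2..}) = infsum (\<lambda>n. 1 / (real n)\<^sup>2) {1} + infsum (\<lambda>n. 1 / (real n)\<^sup>2) {2..}"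
    by (rule infsum_Un_disjoint) (use sq2 in auto)
  then have "pi\<^sup>2 / 6 = 1 + infsum (\<lambda>n. 1 / (real n)\<^sup>2) {2..}"
    using infsumI[OF sq] \<open>{1::nat..} = {1} \<union> {2..}\<close> by simp
  moreover have "pi\<^sup>2 < 4\<^sup>2" using pi_less_4 pi_gt_zero by (intro power_strict_mono) auto
  ultimately have tail: "infsum (\<lambda>n. 1 / (real n)\<^sup>2) {2..} < 2" by simp
  have le: "norm (a n * dterm s n) \<le> (1/4) * (1 / (real n)\<^sup>2)" if n: "n \<in> {2..}" for n
  proof -
    have "norm (a n * dterm s n) \<le> 1 * real n powr (- Re s)"
      unfolding norm_mult using a(1) n by (intro mult_mono) (auto simp: norm_dterm)
    also have "1 * real n powr (- Re s) \<le> real n powr (- 4)" using s n by (simp add: powr_mono)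
    also have "\<dots> = 1 / (real n) ^ 4" using n by (simp add: powr_minus_divide)
    also have "\<dots> = (1 / (real n)\<^sup>2) * (1 / (real n)\<^sup>2)" by (simp add: power2_eq_square power4_eq_xxxx)
    also have "\<dots> \<le> (1/4) * (1 / (real n)\<^sup>2)"
    proof (rule mult_right_mono)
      have "2\<^sup>2 \<le> (real n)\<^sup>2" using n by (intro power_mono) auto
      moreover have "(real n)\<^sup>2 > 0" using n by simp
      ultimately show "1 / (real n)\<^sup>2 \<le> 1/4" by (simp only: divide_le_eq) simp
    qed simp
    finally show ?thesis .
  qed
  have abs2: "Infinite_Sum.abs_summable_on (\<lambda>n. a n * dterm s n) {2..}"
    by (rule summable_on_iff_abs_summable_on_complex[THEN iffD1, OF sum2])
  have "norm (infsum (\<lambda>n. a n * dterm s n) {2..}) \<le> infsum (\<lambda>n. norm (a n * dterm s n)) {2..}"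
    by (rule norm_infsum_bound[OF abs2])
  also have "\<dots> \<le> infsum (\<lambda>n. (1/4) * (1 / (real n)\<^sup>2)) {2..}"
    by (rule infsum_mono[OF abs2 summable_on_cmult_right[OF sq2] le])
  also have "\<dots> = (1/4) * infsum (\<lambda>n. 1 / (real n)\<^sup>2) {2..}" by (rule infsum_cmult_right')
  also have "\<dots> < 1" using tail by simp
  finally have "norm (infsum (\<lambda>n. a n * dterm s n) {2..}) < 1" .
  then show ?thesis unfolding eq by (metis add_eq_0_iff less_irrefl norm_minus_cancel norm_one)
qed

lemma zeta_nonzero: "Re s > 4 \<Longrightarrow> zeta s \<noteq> 0"
  using Dirichlet_series_nonzero[of s "\<lambda>_. 1"] by (simp add: zeta_eq)

lemma L_chi5_nonzero: "Re s > 4 \<Longrightarrow> L_chi5 s \<noteq> 0"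
  using Dirichlet_series_nonzero[of s chi5] norm_chi5 by (simp add: L_chi5_eq chi5_def)

text \<open>The coefficients of the product \<open>\<zeta>(s) L(s, \<chi>)\<close> are the sums of \<open>\<chi>\<close> over the divisors, and these count the
  ideals of given norm.\<close>

lemma zeta_K_ideals:
  assumes s: "Re s > 1"
  shows "(\<lambda>c. dterm s (nat \<bar>nz c\<bar>)) summable_on reps"
    and "zeta_K s = infsum (\<lambda>c. dterm s (nat \<bar>nz c\<bar>)) reps"
proof -
  let ?X = "{1::nat..} \<times> {1::nat..}" and ?F = "\<lambda>(k, d). dterm s k * (chi5 d * dterm s d)" and ?h = "\<lambda>(k, d). k * d"
  have X: "?F summable_on ?X" "infsum ?F ?X = zeta_K s"
    using infsum_times[OF dterm_summable[OF s] dterm_bounded_summable[OF s norm_chi5]]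
    by (simp_all add: zeta_K_def zeta_eq L_chi5_eq)
  have snd: "bij_betw snd {x. x \<in> ?X \<and> ?h x = m} {d. d dvd m}" if m: "m \<in> {1..}" for m
    unfolding bij_betw_def
  proof
    show "inj_on snd {x. x \<in> ?X \<and> ?h x = m}" by (auto simp: inj_on_def)
    show "snd ` {x. x \<in> ?X \<and> ?h x = m} = {d. d dvd m}"
    proof (intro equalityI subsetI)
      fix d assume "d \<in> {d. d dvd m}"
      then obtain k where k: "m = d * k" by (auto elim: dvdE)
      then have "(k, d) \<in> {x. x \<in> ?X \<and> ?h x = m}" using m by (auto simp: Suc_le_eq)
      then show "d \<in> snd ` {x. x \<in> ?X \<and> ?h x = m}" by force
    qed auto
  qed
  have fin: "finite {x \<in> ?X. ?h x = m}" if m: "m \<in> {1..}" for m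
    using bij_betw_finite[OF snd[OF m]] m by (simp add: Suc_le_eq)
  have im: "?h x \<in> {1..}" if "x \<in> ?X" for x using that by (auto simp: Suc_le_eq)
  have fib: "(\<Sum>x | x \<in> ?X \<and> ?h x = m. ?F x) = of_nat (card (reps_of_norm m)) * dterm s m" if m: "m \<in> {1..}" for m
  proof -
    have "(\<Sum>x | x \<in> ?X \<and> ?h x = m. ?F x) = (\<Sum>x | x \<in> ?X \<and> ?h x = m. dterm s m * chi5 (snd x))"
      by (rule sum.cong) (auto simp: dterm_mult)
    also have "\<dots> = (\<Sum>d | d dvd m. dterm s m * chi5 d)"
      using sum.reindex_bij_betw[OF snd[OF m], of "\<lambda>d. dterm s m * chi5 d"] by simp
    also have "\<dots> = dterm s m * of_int (chi_sum m)" by (simp add: chi_sum_def sum_distrib_left chi5_eq)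
    also have "chi_sum m = int (card (reps_of_norm m))" using card_reps_of_norm m by simp
    finally show ?thesis by simp
  qed
  have sumD: "(\<lambda>m. of_nat (card (reps_of_norm m)) * dterm s m) summable_on {1..}"
    using infsum_fibres(2)[OF im fin X(1)] fib by (subst summable_on_cong[symmetric]) auto
  have eqD: "zeta_K s = infsum (\<lambda>m. of_nat (card (reps_of_norm m)) * dterm s m) {1..}"
    using infsum_fibres(3)[OF im fin X(1)] X(2) fib by (metis (no_types, lifting) infsum_cong)
  have im': "nat \<bar>nz c\<bar> \<in> {1..}" if "c \<in> reps" for c
  proof -
    have "nz c \<noteq> 0" using that by (simp add: reps_iff)
    then have "nat \<bar>nz c\<bar> \<noteq> 0" by linarith
    then show ?thesis unfolding atLeast_iff by linarith
  qed
  have fin': "finite {c \<in> reps. nat \<bar>nz c\<bar> = m}" for m using finite_reps_of_norm by (simp add: reps_of_norm_def)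
  show "(\<lambda>c. dterm s (nat \<bar>nz c\<bar>)) summable_on reps"
    using infsum_constant_on_fibres(1)[OF im' fin', of "dterm s"] sumD by (simp add: reps_of_norm_def)
  show "zeta_K s = infsum (\<lambda>c. dterm s (nat \<bar>nz c\<bar>)) reps"
    using infsum_constant_on_fibres(2)[OF im' fin', of "dterm s"] eqD by (simp add: reps_of_norm_def)
qed

section \<open>The zeta function of the icosian ring\<close>

definition gen :: "ico set \<Rightarrow> ico" where "gen J = (SOME p. J = rid p)"

lemma rid_gen [simp]: "rid (gen (rid p)) = rid p"
  unfolding gen_def by (rule someI2[of _ p]) auto

definition ideal_norm :: "ico set \<Rightarrow> nat" where "ideal_norm J = nat (anorm (gen J))"

lemma ideal_norm_rid: "ideal_norm (rid p) = nat (anorm p)"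
proof -
  have "\<bar>nz (nr (gen (rid p)))\<bar> = \<bar>nz (nr p)\<bar>" by (intro assoc_abs_nz rid_eq_imp_assoc) simp
  then have "\<bar>anorm (gen (rid p))\<bar> = \<bar>anorm p\<bar>" by (simp add: anorm_def)
  moreover have "anorm x \<ge> 0" for x using anorm_pos[of x] by (cases "x = 0") auto
  ultimately show ?thesis by (simp add: ideal_norm_def)
qed

definition nonzero_RI :: "ico set set" where "nonzero_RI = {J. RI J \<and> J \<noteq> {0}}"

lemma nonzero_RI_E: "J \<in> nonzero_RI \<Longrightarrow> (\<And>p. p \<noteq> 0 \<Longrightarrow> J = rid p \<Longrightarrow> P) \<Longrightarrow> P"
  unfolding nonzero_RI_def using RI_principal by blast

lemma rid_nonzero_RI: "p \<noteq> 0 \<Longrightarrow> rid p \<in> nonzero_RI"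
  unfolding nonzero_RI_def using RI_rid rid_self[of p] by blast

lemma primitive_RI_subset: "primitive_RI \<subseteq> nonzero_RI"
  using prim_nonzero rid_nonzero_RI by (auto simp: primitive_RI_def)

lemma group_index_nonzero_RI: "J \<in> nonzero_RI \<Longrightarrow> group_index UNIV J = (ideal_norm J)\<^sup>2"
  by (auto elim!: nonzero_RI_E simp: group_index_rid ideal_norm_rid)

lemma ideal_norm_pos: "J \<in> nonzero_RI \<Longrightarrow> ideal_norm J > 0"
  by (auto elim!: nonzero_RI_E simp: ideal_norm_rid anorm_pos)

definition norm_rep :: "ico set \<Rightarrow> zt" where "norm_rep J = rep (nr (gen J))"

lemma norm_rep_rid: "norm_rep (rid p) = rep (nr p)"
  unfolding norm_rep_def rep_eq_iff by (rule rid_eq_imp_assoc) simp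

lemma norm_rep_nonzero_RI: "J \<in> nonzero_RI \<Longrightarrow> norm_rep J \<in> reps" "J \<in> nonzero_RI \<Longrightarrow> nat \<bar>nz (norm_rep J)\<bar> = ideal_norm J"
  by (auto elim!: nonzero_RI_E simp: norm_rep_rid rep_in_reps ideal_norm_rid anorm_def anorm_pos[unfolded anorm_def] abs_of_pos)

lemma norm_rep_fibre: "n \<in> reps \<Longrightarrow> {J \<in> nonzero_RI. norm_rep J = n} = ideals_of_norm n"
proof (intro equalityI subsetI)
  fix J assume n: "n \<in> reps" and "J \<in> {J \<in> nonzero_RI. norm_rep J = n}"
  then obtain p where "J = rid p" "rep (nr p) = n" by (auto elim!: nonzero_RI_E simp: norm_rep_rid)
  then show "J \<in> ideals_of_norm n" using ideals_of_norm_I[of p n] assoc_sym[OF rep_assoc[of "nr p"]] by simp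
next
  fix J assume n: "n \<in> reps" and "J \<in> ideals_of_norm n"
  then obtain p where p: "J = rid p" "nr p \<sim> n" by (auto elim: ideals_of_norm_E)
  moreover from this n have "p \<noteq> 0" by (auto simp: reps_iff)
  moreover have "rep (nr p) = n" using p(2) n by (metis reps_iff rep_eq_iff)
  ultimately show "J \<in> {J \<in> nonzero_RI. norm_rep J = n}" by (simp add: rid_nonzero_RI norm_rep_rid)
qed

text \<open>Sorting the right ideals by their norm \<open>n\<close> yields the sum of the norms of
  the divisors \<open>d\<close> of \<open>n\<close>, each divided by the power \<open>2 s\<close>
  of the norm of \<open>n\<close>. Writing \<open>n = d e\<close> separates this into two sums
  over ideals of \<open>\<int>[\<tau>]\<close>.\<close>

lemma zeta_ideals:
  assumes s: "Re s > 1"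
  shows "(\<lambda>J. dterm s (group_index UNIV J)) summable_on nonzero_RI"
    and "infsum (\<lambda>J. dterm s (group_index UNIV J)) nonzero_RI = zeta_K (2 * s) * zeta_K (2 * s - 1)"
proof -
  let ?N = "\<lambda>c. nat \<bar>nz c\<bar>"
  let ?F = "\<lambda>(d, e). dterm (2 * s - 1) (?N d) * dterm (2 * s) (?N e)" and ?h = "\<lambda>(d, e). rep (d * e)"
  have s2: "Re (2 * s) > 1" "Re (2 * s - 1) > 1" using s by simp_all
  have X: "?F summable_on (reps \<times> reps)" "infsum ?F (reps \<times> reps) = zeta_K (2 * s - 1) * zeta_K (2 * s)"
    using infsum_times[OF zeta_K_ideals(1)[OF s2(2)] zeta_K_ideals(1)[OF s2(1)]]
      zeta_K_ideals(2)[OF s2(2)] zeta_K_ideals(2)[OF s2(1)] by simp_all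
  have im: "?h x \<in> reps" if "x \<in> reps \<times> reps" for x 
  proof -
    have "fst x * snd x \<noteq> 0" using that by (auto simp: reps_iff)
    then show ?thesis by (simp add: case_prod_unfold rep_in_reps)
  qed
  have fst: "bij_betw fst {x. x \<in> reps \<times> reps \<and> ?h x = n} (divs n)" if n: "n \<in> reps" for n
    unfolding bij_betw_def
  proof
    show "inj_on fst {x. x \<in> reps \<times> reps \<and> ?h x = n}"
    proof (rule inj_onI)
      fix x y assume "x \<in> {x. x \<in> reps \<times> reps \<and> ?h x = n}" "y \<in> {x. x \<in> reps \<times> reps \<and> ?h x = n}" "fst x = fst y"
      then obtain d e e' where xy: "x = (d, e)" "y = (d, e')" "d \<in> reps" "e \<in> reps" "e' \<in> reps"
        "rep (d * e) = rep (d * e')" by auto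
      then have "e \<sim> e'" by (simp add: rep_eq_iff assoc_mult_cancel reps_iff)
      then show "x = y" using xy reps_eqI by blast
    qed
    show "fst ` {x. x \<in> reps \<times> reps \<and> ?h x = n} = divs n"
    proof (intro equalityI subsetI)
      fix d assume "d \<in> fst ` {x. x \<in> reps \<times> reps \<and> ?h x = n}"
      then obtain e where "d \<in> reps" "rep (d * e) = n" by auto
      moreover have "d dvd rep (d * e)" by simp
      ultimately show "d \<in> divs n" by (simp add: divs_def)
    next
      fix d assume d: "d \<in> divs n"
      then obtain k where k: "n = d * k" by (auto simp: divs_def elim: dvdE)
      have "k \<noteq> 0" using n k by (auto simp: reps_iff)
      moreover have "d * rep k \<sim> n" unfolding k by (intro assoc_mult) auto
      then have "rep (d * rep k) = n" using n by (metis reps_iff rep_eq_iff)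
      ultimately have "(d, rep k) \<in> {x. x \<in> reps \<times> reps \<and> ?h x = n}" using d by (simp add: divs_def rep_in_reps)
      then show "d \<in> fst ` {x. x \<in> reps \<times> reps \<and> ?h x = n}" by force
    qed
  qed
  have fin: "finite {x \<in> reps \<times> reps. ?h x = n}" if n: "n \<in> reps" for n
    using bij_betw_finite[OF fst[OF n]] finite_divs n by (simp add: reps_iff)
  have fib: "(\<Sum>x | x \<in> reps \<times> reps \<and> ?h x = n. ?F x) = of_nat (card (ideals_of_norm n)) * dterm (2 * s) (?N n)" if n: "n \<in> reps" for n
  proof -
    have "?F x = of_nat (?N (fst x)) * dterm (2 * s) (?N n)" if x: "x \<in> {x. x \<in> reps \<times> reps \<and> ?h x = n}" for x
    proof -
      obtain d e where de: "x = (d, e)" "d \<in> reps" "rep (d * e) = n" using x by auto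
      have "?N d > 0" using de(2) by (simp add: reps_iff)
      moreover have "?N n = ?N d * ?N e" unfolding de(3)[symmetric] by (simp add: nz_mult abs_mult nat_mult_distrib)
      ultimately show ?thesis by (simp add: de(1) dterm_shift dterm_mult)
    qed
    then have "(\<Sum>x | x \<in> reps \<times> reps \<and> ?h x = n. ?F x) =
        (\<Sum>x | x \<in> reps \<times> reps \<and> ?h x = n. of_nat (?N (fst x)) * dterm (2 * s) (?N n))"
      by (intro sum.cong) auto
    also have "\<dots> = (\<Sum>d\<in>divs n. of_nat (?N d) * dterm (2 * s) (?N n))"
      using sum.reindex_bij_betw[OF fst[OF n], of "\<lambda>d. of_nat (?N d) * dterm (2 * s) (?N n)"] by simp
    also have "\<dots> = of_nat (sigma n) * dterm (2 * s) (?N n)" by (simp add: sigma_def sum_distrib_right)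
    finally show ?thesis using card_ideals_of_norm_eq_sigma n by (simp add: reps_iff)
  qed
  have sumR: "(\<lambda>n. of_nat (card (ideals_of_norm n)) * dterm (2 * s) (?N n)) summable_on reps"
    using infsum_fibres(2)[OF im fin X(1)] fib by (subst summable_on_cong[symmetric]) auto
  have eqR: "zeta_K (2 * s - 1) * zeta_K (2 * s) = infsum (\<lambda>n. of_nat (card (ideals_of_norm n)) * dterm (2 * s) (?N n)) reps"
    using infsum_fibres(3)[OF im fin X(1)] X(2) fib by (metis (no_types, lifting) infsum_cong)
  have fin': "finite {J \<in> nonzero_RI. norm_rep J = n}" if "n \<in> reps" for n
    using that by (simp add: norm_rep_fibre finite_ideals_of_norm reps_iff)
  have tm: "dterm s (group_index UNIV J) = dterm (2 * s) (?N (norm_rep J))" if "J \<in> nonzero_RI" for J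
    using that dterm_power[of 2 s "ideal_norm J"] by (simp add: group_index_nonzero_RI norm_rep_nonzero_RI)
  have card: "of_nat (card {J \<in> nonzero_RI. norm_rep J = n}) * dterm (2 * s) (?N n) = of_nat (card (ideals_of_norm n)) * dterm (2 * s) (?N n)"
    if "n \<in> reps" for n using that by (simp add: norm_rep_fibre)
  note c = infsum_constant_on_fibres[where X = nonzero_RI and h = norm_rep and C = reps and g = "\<lambda>n. dterm (2 * s) (?N n)", OF norm_rep_nonzero_RI(1) fin']
  have "(\<lambda>J. dterm (2 * s) (?N (norm_rep J))) summable_on nonzero_RI"
    using c(1) sumR card by (simp cong: summable_on_cong)
  then show "(\<lambda>J. dterm s (group_index UNIV J)) summable_on nonzero_RI"
    using tm by (simp cong: summable_on_cong)
  have "infsum (\<lambda>J. dterm s (group_index UNIV J)) nonzero_RI = infsum (\<lambda>J. dterm (2 * s) (?N (norm_rep J))) nonzero_RI"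
    using tm by (rule infsum_cong)
  also have "\<dots> = infsum (\<lambda>n. of_nat (card (ideals_of_norm n)) * dterm (2 * s) (?N n)) reps"
    by (rule trans[OF c(2) infsum_cong]) (use card in auto)
  finally show "infsum (\<lambda>J. dterm s (group_index UNIV J)) nonzero_RI = zeta_K (2 * s) * zeta_K (2 * s - 1)"
    by (simp only: eqR[symmetric] mult.commute[of "zeta_K (2 * s)" "zeta_K (2 * s - 1)"])
qed

text \<open>A right ideal is uniquely the product of its content \<open>c\<close> and a primitive
  right ideal, and the content contributes the fourth power of its norm to the index.\<close>

lemma zeta_ideals_primitive:
  assumes s: "Re s > 1"
  shows "(\<lambda>J. dterm s (group_index UNIV J)) summable_on primitive_RI"
    and "infsum (\<lambda>J. dterm s (group_index UNIV J)) nonzero_RI = zeta_K (4 * s) * infsum (\<lambda>J. dterm s (group_index UNIV J)) primitive_RI"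
proof -
  show sum: "(\<lambda>J. dterm s (group_index UNIV J)) summable_on primitive_RI"
    using zeta_ideals(1)[OF s] primitive_RI_subset by (rule summable_on_subset_banach)
  have s4: "Re (4 * s) > 1" using s by simp
  have "infsum (\<lambda>J. dterm s (group_index UNIV J)) nonzero_RI =
      infsum (\<lambda>x. dterm s (group_index UNIV ((\<lambda>(c, J). (*) (sc c) ` J) x))) (reps \<times> primitive_RI)"
    unfolding nonzero_RI_def by (rule infsum_reindex_bij_betw[OF bij_betw_content, symmetric])
  also have "\<dots> = infsum (\<lambda>(c, J). dterm (4 * s) (nat \<bar>nz c\<bar>) * dterm s (group_index UNIV J)) (reps \<times> primitive_RI)"
  proof (rule infsum_cong, clarify)
    fix c J assume c: "c \<in> reps" "J \<in> primitive_RI"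
    then obtain p where p: "J = rid p" by (auto simp: primitive_RI_def)
    have "sc c \<noteq> 0" "c \<noteq> 0" using c by (simp_all add: reps_iff)
    then have "group_index UNIV ((*) (sc c) ` J) = nat \<bar>nz c\<bar> ^ 4 * group_index UNIV J"
      by (simp add: p scaled_rid group_index_rid_mult group_index_rid_sc)
    then show "dterm s (group_index UNIV ((*) (sc c) ` J)) = dterm (4 * s) (nat \<bar>nz c\<bar>) * dterm s (group_index UNIV J)"
      using dterm_power[of 4 s] by (simp add: dterm_mult)
  qed
  also have "\<dots> = zeta_K (4 * s) * infsum (\<lambda>J. dterm s (group_index UNIV J)) primitive_RI"
    by (simp add: infsum_times(2)[OF zeta_K_ideals(1)[OF s4] sum] zeta_K_ideals(2)[OF s4])
  finally show "infsum (\<lambda>J. dterm s (group_index UNIV J)) nonzero_RI = zeta_K (4 * s) * infsum (\<lambda>J. dterm s (group_index UNIV J)) primitive_RI" .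
qed

section \<open>Right ideals and sublattices in Euclidean space\<close>

lemma group_index_emb: "group_index (emb ` G) (emb ` H) = group_index G H"
  by (rule group_index_inj_image) (simp_all add: emb_inj')

lemma right_ideal_iff: "right_ideal I \<longleftrightarrow> (\<exists>J. RI J \<and> I = emb ` J)"
proof
  assume I: "right_ideal I"
  define J where "J = emb -` I"
  have IJ: "I = emb ` J" using I unfolding right_ideal_def emb_range J_def by blast
  have "x - y \<in> J" if "x \<in> J" "y \<in> J" for x y
    using I that by (auto simp: right_ideal_def J_def)
  moreover have "0 \<in> J" using I by (auto simp: right_ideal_def J_def)
  moreover have "x * a \<in> J" if "x \<in> J" for x a
    using I that by (auto simp: right_ideal_def J_def emb_range)
  ultimately have "RI J" unfolding RI_def add_subgroup_def by blast
  then show "\<exists>J. RI J \<and> I = emb ` J" using IJ by blast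
next
  assume "\<exists>J. RI J \<and> I = emb ` J"
  then obtain J where J: "RI J" "I = emb ` J" by blast
  have sub: "add_subgroup J" using J(1) by (simp add: RI_def)
  show "right_ideal I"
    unfolding right_ideal_def emb_range J(2)
  proof (intro conjI ballI)
    show "0 \<in> emb ` J" using add_subgroup_0[OF sub] emb_linear(1) by (metis imageI)
  next
    fix x y assume "x \<in> emb ` J" "y \<in> emb ` J"
    then show "x - y \<in> emb ` J" using add_subgroup_diff[OF sub] by (auto simp flip: emb_linear(3))
  next
    fix x a assume "x \<in> emb ` J" "a \<in> range emb"
    then show "x \<star> a \<in> emb ` J" using J(1) by (auto simp: RI_def simp flip: emb_mult)
  qed auto
qed

lemma primitive_icosian_iff: "primitive_icosian (emb p) \<longleftrightarrow> prim p"
proof -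
  have "emb p \<in> (\<lambda>x. rz c *\<^sub>R x) ` range emb \<longleftrightarrow> sdvd c p" for c
  proof
    assume "emb p \<in> (\<lambda>x. rz c *\<^sub>R x) ` range emb"
    then obtain y where "emb p = rz c *\<^sub>R emb y" by blast
    then have "p = sc c * y" by (simp only: emb_sc[symmetric] emb_inj)
    then show "sdvd c p" by (rule sdvdI)
  next
    assume "sdvd c p"
    then obtain y where "p = sc c * y" by (auto simp: sdvd_def)
    then have "emb p = rz c *\<^sub>R emb y" by (simp only: emb_sc)
    then show "emb p \<in> (\<lambda>x. rz c *\<^sub>R x) ` range emb" by blast
  qed
  then show ?thesis
    unfolding primitive_icosian_def prim_def emb_range rz_range by (auto simp: Z_tau_unit_iff)
qed

lemma primitive_right_ideal_iff: "primitive_right_ideal I \<longleftrightarrow> (\<exists>J\<in>primitive_RI. I = emb ` J)"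
proof -
  have rid: "(\<lambda>x. emb p \<star> x) ` range emb = emb ` rid p" for p
    by (simp add: rid_def image_image)
  have "(\<exists>p. primitive_icosian p \<and> I = (\<lambda>x. p \<star> x) ` icosians) \<longleftrightarrow> (\<exists>J\<in>primitive_RI. I = emb ` J)"
  proof
    assume "\<exists>p. primitive_icosian p \<and> I = (\<lambda>x. p \<star> x) ` icosians"
    then obtain p where p: "primitive_icosian p" "I = (\<lambda>x. p \<star> x) ` range emb" unfolding emb_range by blast
    then obtain p' where "p = emb p'" unfolding primitive_icosian_def emb_range by blast
    then show "\<exists>J\<in>primitive_RI. I = emb ` J" using p primitive_icosian_iff rid unfolding primitive_RI_def by blast
  next
    assume "\<exists>J\<in>primitive_RI. I = emb ` J"
    then obtain p where "prim p" "I = emb ` rid p" by (auto simp: primitive_RI_def)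
    then have "primitive_icosian (emb p) \<and> I = (\<lambda>x. emb p \<star> x) ` icosians"
      by (simp only: primitive_icosian_iff emb_range rid)
    then show "\<exists>p. primitive_icosian p \<and> I = (\<lambda>x. p \<star> x) ` icosians" by blast
  qed
  moreover have "right_ideal I" if J: "J \<in> primitive_RI" "I = emb ` J" for J
  proof -
    have "RI J" using J(1) primitive_RI_subset by (auto simp: nonzero_RI_def)
    then show ?thesis using J(2) right_ideal_iff by blast
  qed
  ultimately show ?thesis unfolding primitive_right_ideal_def by metis
qed

lemma inj_on_image_emb: "inj_on ((`) emb) A"
  by (meson emb_inj' inj_image_eq_iff inj_onI)

lemma bij_betw_primitive_RI: "bij_betw ((`) emb) primitive_RI {I. primitive_right_ideal I}"
  unfolding bij_betw_def primitive_right_ideal_iff using inj_on_image_emb by auto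

lemma bij_betw_nonzero_RI: "bij_betw ((`) emb) nonzero_RI {I. right_ideal I \<and> I \<noteq> {0}}"
proof -
  have "emb ` J = {0} \<longleftrightarrow> J = {0}" for J
    using inj_image_eq_iff[OF emb_inj', of J "{0}"] by simp
  then have h: "I \<in> (`) emb ` nonzero_RI \<longleftrightarrow> right_ideal I \<and> I \<noteq> {0}" for I
    unfolding nonzero_RI_def right_ideal_iff image_iff mem_Collect_eq Bex_def by metis
  have "(`) emb ` nonzero_RI = {I. right_ideal I \<and> I \<noteq> {0}}"
    by (intro equalityI subsetI) (simp_all only: mem_Collect_eq h simp_thms)
  then show ?thesis unfolding bij_betw_def by (intro conjI inj_on_image_emb)
qed

lemma ideal_term_emb: "ideal_term s (emb ` J) = dterm s (group_index UNIV J)"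
  unfolding ideal_term_def dterm_def emb_range group_index_emb ..

definition ssl_L_of :: "nat \<times> ico set \<Rightarrow> (real ^ 4) set" where "ssl_L_of = (\<lambda>(m, J). emb ` msl m (gen J))"

definition ssl_A4_of :: "nat \<times> ico set \<Rightarrow> (real ^ 5) set" where "ssl_A4_of x = root_map ` ssl_L_of x"

lemma gen_primitive_RI: "J \<in> primitive_RI \<Longrightarrow> prim (gen J) \<and> rid (gen J) = J"
  by (auto simp: primitive_RI_def intro: prim_rid_cong[OF rid_gen[symmetric]])

lemma gen_rid_msl: "prim p \<Longrightarrow> msl m (gen (rid p)) = msl m p"
  using gen_primitive_RI[of "rid p"] prim_nonzero by (intro msl_cong) (auto simp: primitive_RI_def)

lemma inj_root_map: "inj root_map" by (rule inj_on_inverseI[of _ root_map_inv]) (rule root_map_inv_root_map)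

lemma bij_betw_ssl_L_of: "bij_betw ssl_L_of ({1..} \<times> primitive_RI) {\<Lambda>. ssl L_lattice \<Lambda>}"
  unfolding bij_betw_def
proof
  show "inj_on ssl_L_of ({1..} \<times> primitive_RI)"
  proof (rule inj_onI)
    fix x y assume "x \<in> {1..} \<times> primitive_RI" "y \<in> {1..} \<times> primitive_RI" and eq: "ssl_L_of x = ssl_L_of y"
    then obtain m J k K where x: "x = (m, J)" "y = (k, K)" "m \<ge> 1" "k \<ge> 1" "J \<in> primitive_RI" "K \<in> primitive_RI" by auto
    have "msl m (gen J) = msl k (gen K)" using eq x inj_image_eq_iff[OF emb_inj'] by (simp add: ssl_L_of_def)
    then have "m = k \<and> rid (gen J) = rid (gen K)" using msl_inj gen_primitive_RI x by blast
    then show "x = y" using gen_primitive_RI x by simp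
  qed
  show "ssl_L_of ` ({1..} \<times> primitive_RI) = {\<Lambda>. ssl L_lattice \<Lambda>}"
  proof (intro equalityI subsetI)
    fix \<Lambda> assume "\<Lambda> \<in> ssl_L_of ` ({1..} \<times> primitive_RI)"
    then obtain m J where "m \<ge> 1" "J \<in> primitive_RI" "\<Lambda> = emb ` msl m (gen J)" by (auto simp: ssl_L_of_def)
    then show "\<Lambda> \<in> {\<Lambda>. ssl L_lattice \<Lambda>}" using gen_primitive_RI unfolding ssl_L_iff by blast
  next
    fix \<Lambda> assume "\<Lambda> \<in> {\<Lambda>. ssl L_lattice \<Lambda>}"
    then obtain p m where p: "prim p" "m \<ge> 1" "\<Lambda> = emb ` msl m p" unfolding ssl_L_iff by blast
    then have "\<Lambda> = ssl_L_of (m, rid p)" by (simp add: ssl_L_of_def gen_rid_msl)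
    moreover have "(m, rid p) \<in> {1..} \<times> primitive_RI" using p by (auto simp: primitive_RI_def)
    ultimately show "\<Lambda> \<in> ssl_L_of ` ({1..} \<times> primitive_RI)" by blast
  qed
qed

lemma bij_betw_ssl_A4_of: "bij_betw ssl_A4_of ({1..} \<times> primitive_RI) {\<Lambda>. ssl A4 \<Lambda>}"
proof -
  have "bij_betw ((`) root_map) {\<Lambda>. ssl L_lattice \<Lambda>} {\<Lambda>. ssl A4 \<Lambda>}"
    unfolding bij_betw_def ssl_A4_iff using inj_image_eq_iff[OF inj_root_map] by (auto intro!: inj_onI)
  from bij_betw_trans[OF bij_betw_ssl_L_of this] show ?thesis by (simp add: ssl_A4_of_def[abs_def] comp_def)
qed

lemma ssl_A4_E:
  assumes "ssl A4 \<Lambda>"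
  shows "\<exists>m J. \<Lambda> = ssl_A4_of (m, J) \<and> m \<ge> 1 \<and> J \<in> primitive_RI"
proof -
  have "\<Lambda> \<in> ssl_A4_of ` ({1..} \<times> primitive_RI)"
    unfolding bij_betw_imp_surj_on[OF bij_betw_ssl_A4_of] using assms by simp
  then obtain x where x: "x \<in> {1..} \<times> primitive_RI" "\<Lambda> = ssl_A4_of x" by blast
  then show ?thesis by (cases x) auto
qed

lemma group_index_ssl_L_of:
  assumes "m \<ge> 1" "J \<in> primitive_RI"
  shows "group_index L_lattice (ssl_L_of (m, J)) = (m\<^sup>2 * ideal_norm J)\<^sup>2"
proof -
  have p: "prim (gen J)" "rid (gen J) = J" using gen_primitive_RI[OF assms(2)] by auto
  show ?thesis
    using group_index_msl[OF prim_nonzero[OF p(1)] assms(1)]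
    by (simp add: ssl_L_of_def L_lattice_eq group_index_emb ideal_norm_def power_mult_distrib flip: power_mult)
qed

lemma group_index_ssl_A4_of: "group_index A4 (ssl_A4_of x) = group_index L_lattice (ssl_L_of x)"
  unfolding root_map_L[symmetric] ssl_A4_of_def
  by (rule group_index_inj_image) (simp_all add: inj_root_map linear_diff[OF linear_root_map])

text \<open>The sublattice \<open>m p L p~\<close> lies in \<open>m L\<close>, but for \<open>m =
  1\<close> in no proper integer multiple of \<open>L\<close>.\<close>

lemma primitive_ssl_iff: "primitive_ssl A4 \<Lambda> \<longleftrightarrow> (\<exists>J\<in>primitive_RI. \<Lambda> = ssl_A4_of (1, J))"
proof
  assume P: "primitive_ssl A4 \<Lambda>"
  then have "ssl A4 \<Lambda>" by (simp add: primitive_ssl_def)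
  then obtain m J where mJ: "\<Lambda> = ssl_A4_of (m, J)" "m \<ge> 1" "J \<in> primitive_RI"
    using ssl_A4_E by blast
  have "\<Lambda> \<subseteq> (\<lambda>x. real m *\<^sub>R x) ` A4"
  proof
    fix v assume "v \<in> \<Lambda>"
    then obtain z where z: "z \<in> SL (gen J)" "v = root_map (emb (sc (of_nat m) * z))"
      unfolding mJ(1) ssl_A4_of_def ssl_L_of_def msl_def by blast
    then have "v = real m *\<^sub>R root_map (emb z)" by (simp add: linear_scale[OF linear_root_map])
    then show "v \<in> (\<lambda>x. real m *\<^sub>R x) ` A4" using z(1) SL_subset unfolding root_map_L[symmetric] L_lattice_eq by blast
  qed
  then have "m = 1" using P mJ(2) unfolding primitive_ssl_def by blast
  then show "\<exists>J\<in>primitive_RI. \<Lambda> = ssl_A4_of (1, J)" using mJ by blast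
next
  assume "\<exists>J\<in>primitive_RI. \<Lambda> = ssl_A4_of (1, J)"
  then obtain J where J: "J \<in> primitive_RI" "\<Lambda> = ssl_A4_of (1, J)" by blast
  have p: "prim (gen J)" using gen_primitive_RI[OF J(1)] by simp
  have "ssl A4 \<Lambda>" using bij_betw_imp_surj_on[OF bij_betw_ssl_A4_of] J by auto
  moreover have "m = 1" if m: "m \<ge> 1" "\<Lambda> \<subseteq> (\<lambda>x. real m *\<^sub>R x) ` A4" for m
  proof -
    have "sdvd (of_int (int m)) (twist_act (gen J) x)" if x: "x \<in> Fix" for x
    proof -
      have "root_map (emb (twist_act (gen J) x)) \<in> \<Lambda>"
        unfolding J(2) ssl_A4_of_def ssl_L_of_def msl_def SL_def using x by auto
      then obtain y where "y \<in> Fix" "root_map (emb (twist_act (gen J) x)) = real m *\<^sub>R root_map (emb y)"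
        using m(2) unfolding root_map_L[symmetric] L_lattice_eq by blast
      then have "root_map (emb (twist_act (gen J) x)) = root_map (emb (sc (of_int (int m)) * y))"
        by (simp add: linear_scale[OF linear_root_map])
      then have "twist_act (gen J) x = sc (of_int (int m)) * y" by (simp only: inj_eq[OF inj_root_map] emb_inj)
      then show ?thesis by (rule sdvdI)
    qed
    from SL_primitive[OF p this] show ?thesis by simp
  qed
  ultimately show "primitive_ssl A4 \<Lambda>" unfolding primitive_ssl_def by blast
qed

lemma bij_betw_primitive: "bij_betw (\<lambda>J. ssl_A4_of (1, J)) primitive_RI {\<Lambda>. primitive_ssl A4 \<Lambda>}"
proof -
  have "inj_on (\<lambda>J. ssl_A4_of (1, J)) primitive_RI"
    using bij_betw_imp_inj_on[OF bij_betw_ssl_A4_of] by (auto simp: inj_on_def)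
  then show ?thesis unfolding bij_betw_def primitive_ssl_iff by auto
qed

lemma finite_ideal_norm: "k > 0 \<Longrightarrow> finite {J \<in> nonzero_RI. ideal_norm J = k}"
proof -
  assume k: "k > 0"
  have "finite (\<Union>c\<in>reps_of_norm k. ideals_of_norm c)" using finite_reps_of_norm finite_ideals_of_norm reps_of_norm_nz by blast
  moreover have "{J \<in> nonzero_RI. ideal_norm J = k} \<subseteq> (\<Union>c\<in>reps_of_norm k. ideals_of_norm c)"
  proof
    fix J assume J: "J \<in> {J \<in> nonzero_RI. ideal_norm J = k}"
    then have "norm_rep J \<in> reps_of_norm k" using norm_rep_nonzero_RI by (auto simp: reps_of_norm_def)
    moreover have "J \<in> ideals_of_norm (norm_rep J)" using norm_rep_fibre[of "norm_rep J"] norm_rep_nonzero_RI J by blast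
    ultimately show "J \<in> (\<Union>c\<in>reps_of_norm k. ideals_of_norm c)" by blast
  qed
  ultimately show ?thesis by (rule finite_subset[rotated])
qed

lemma finite_pairs:
  assumes "j > 0"
  shows "finite {x \<in> {1..} \<times> primitive_RI. (fst x)\<^sup>2 * ideal_norm (snd x) = j}"
proof -
  have "finite ({1..j} \<times> (\<Union>k\<in>{1..j}. {J \<in> nonzero_RI. ideal_norm J = k}))"
    using finite_ideal_norm by (intro finite_cartesian_product finite_UN_I) auto
  moreover have "{x \<in> {1..} \<times> primitive_RI. (fst x)\<^sup>2 * ideal_norm (snd x) = j} \<subseteq> {1..j} \<times> (\<Union>k\<in>{1..j}. {J \<in> nonzero_RI. ideal_norm J = k})"
  proof
    fix x assume x: "x \<in> {x \<in> {1..} \<times> primitive_RI. (fst x)\<^sup>2 * ideal_norm (snd x) = j}"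
    then have d: "fst x dvd j" "ideal_norm (snd x) dvd j" by (auto simp: power2_eq_square)
    then have "fst x \<le> j" "ideal_norm (snd x) \<le> j" using assms by (auto intro: dvd_imp_le)
    moreover have "ideal_norm (snd x) \<noteq> 0" using d(2) assms by (metis dvd_0_left not_gr_zero)
    ultimately show "x \<in> {1..j} \<times> (\<Union>k\<in>{1..j}. {J \<in> nonzero_RI. ideal_norm J = k})"
      using x primitive_RI_subset by (auto simp: Suc_le_eq)
  qed
  ultimately show ?thesis by (rule finite_subset[rotated])
qed

lemma ideal_norm_prim_exists:
  assumes "c \<noteq> 0"
  shows "\<exists>J\<in>primitive_RI. ideal_norm J = nat \<bar>nz c\<bar>"
proof -
  obtain p where p: "prim p" "nr p \<sim> c" using prim_exists[OF assms] by blast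
  have "anorm p = \<bar>nz c\<bar>"
    using assoc_abs_nz[OF p(2)] anorm_pos[OF prim_nonzero[OF p(1)]] by (simp add: anorm_def)
  then have "ideal_norm (rid p) = nat \<bar>nz c\<bar>" by (simp add: ideal_norm_rid)
  then show ?thesis using p(1) by (auto simp: primitive_RI_def)
qed

text \<open>The index is the square of the norm of \<open>m\<close> times the reduced norm of a
  generator.\<close>

lemma index_as_norm:
  assumes "m \<ge> 1" "J \<in> primitive_RI"
  shows "\<exists>c. c \<noteq> 0 \<and> int (m\<^sup>2 * ideal_norm J) = nz c"
proof (intro exI conjI)
  have p: "gen J \<noteq> 0" using gen_primitive_RI[OF assms(2)] prim_nonzero by blast
  show "of_nat m * nr (gen J) \<noteq> 0" using p assms(1) by simp
  have "nz (of_nat m) = (int m)\<^sup>2" using nz_simps(3)[of "int m"] by simp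
  then show "int (m\<^sup>2 * ideal_norm J) = nz (of_nat m * nr (gen J))"
    using anorm_pos[OF p] by (simp add: ideal_norm_def nz_mult anorm_def)
qed

section \<open>The generating functions\<close>

lemma zeta_icosian_eq: "zeta_icosian s = infsum (\<lambda>J. dterm s (group_index UNIV J)) nonzero_RI"
  and ideal_term_summable: "ideal_term s summable_on {I. right_ideal I \<and> I \<noteq> {0}} \<longleftrightarrow>
    (\<lambda>J. dterm s (group_index UNIV J)) summable_on nonzero_RI"
  unfolding zeta_icosian_def
  using infsum_reindex_bij_betw[OF bij_betw_nonzero_RI, of "ideal_term s"]
    summable_on_reindex_bij_betw[OF bij_betw_nonzero_RI, of "ideal_term s"]
  by (simp_all add: ideal_term_emb)

lemma zeta_icosian_pr_eq: "zeta_icosian_pr s = infsum (\<lambda>J. dterm s (group_index UNIV J)) primitive_RI"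
  and ideal_term_pr_summable: "ideal_term s summable_on {I. primitive_right_ideal I} \<longleftrightarrow>
    (\<lambda>J. dterm s (group_index UNIV J)) summable_on primitive_RI"
  unfolding zeta_icosian_pr_def
  using infsum_reindex_bij_betw[OF bij_betw_primitive_RI, of "ideal_term s"]
    summable_on_reindex_bij_betw[OF bij_betw_primitive_RI, of "ideal_term s"]
  by (simp_all add: ideal_term_emb)

lemma bij_betw_restrict:
  assumes "bij_betw f X {y. Q y}" "\<And>x. x \<in> X \<Longrightarrow> P (f x) \<longleftrightarrow> R x"
  shows "bij_betw f {x \<in> X. R x} {y. Q y \<and> P y}"
proof -
  have "f ` X = {y. Q y}" "inj_on f X" using assms(1) by (simp_all add: bij_betw_def)
  moreover have "f ` {x \<in> X. R x} = {y \<in> f ` X. P y}" using assms(2) by auto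
  ultimately show ?thesis unfolding bij_betw_def by (auto intro: inj_on_subset)
qed

lemma card_ssl_A4: "card {\<Lambda>. ssl A4 \<Lambda> \<and> group_index A4 \<Lambda> = n} = card {x \<in> {1..} \<times> primitive_RI. ((fst x)\<^sup>2 * ideal_norm (snd x))\<^sup>2 = n}"
  and card_ssl_L: "card {\<Lambda>. ssl L_lattice \<Lambda> \<and> group_index L_lattice \<Lambda> = n} = card {x \<in> {1..} \<times> primitive_RI. ((fst x)\<^sup>2 * ideal_norm (snd x))\<^sup>2 = n}"
  and finite_ssl_A4: "finite {\<Lambda>. ssl A4 \<Lambda> \<and> group_index A4 \<Lambda> = n} \<longleftrightarrow> finite {x \<in> {1..} \<times> primitive_RI. ((fst x)\<^sup>2 * ideal_norm (snd x))\<^sup>2 = n}"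
  and finite_ssl_L: "finite {\<Lambda>. ssl L_lattice \<Lambda> \<and> group_index L_lattice \<Lambda> = n} \<longleftrightarrow> finite {x \<in> {1..} \<times> primitive_RI. ((fst x)\<^sup>2 * ideal_norm (snd x))\<^sup>2 = n}"
proof -
  let ?X = "{x \<in> {1..} \<times> primitive_RI. ((fst x)\<^sup>2 * ideal_norm (snd x))\<^sup>2 = n}"
  have iL: "group_index L_lattice (ssl_L_of x) = ((fst x)\<^sup>2 * ideal_norm (snd x))\<^sup>2" if "x \<in> {1..} \<times> primitive_RI" for x
    using that group_index_ssl_L_of by auto
  have L: "bij_betw ssl_L_of ?X {\<Lambda>. ssl L_lattice \<Lambda> \<and> group_index L_lattice \<Lambda> = n}"
    by (rule bij_betw_restrict[OF bij_betw_ssl_L_of]) (simp only: iL)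
  have A: "bij_betw ssl_A4_of ?X {\<Lambda>. ssl A4 \<Lambda> \<and> group_index A4 \<Lambda> = n}"
    by (rule bij_betw_restrict[OF bij_betw_ssl_A4_of]) (simp only: iL group_index_ssl_A4_of)
  show "card {\<Lambda>. ssl A4 \<Lambda> \<and> group_index A4 \<Lambda> = n} = card ?X"
    "card {\<Lambda>. ssl L_lattice \<Lambda> \<and> group_index L_lattice \<Lambda> = n} = card ?X"
    using bij_betw_same_card[OF A] bij_betw_same_card[OF L] by simp_all
  show "finite {\<Lambda>. ssl A4 \<Lambda> \<and> group_index A4 \<Lambda> = n} \<longleftrightarrow> finite ?X"
    "finite {\<Lambda>. ssl L_lattice \<Lambda> \<and> group_index L_lattice \<Lambda> = n} \<longleftrightarrow> finite ?X"
    using bij_betw_finite[OF A] bij_betw_finite[OF L] by simp_all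
qed

lemma finite_pairs_square: "finite {x \<in> {1..} \<times> primitive_RI. ((fst x)\<^sup>2 * ideal_norm (snd x))\<^sup>2 = n}"
proof (cases "\<exists>j. j > 0 \<and> n = j\<^sup>2")
  case True
  then obtain j where j: "j > 0" "n = j\<^sup>2" by blast
  then have "{x \<in> {1..} \<times> primitive_RI. ((fst x)\<^sup>2 * ideal_norm (snd x))\<^sup>2 = n} = {x \<in> {1..} \<times> primitive_RI. (fst x)\<^sup>2 * ideal_norm (snd x) = j}"
    by (simp only: power2_eq_iff_nonneg le0)
  then show ?thesis using finite_pairs[OF j(1)] by (simp only:)
next
  case False
  have "(fst x)\<^sup>2 * ideal_norm (snd x) > 0" if "x \<in> {1..} \<times> primitive_RI" for x
    using that ideal_norm_pos primitive_RI_subset by (auto simp: Suc_le_eq)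
  then have "{x \<in> {1..} \<times> primitive_RI. ((fst x)\<^sup>2 * ideal_norm (snd x))\<^sup>2 = n} = {}" using False by blast
  then show ?thesis by (simp only: finite.emptyI)
qed

text \<open>The sublattice given by \<open>m\<close> and an ideal of norm \<open>N\<close> has
  index \<open>(m\<^sup>2 N)\<^sup>2\<close>.\<close>

lemma num_ssl_eq: "num_ssl j = card {x \<in> {1..} \<times> primitive_RI. (fst x)\<^sup>2 * ideal_norm (snd x) = j}"
  unfolding num_ssl_def card_ssl_A4 by (simp only: power2_eq_iff_nonneg le0)

lemma num_ssl_pr_eq: "num_ssl_pr j = card {J \<in> primitive_RI. ideal_norm J = j}"
proof -
  have idx: "group_index A4 (ssl_A4_of (1, J)) = (ideal_norm J)\<^sup>2" if "J \<in> primitive_RI" for J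
    using group_index_ssl_L_of[of 1 J] that by (simp add: group_index_ssl_A4_of)
  have "{\<Lambda>. primitive_ssl A4 \<Lambda> \<and> group_index A4 \<Lambda> = j\<^sup>2} = (\<lambda>J. ssl_A4_of (1, J)) ` {J \<in> primitive_RI. ideal_norm J = j}"
    unfolding primitive_ssl_iff using idx by auto
  moreover have "inj_on (\<lambda>J. ssl_A4_of (1, J)) {J \<in> primitive_RI. ideal_norm J = j}"
    using bij_betw_imp_inj_on[OF bij_betw_primitive] by (rule inj_on_subset) auto
  ultimately show ?thesis unfolding num_ssl_pr_def by (simp add: card_image)
qed

lemma ssl_series:
  assumes s: "Re s > 1"
  shows "ssl_term s summable_on {1..}"
    and "D_A4 s = zeta (4 * s) * zeta_icosian_pr s"
proof -
  let ?h = "\<lambda>x. (fst x)\<^sup>2 * ideal_norm (snd x)"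
  let ?F = "\<lambda>(m, J). dterm (4 * s) m * dterm s (group_index UNIV J)"
  have s4: "Re (4 * s) > 1" using s by simp
  have X: "?F summable_on ({1..} \<times> primitive_RI)" "infsum ?F ({1..} \<times> primitive_RI) = zeta (4 * s) * zeta_icosian_pr s"
    using infsum_times[OF dterm_summable[OF s4] zeta_ideals_primitive(1)[OF s]]
    by (simp_all add: zeta_eq zeta_icosian_pr_eq)
  have F: "?F x = dterm (2 * s) (?h x)" if x: "x \<in> {1..} \<times> primitive_RI" for x
  proof -
    obtain m J where x: "x = (m, J)" "m \<ge> 1" "J \<in> primitive_RI" using x by (cases x) auto
    then have "group_index UNIV J = (ideal_norm J)\<^sup>2" using primitive_RI_subset group_index_nonzero_RI by blast
    then show ?thesis using dterm_power[of 2 s "ideal_norm J"] dterm_power[of 2 "2 * s" m] by (simp add: x dterm_mult)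
  qed
  have im: "?h x \<in> {1..}" if "x \<in> {1..} \<times> primitive_RI" for x
    using that ideal_norm_pos primitive_RI_subset by (auto simp: Suc_le_eq)
  have fin: "finite {x \<in> {1..} \<times> primitive_RI. ?h x = j}" if "j \<in> {1..}" for j
    using finite_pairs that by simp
  have st: "of_nat (card {x \<in> {1..} \<times> primitive_RI. ?h x = j}) * dterm (2 * s) j = ssl_term s j" for j
    by (simp add: ssl_term_def num_ssl_eq dterm_def)
  note c = infsum_constant_on_fibres[where h = ?h and g = "dterm (2 * s)", OF im fin, unfolded st]
  have "(\<lambda>x. dterm (2 * s) (?h x)) summable_on ({1..} \<times> primitive_RI)"
    using X(1) summable_on_cong[of "{1..} \<times> primitive_RI" ?F "\<lambda>x. dterm (2 * s) (?h x)"] F by blast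
  then show "ssl_term s summable_on {1..}" using c(1) by simp
  have "zeta (4 * s) * zeta_icosian_pr s = infsum (\<lambda>x. dterm (2 * s) (?h x)) ({1..} \<times> primitive_RI)"
    unfolding X(2)[symmetric] using F by (rule infsum_cong)
  then show "D_A4 s = zeta (4 * s) * zeta_icosian_pr s" by (simp only: D_A4_def c(2))
qed

lemma ssl_pr_series:
  assumes s: "Re s > 1"
  shows "ssl_pr_term s summable_on {1..}"
    and "D_A4_pr s = zeta_icosian_pr s"
proof -
  have F: "dterm s (group_index UNIV J) = dterm (2 * s) (ideal_norm J)" if "J \<in> primitive_RI" for J
  proof -
    have "group_index UNIV J = (ideal_norm J)\<^sup>2" using that primitive_RI_subset group_index_nonzero_RI by blast
    then show ?thesis using dterm_power[of 2 s "ideal_norm J"] by simp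
  qed
  have im: "ideal_norm J \<in> {1..}" if "J \<in> primitive_RI" for J
    using that ideal_norm_pos primitive_RI_subset by (auto simp: Suc_le_eq)
  have fin: "finite {J \<in> primitive_RI. ideal_norm J = j}" if "j \<in> {1..}" for j
    using finite_ideal_norm[of j] that primitive_RI_subset by (auto intro: finite_subset[rotated])
  have st: "of_nat (card {J \<in> primitive_RI. ideal_norm J = j}) * dterm (2 * s) j = ssl_pr_term s j" for j
    by (simp add: ssl_pr_term_def num_ssl_pr_eq dterm_def)
  note c = infsum_constant_on_fibres[where h = ideal_norm and g = "dterm (2 * s)", OF im fin, unfolded st]
  have "(\<lambda>J. dterm (2 * s) (ideal_norm J)) summable_on primitive_RI"
    using zeta_ideals_primitive(1)[OF s] summable_on_cong[of primitive_RI "\<lambda>J. dterm s (group_index UNIV J)" "\<lambda>J. dterm (2 * s) (ideal_norm J)"] F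
    by blast
  then show "ssl_pr_term s summable_on {1..}" using c(1) by simp
  have "zeta_icosian_pr s = infsum (\<lambda>J. dterm (2 * s) (ideal_norm J)) primitive_RI"
    unfolding zeta_icosian_pr_eq using F by (rule infsum_cong)
  then show "D_A4_pr s = zeta_icosian_pr s" by (simp only: D_A4_pr_def c(2))
qed

theorem theorem1:
  shows
    "(\<forall>n. finite {\<Lambda>. ssl A4 \<Lambda> \<and> group_index A4 \<Lambda> = n} \<and>
          finite {\<Lambda>. ssl L_lattice \<Lambda> \<and> group_index L_lattice \<Lambda> = n} \<and>
          card {\<Lambda>. ssl A4 \<Lambda> \<and> group_index A4 \<Lambda> = n} =
          card {\<Lambda>. ssl L_lattice \<Lambda> \<and> group_index L_lattice \<Lambda> = n})
     \<and> (\<forall>k l :: int. real_of_int (k\<^sup>2 + k * l - l\<^sup>2) = K_norm (real_of_int k + real_of_int l * tau))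
     \<and> {group_index A4 \<Lambda> | \<Lambda>. ssl A4 \<Lambda>} =
         {n. \<exists>k l :: int. k\<^sup>2 + k * l - l\<^sup>2 \<noteq> 0 \<and> int n = (k\<^sup>2 + k * l - l\<^sup>2)\<^sup>2}
     \<and> (\<exists>\<phi>. bij_betw \<phi> {\<Lambda>. primitive_ssl A4 \<Lambda>} {I. primitive_right_ideal I} \<and>
            (\<forall>\<Lambda>. primitive_ssl A4 \<Lambda> \<longrightarrow> group_index icosians (\<phi> \<Lambda>) = group_index A4 \<Lambda>))
     \<and> (\<forall>s::complex. Re s > 1 \<longrightarrow>
          ssl_term s summable_on {1..} \<and>
          ssl_pr_term s summable_on {1..} \<and>
          ideal_term s summable_on {I. right_ideal I \<and> I \<noteq> {0}} \<and>
          ideal_term s summable_on {I. primitive_right_ideal I} \<and>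
          D_A4 s = zeta (4 * s) * (zeta_icosian s / zeta_K (4 * s)) \<and>
          zeta (4 * s) * (zeta_icosian s / zeta_K (4 * s)) =
            zeta_K (2 * s) * zeta_K (2 * s - 1) / L_chi5 (4 * s) \<and>
          D_A4_pr s = zeta_icosian_pr s \<and>
          zeta_icosian_pr s = zeta_icosian s / zeta_K (4 * s) \<and>
          zeta_icosian s / zeta_K (4 * s) =
            zeta_K (2 * s) * zeta_K (2 * s - 1) / zeta_K (4 * s))
     \<and> (\<forall>\<Lambda>. ssl A4 \<Lambda> \<longrightarrow>
          (\<exists>\<Lambda>'. primitive_ssl A4 \<Lambda>' \<and> group_index A4 \<Lambda>' = group_index A4 \<Lambda>))"
proof (intro conjI)
  show "\<forall>n. finite {\<Lambda>. ssl A4 \<Lambda> \<and> group_index A4 \<Lambda> = n} \<and>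
          finite {\<Lambda>. ssl L_lattice \<Lambda> \<and> group_index L_lattice \<Lambda> = n} \<and>
          card {\<Lambda>. ssl A4 \<Lambda> \<and> group_index A4 \<Lambda> = n} =
          card {\<Lambda>. ssl L_lattice \<Lambda> \<and> group_index L_lattice \<Lambda> = n}"
    unfolding finite_ssl_A4 finite_ssl_L card_ssl_A4 card_ssl_L using finite_pairs_square by blast
  show "\<forall>k l :: int. real_of_int (k\<^sup>2 + k * l - l\<^sup>2) = K_norm (real_of_int k + real_of_int l * tau)"
    using K_norm_eq by blast
  have idx: "group_index A4 (ssl_A4_of (m, J)) = (m\<^sup>2 * ideal_norm J)\<^sup>2" if "m \<ge> 1" "J \<in> primitive_RI" for m J
    using group_index_ssl_L_of that by (simp add: group_index_ssl_A4_of)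
  have ssl_I: "ssl A4 (ssl_A4_of (m, J))" if "m \<ge> 1" "J \<in> primitive_RI" for m J
    using bij_betw_imp_surj_on[OF bij_betw_ssl_A4_of] that by auto
  show "{group_index A4 \<Lambda> | \<Lambda>. ssl A4 \<Lambda>} =
         {n. \<exists>k l :: int. k\<^sup>2 + k * l - l\<^sup>2 \<noteq> 0 \<and> int n = (k\<^sup>2 + k * l - l\<^sup>2)\<^sup>2}"
  proof (intro equalityI subsetI)
    fix n assume "n \<in> {group_index A4 \<Lambda> | \<Lambda>. ssl A4 \<Lambda>}"
    then obtain m J where mJ: "m \<ge> 1" "J \<in> primitive_RI" "n = (m\<^sup>2 * ideal_norm J)\<^sup>2" using ssl_A4_E idx by blast
    obtain c where c: "c \<noteq> 0" "int (m\<^sup>2 * ideal_norm J) = nz c" using index_as_norm[OF mJ(1,2)] by blast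
    have "nz c \<noteq> 0" using c(1) by simp
    moreover have "int n = (nz c)\<^sup>2" unfolding c(2)[symmetric] mJ(3) by simp
    ultimately show "n \<in> {n. \<exists>k l :: int. k\<^sup>2 + k * l - l\<^sup>2 \<noteq> 0 \<and> int n = (k\<^sup>2 + k * l - l\<^sup>2)\<^sup>2}"
      unfolding nz_def by blast
  next
    fix n assume "n \<in> {n. \<exists>k l :: int. k\<^sup>2 + k * l - l\<^sup>2 \<noteq> 0 \<and> int n = (k\<^sup>2 + k * l - l\<^sup>2)\<^sup>2}"
    then obtain k l where kl: "nz (ZT k l) \<noteq> 0" "int n = (nz (ZT k l))\<^sup>2" by (auto simp: nz_def)
    then obtain J where J: "J \<in> primitive_RI" "ideal_norm J = nat \<bar>nz (ZT k l)\<bar>" using ideal_norm_prim_exists[of "ZT k l"] by auto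
    have "int n = int ((1\<^sup>2 * ideal_norm J)\<^sup>2)" unfolding J(2) kl(2) by simp
    then have "n = group_index A4 (ssl_A4_of (1, J))" using idx[OF _ J(1), of 1] by simp
    then show "n \<in> {group_index A4 \<Lambda> | \<Lambda>. ssl A4 \<Lambda>}" using ssl_I[OF _ J(1), of 1] by auto
  qed
  show "\<exists>\<phi>. bij_betw \<phi> {\<Lambda>. primitive_ssl A4 \<Lambda>} {I. primitive_right_ideal I} \<and>
            (\<forall>\<Lambda>. primitive_ssl A4 \<Lambda> \<longrightarrow> group_index icosians (\<phi> \<Lambda>) = group_index A4 \<Lambda>)"
  proof (intro exI conjI allI impI)
    let ?g = "the_inv_into primitive_RI (\<lambda>J. ssl_A4_of (1, J))"
    show "bij_betw ((`) emb \<circ> ?g) {\<Lambda>. primitive_ssl A4 \<Lambda>} {I. primitive_right_ideal I}"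
      by (rule bij_betw_trans[OF bij_betw_the_inv_into[OF bij_betw_primitive] bij_betw_primitive_RI])
    fix \<Lambda> assume "primitive_ssl A4 \<Lambda>"
    then obtain J where J: "J \<in> primitive_RI" "\<Lambda> = ssl_A4_of (1, J)" unfolding primitive_ssl_iff by blast
    have "?g \<Lambda> = J"
      unfolding J(2) by (rule the_inv_into_f_f[OF bij_betw_imp_inj_on[OF bij_betw_primitive] J(1)])
    moreover have "group_index UNIV J = (ideal_norm J)\<^sup>2" using J(1) primitive_RI_subset group_index_nonzero_RI by blast
    ultimately show "group_index icosians (((`) emb \<circ> ?g) \<Lambda>) = group_index A4 \<Lambda>"
      using idx[OF _ J(1), of 1] by (simp add: J(2) emb_range group_index_emb)
  qed
  show "\<forall>s::complex. Re s > 1 \<longrightarrow>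
          ssl_term s summable_on {1..} \<and>
          ssl_pr_term s summable_on {1..} \<and>
          ideal_term s summable_on {I. right_ideal I \<and> I \<noteq> {0}} \<and>
          ideal_term s summable_on {I. primitive_right_ideal I} \<and>
          D_A4 s = zeta (4 * s) * (zeta_icosian s / zeta_K (4 * s)) \<and>
          zeta (4 * s) * (zeta_icosian s / zeta_K (4 * s)) =
            zeta_K (2 * s) * zeta_K (2 * s - 1) / L_chi5 (4 * s) \<and>
          D_A4_pr s = zeta_icosian_pr s \<and>
          zeta_icosian_pr s = zeta_icosian s / zeta_K (4 * s) \<and>
          zeta_icosian s / zeta_K (4 * s) =
            zeta_K (2 * s) * zeta_K (2 * s - 1) / zeta_K (4 * s)"
  proof (intro allI impI)
    fix s :: complex assume s: "Re s > 1"
    have s4: "Re (4 * s) > 4" using s by simp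
    have nz: "zeta (4 * s) \<noteq> 0" "L_chi5 (4 * s) \<noteq> 0" "zeta_K (4 * s) \<noteq> 0"
      using zeta_nonzero[OF s4] L_chi5_nonzero[OF s4] by (simp_all add: zeta_K_def)
    have zI: "zeta_icosian s = zeta_K (2 * s) * zeta_K (2 * s - 1)"
      unfolding zeta_icosian_eq by (rule zeta_ideals(2)[OF s])
    have "zeta_icosian s = zeta_K (4 * s) * zeta_icosian_pr s"
      unfolding zeta_icosian_eq zeta_icosian_pr_eq by (rule zeta_ideals_primitive(2)[OF s])
    then have pr: "zeta_icosian_pr s = zeta_icosian s / zeta_K (4 * s)" using nz(3) by simp
    have "zeta (4 * s) * (zeta_icosian s / zeta_K (4 * s)) = zeta_icosian s / L_chi5 (4 * s)"
      using nz(1) by (simp add: zeta_K_def)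
    then show "ssl_term s summable_on {1..} \<and>
          ssl_pr_term s summable_on {1..} \<and>
          ideal_term s summable_on {I. right_ideal I \<and> I \<noteq> {0}} \<and>
          ideal_term s summable_on {I. primitive_right_ideal I} \<and>
          D_A4 s = zeta (4 * s) * (zeta_icosian s / zeta_K (4 * s)) \<and>
          zeta (4 * s) * (zeta_icosian s / zeta_K (4 * s)) =
            zeta_K (2 * s) * zeta_K (2 * s - 1) / L_chi5 (4 * s) \<and>
          D_A4_pr s = zeta_icosian_pr s \<and>
          zeta_icosian_pr s = zeta_icosian s / zeta_K (4 * s) \<and>
          zeta_icosian s / zeta_K (4 * s) =
            zeta_K (2 * s) * zeta_K (2 * s - 1) / zeta_K (4 * s)"
      using ssl_series[OF s] ssl_pr_series[OF s] zeta_ideals(1)[OF s] zeta_ideals_primitive(1)[OF s] pr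
      by (simp only: ideal_term_summable ideal_term_pr_summable zI simp_thms)
  qed
  show "\<forall>\<Lambda>. ssl A4 \<Lambda> \<longrightarrow>
          (\<exists>\<Lambda>'. primitive_ssl A4 \<Lambda>' \<and> group_index A4 \<Lambda>' = group_index A4 \<Lambda>)"
  proof (intro allI impI)
    fix \<Lambda> assume "ssl A4 \<Lambda>"
    then obtain m J where mJ: "\<Lambda> = ssl_A4_of (m, J)" "m \<ge> 1" "J \<in> primitive_RI" using ssl_A4_E by blast
    obtain c where c: "c \<noteq> 0" "int (m\<^sup>2 * ideal_norm J) = nz c" using index_as_norm[OF mJ(2,3)] by blast
    obtain K where K: "K \<in> primitive_RI" "ideal_norm K = nat \<bar>nz c\<bar>" using ideal_norm_prim_exists[OF c(1)] by blast
    have "ideal_norm K = m\<^sup>2 * ideal_norm J" unfolding K(2) c(2)[symmetric] by (simp only: nat_int abs_of_nat)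
    then have "group_index A4 (ssl_A4_of (1, K)) = group_index A4 \<Lambda>"
      using idx[OF _ K(1), of 1] idx[OF mJ(2,3)] by (simp add: mJ(1))
    then show "\<exists>\<Lambda>'. primitive_ssl A4 \<Lambda>' \<and> group_index A4 \<Lambda>' = group_index A4 \<Lambda>"
      using K(1) unfolding primitive_ssl_iff by blast
  qed
qed

end
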